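(* Let $\underline{y}>0$, $n\geq 1$ an integer, and $0<\varepsilon<\min\{\underline{y}/(n+1),1\}$. Let $X$ be a Lévy process with triplet $(\sigma^2,b,\nu)$ such that $\nu$ has a density $s:\mathbb{R}\setminus\{0\}\to[0,\infty)$ satisfying, for every integer $0\leq k\leq 2n+1$ and every $\delta>0$, $$a_{k,\delta}:=\sup_{|x|>\delta}|s^{(k)}(x)|<\infty .$$ Then there exists $t_0>0$ such that, for all $y\geq\underline{y}$ and $0<t<t_0$, $$\mathbb{P}(X_t\geq y)=e^{-\lambda_\varepsilon t}\sum_{j=1}^{n}c_j\,\frac{t^j}{j!}+O_{\varepsilon,\underline{y}}(t^{n+1}),$$ where $$c_j:=\sum_{i=1}^{j}\binom{j}{i}\,(L_\varepsilon^{j-i}\hat f_i)(0),\qquad \hat f_i(x):=\int_{y-x}^{\infty}\bar s_\varepsilon^{*i}(u)\,du .$$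
   Context: A Lévy process $X=(X_t)_{t\ge0}$ has triplet $(\sigma^2,b,\nu)$ if $X_t=bt+\sigma W_t+\int_0^t\int_{|x|\le1}x\,(\mu-\bar\mu)(dx,ds)+\int_0^t\int_{|x|>1}x\,\mu(dx,ds)$, where $W$ is a standard Brownian motion and $\mu$ is an independent Poisson random measure on $\mathbb{R}_+\times(\mathbb{R}\setminus\{0\})$ with mean measure $\bar\mu(dx,dt)=\nu(dx)\,dt$, $\nu$ being a Lévy measure ($\int\min(1,x^2)\,\nu(dx)<\infty$). Fix a truncation function $c_\varepsilon\in C^\infty(\mathbb{R})$ with $\mathbf 1_{[-\varepsilon/2,\varepsilon/2]}\le c_\varepsilon\le\mathbf 1_{[-\varepsilon,\varepsilon]}$ and put $\bar c_\varepsilon:=1-c_\varepsilon$, $s_\varepsilon:=c_\varepsilon s$, $\bar s_\varepsilon:=\bar c_\varepsilon s$ (with $\bar s_\varepsilon(0):=0$), $\lambda_\varepsilon:=\int\bar c_\varepsilon(x)\,\nu(dx)$, $b_\varepsilon:=b-\int_{|x|\le1}x\,\bar c_\varepsilon(x)\,\nu(dx)$. Convolution powers: $\bar s_\varepsilon^{*1}=\bar s_\varepsilon$ and $\bar s_\varepsilon^{*i}(x)=\int\bar s_\varepsilon^{*(i-1)}(x-u)\,\bar s_\varepsilon(u)\,du$ for $i\ge2$. The operator $L_\varepsilon$ is $$(L_\varepsilon g)(x)=b_\varepsilon g'(x)+\frac{\sigma^2}{2}g''(x)+\int\int_0^1 g''(x+\beta w)(1-\beta)\,d\beta\,w^2c_\varepsilon(w)s(w)\,dw,$$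 with $L_\varepsilon^0g=g$ and $L_\varepsilon^{k}=L_\varepsilon\circ L_\varepsilon^{k-1}$. $O_{\varepsilon,\underline{y}}(t^{n+1})$ denotes a term bounded in absolute value by $Ct^{n+1}$ with a constant $C$ that may depend on $\varepsilon$ and $\underline{y}$ (and on $X$, $n$, $c_\varepsilon$), but not on $y\ge\underline{y}$ or $t\in(0,t_0)$. *)

theory Defs
  imports "HOL-Probability.Probability"
begin

definition independent_increments :: "'w measure \<Rightarrow> (real \<Rightarrow> 'w \<Rightarrow> real) \<Rightarrow> bool" where
  "independent_increments M X \<longleftrightarrow>
     (\<forall>(k::nat) (\<tau>::nat \<Rightarrow> real). 0 \<le> \<tau> 0 \<and> mono \<tau> \<longrightarrow>
        prob_space.indep_vars M (\<lambda>_. borel) (\<lambda>i \<omega>. X (\<tau> (Suc i)) \<omega> - X (\<tau> i) \<omega>) {..<k})"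

definition cadlag :: "(real \<Rightarrow> real) \<Rightarrow> bool" where
  "cadlag f \<longleftrightarrow> (\<forall>t\<ge>0. continuous (at_right t) f) \<and> (\<forall>t>0. \<exists>l. (f \<longlongrightarrow> l) (at_left t))"

definition levy_process :: "'w measure \<Rightarrow> (real \<Rightarrow> 'w \<Rightarrow> real) \<Rightarrow> bool" where
  "levy_process M X \<longleftrightarrow>
     prob_space M \<and>
     (\<forall>t\<ge>0. X t \<in> borel_measurable M) \<and>
     (AE \<omega> in M. X 0 \<omega> = 0) \<and>
     independent_increments M X \<and>
     (\<forall>t\<ge>0. \<forall>h\<ge>0. distr M borel (\<lambda>\<omega>. X (t + h) \<omega> - X t \<omega>) = distr M borel (X h)) \<and>
     (AE \<omega> in M. cadlag (\<lambda>t. X t \<omega>))"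

definition standard_brownian_motion :: "'w measure \<Rightarrow> (real \<Rightarrow> 'w \<Rightarrow> real) \<Rightarrow> bool" where
  "standard_brownian_motion M W \<longleftrightarrow>
     prob_space M \<and>
     (\<forall>t\<ge>0. W t \<in> borel_measurable M) \<and>
     (AE \<omega> in M. W 0 \<omega> = 0) \<and>
     independent_increments M W \<and>
     (\<forall>r\<ge>0. \<forall>t>r. distributed M lborel (\<lambda>\<omega>. W t \<omega> - W r \<omega>)
                       (\<lambda>x. ennreal (normal_density 0 (sqrt (t - r)) x))) \<and>
     (AE \<omega> in M. continuous_on {0..} (\<lambda>t. W t \<omega>))"

definition poisson_random_measure :: "'w measure \<Rightarrow> 'e measure \<Rightarrow> ('w \<Rightarrow> 'e measure) \<Rightarrow> bool" where
  "poisson_random_measure M N \<mu> \<longleftrightarrow>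
     prob_space M \<and>
     (\<forall>\<omega>\<in>space M. sets (\<mu> \<omega>) = sets N) \<and>
     (\<forall>A\<in>sets N. (\<lambda>\<omega>. emeasure (\<mu> \<omega>) A) \<in> borel_measurable M) \<and>
     (\<forall>A\<in>sets N. emeasure N A < \<infinity> \<longrightarrow>
        (\<forall>k::nat. measure M {\<omega>\<in>space M. emeasure (\<mu> \<omega>) A = of_nat k}
                    = exp (- measure N A) * measure N A ^ k / fact k)) \<and>
     (\<forall>A\<in>sets N. emeasure N A = \<infinity> \<longrightarrow> (AE \<omega> in M. emeasure (\<mu> \<omega>) A = \<infinity>)) \<and>
     (\<forall>(k::nat) A. (\<forall>i<k. A i \<in> sets N) \<and> disjoint_family_on A {..<k} \<longrightarrow>
        prob_space.indep_vars M (\<lambda>_. borel) (\<lambda>i \<omega>. emeasure (\<mu> \<omega>) (A i)) {..<k})"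

definition independent_process_random_measure ::
    "'w measure \<Rightarrow> (real \<Rightarrow> 'w \<Rightarrow> real) \<Rightarrow> 'e measure \<Rightarrow> ('w \<Rightarrow> 'e measure) \<Rightarrow> bool" where
  "independent_process_random_measure M W N \<mu> \<longleftrightarrow>
     prob_space.indep_set M
       (sigma_sets (space M) {W t -` B \<inter> space M | t B. t \<ge> 0 \<and> B \<in> sets borel})
       (sigma_sets (space M) {(\<lambda>\<omega>. emeasure (\<mu> \<omega>) A) -` B \<inter> space M | A B.
                                 A \<in> sets N \<and> B \<in> sets borel})"

text \<open>A measure on the punctured line is represented by a Borel measure on the line that does
  not charge the origin.\<close>

definition levy_measure :: "real measure \<Rightarrow> bool" where
  "levy_measure \<nu> \<longleftrightarrow>
     sets \<nu> = sets borel \<and> emeasure \<nu> {0} = 0 \<and> (\<integral>\<^sup>+x. ennreal (min 1 (x\<^sup>2)) \<partial>\<nu>) < \<infinity>"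

definition jump_mean_measure :: "real measure \<Rightarrow> (real \<times> real) measure" where
  "jump_mean_measure \<nu> = restrict_space lborel {0..} \<Otimes>\<^sub>M \<nu>"

text \<open>\<open>Z\<close> is a version of the integral of \<open>x\<close> over \<open>(0,t] \<times> {\<bar>x\<bar> \<le> 1}\<close> against the compensated
  measure: since \<open>x\<close> need not be integrable near the origin against \<open>\<mu>\<close> or its mean, the
  integral is, as usual, the mean-square limit of the integrals over \<open>{\<delta> < \<bar>x\<bar> \<le> 1}\<close>.\<close>

definition is_compensated_small_jumps ::
    "'w measure \<Rightarrow> real measure \<Rightarrow> ('w \<Rightarrow> (real \<times> real) measure) \<Rightarrow> real \<Rightarrow> ('w \<Rightarrow> real) \<Rightarrow> bool" where
  "is_compensated_small_jumps M \<nu> \<mu> t Z \<longleftrightarrow>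
     Z \<in> borel_measurable M \<and>
     ((\<lambda>\<delta>. \<integral>\<^sup>+\<omega>. ennreal
         (((LINT p:{0<..t} \<times> {x. \<delta> < \<bar>x\<bar> \<and> \<bar>x\<bar> \<le> 1}|\<mu> \<omega>. snd p)
           - (LINT p:{0<..t} \<times> {x. \<delta> < \<bar>x\<bar> \<and> \<bar>x\<bar> \<le> 1}|jump_mean_measure \<nu>. snd p)
           - Z \<omega>)\<^sup>2) \<partial>M) \<longlongrightarrow> 0) (at_right 0)"

text \<open>The first parameter of the triplet is the variance. Stochastic integrals are determined
  up to null sets only, so the decomposition is required almost surely for each time.\<close>

definition has_levy_triplet ::
    "'w measure \<Rightarrow> (real \<Rightarrow> 'w \<Rightarrow> real) \<Rightarrow> real \<Rightarrow> real \<Rightarrow> real measure \<Rightarrow> bool" where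
  "has_levy_triplet M X v b \<nu> \<longleftrightarrow>
     levy_measure \<nu> \<and>
     (\<exists>\<sigma> W \<mu> Z. \<sigma> \<ge> 0 \<and> v = \<sigma>\<^sup>2 \<and>
        standard_brownian_motion M W \<and>
        poisson_random_measure M (jump_mean_measure \<nu>) \<mu> \<and>
        independent_process_random_measure M W (jump_mean_measure \<nu>) \<mu> \<and>
        (\<forall>t\<ge>0. is_compensated_small_jumps M \<nu> \<mu> t (Z t)) \<and>
        (\<forall>t\<ge>0. AE \<omega> in M. X t \<omega> =
           b * t + \<sigma> * W t \<omega> + Z t \<omega> + (LINT p:{0<..t} \<times> {x. \<bar>x\<bar> > 1}|\<mu> \<omega>. snd p)))"

definition smooth_fun :: "(real \<Rightarrow> real) \<Rightarrow> bool" where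
  "smooth_fun f \<longleftrightarrow> (\<forall>k x. (deriv ^^ k) f field_differentiable at x)"

definition truncation_function :: "real \<Rightarrow> (real \<Rightarrow> real) \<Rightarrow> bool" where
  "truncation_function \<epsilon> c \<longleftrightarrow> smooth_fun c \<and>
     (\<forall>x. indicator {- \<epsilon> / 2..\<epsilon> / 2} x \<le> c x \<and> c x \<le> indicator {- \<epsilon>..\<epsilon>} x)"

text \<open>A density on the punctured line is a total function whose value at 0 is irrelevant.\<close>

definition sbar :: "(real \<Rightarrow> real) \<Rightarrow> (real \<Rightarrow> real) \<Rightarrow> real \<Rightarrow> real" where
  "sbar c s x = (if x = 0 then 0 else (1 - c x) * s x)"

definition lambda_eps :: "(real \<Rightarrow> real) \<Rightarrow> real measure \<Rightarrow> real" where
  "lambda_eps c \<nu> = (LINT x|\<nu>. 1 - c x)"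

definition b_eps :: "(real \<Rightarrow> real) \<Rightarrow> real \<Rightarrow> real measure \<Rightarrow> real" where
  "b_eps c b \<nu> = b - (LINT x:{-1..1}|\<nu>. x * (1 - c x))"

text \<open>Only the powers \<open>i \<ge> 1\<close> are meaningful; the value at \<open>i = 0\<close> is never used.\<close>

fun conv_power :: "(real \<Rightarrow> real) \<Rightarrow> nat \<Rightarrow> real \<Rightarrow> real" where
  "conv_power f 0 = (\<lambda>x. 0)"
| "conv_power f (Suc 0) = f"
| "conv_power f (Suc (Suc i)) = (\<lambda>x. LBINT u. conv_power f (Suc i) (x - u) * f u)"

definition L_eps ::
    "(real \<Rightarrow> real) \<Rightarrow> (real \<Rightarrow> real) \<Rightarrow> real \<Rightarrow> real \<Rightarrow> real measure \<Rightarrow> (real \<Rightarrow> real) \<Rightarrow> real \<Rightarrow> real" where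
  "L_eps c s v b \<nu> g x =
     b_eps c b \<nu> * deriv g x + v / 2 * (deriv ^^ 2) g x
     + (LBINT w. (LBINT \<beta>:{0..1}. (deriv ^^ 2) g (x + \<beta> * w) * (1 - \<beta>)) * w\<^sup>2 * c w * s w)"

definition f_hat :: "(real \<Rightarrow> real) \<Rightarrow> (real \<Rightarrow> real) \<Rightarrow> real \<Rightarrow> nat \<Rightarrow> real \<Rightarrow> real" where
  "f_hat c s y i x = (LBINT u:{y - x..}. conv_power (sbar c s) i u)"

definition expansion_coeff ::
    "(real \<Rightarrow> real) \<Rightarrow> (real \<Rightarrow> real) \<Rightarrow> real \<Rightarrow> real \<Rightarrow> real measure \<Rightarrow> real \<Rightarrow> nat \<Rightarrow> real" where
  "expansion_coeff c s v b \<nu> y j =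
     (\<Sum>i=1..j. real (j choose i) * (L_eps c s v b \<nu> ^^ (j - i)) (f_hat c s y i) 0)"

end

theory Submission
  imports Defs
begin

text \<open>The law of \<open>X\<^sub>t\<close> is a weak limit of laws \<open>P\<^sub>m\<close> of compound Poisson variables with Levy density
  \<open>r\<^sub>m + sbar\<close>, where \<open>r\<^sub>m\<close> is a bounded-support density imitating drift, Brownian part and small jumps;
  this follows from the characteristic functions and spares the construction of the small-jump process.
  Counting the jumps coming from \<open>sbar\<close> gives
  \<open>P\<^sub>m(y, \<infinity>) = exp(-\<lambda>t) (\<Sum>k. t^k/k! E (f_hat k) (Y\<^sub>t))\<close> with \<open>Y\<close> compound Poisson with density \<open>r\<^sub>m\<close>.
  For \<open>1 \<le> k \<le> n\<close> each expectation is expanded by Taylor's formula in \<open>t\<close> with the bounded generator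
  \<open>A\<^sub>m\<close> of \<open>Y\<close>. The powers of \<open>A\<^sub>m\<close> lose two derivatives each, are bounded uniformly in \<open>m\<close> and converge to
  those of \<open>L_eps\<close>. The term \<open>k = 0\<close> is \<open>O(t^(n+1))\<close> since \<open>n\<close> jumps of size at most \<open>\<epsilon>\<close> do not reach \<open>y\<close>.
  All bounds are uniform in \<open>m\<close> and in \<open>y > (n+1)\<epsilon>\<close>, so they survive the limit at points that
  are not atoms, and left limits remove this restriction.\<close>

section \<open>Functions with bounded derivatives\<close>

text \<open>The total masses of the approximating densities may blow up, so the operator norm of the
  generator gives nothing. Once the generator is written in compensated form, with its first moment
  kept exactly equal to the drift, only the drift and the second moment of the density enter its
  size. Both stay bounded; the price is two derivatives. Convergence of the generators costs one
  more, through a Taylor bound of third order. The term without large jumps involves the indicator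
  of a half-line, to which no generator estimate applies. It is replaced by a smooth majorant that
  is 0 up to n * \<epsilon> and 1 beyond (n + 1) * \<epsilon>. The first n generator powers of the
  majorant vanish at 0, so that Taylor's formula leaves only the remainder. This is where the
  restriction on \<epsilon> is spent. Convergence of the generators serves twice: for the
  coefficients, and, applied to trigonometric functions, for the exponents of the characteristic
  functions. \<open>Cb\<close> carries a single bound for all orders, so that every operator
  estimate is tracked by one constant.\<close>

fun Cb :: "real set \<Rightarrow> nat \<Rightarrow> real \<Rightarrow> (real \<Rightarrow> real) \<Rightarrow> bool" where
  "Cb S 0 B g \<longleftrightarrow> continuous_on S g \<and> (\<forall>x\<in>S. \<bar>g x\<bar> \<le> B)"
| "Cb S (Suc k) B g \<longleftrightarrow> (\<forall>x\<in>S. g field_differentiable at x \<and> \<bar>g x\<bar> \<le> B) \<and> Cb S k B (deriv g)"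

lemma Cb_bound: "Cb S k B g \<Longrightarrow> x \<in> S \<Longrightarrow> \<bar>g x\<bar> \<le> B"
  by (cases k) auto

lemma Cb_continuous: "Cb S k B g \<Longrightarrow> continuous_on S g"
  by (cases k) (auto intro!: continuous_at_imp_continuous_on field_differentiable_imp_continuous_at)

lemma Cb_Suc_D: "Cb S (Suc k) B g \<Longrightarrow> Cb S k B g"
proof (induction k arbitrary: g)
  case 0
  then show ?case using Cb_continuous[of S 1 B g] by simp
qed auto

lemma Cb_antimono: "Cb S k B g \<Longrightarrow> j \<le> k \<Longrightarrow> Cb S j B g"
proof (induction k)
  case (Suc k)
  then show ?case using Cb_Suc_D[of S k B g] by (cases "j = Suc k") auto
qed simp

lemma Cb_mono: "Cb S k B g \<Longrightarrow> B \<le> C \<Longrightarrow> T \<subseteq> S \<Longrightarrow> Cb T k C g"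
  by (induction k arbitrary: g) (force intro: continuous_on_subset)+

lemma Cb_funpow: "Cb S (i + k) B g \<Longrightarrow> Cb S k B ((deriv ^^ i) g)"
  by (induction i arbitrary: g) (auto simp del: funpow.simps simp: funpow_Suc_right)

text \<open>Openness matters: \<open>deriv\<close> at a point of \<open>S\<close> depends on a
  neighbourhood, and agreement on an open set covers one.\<close>

lemma Cb_cong:
  assumes "open S" "\<And>x. x \<in> S \<Longrightarrow> f x = g x"
  shows "Cb S k B f \<longleftrightarrow> Cb S k B g"
  using assms(2)
proof (induction k arbitrary: f g)
  case 0
  then show ?case using continuous_on_cong[of S S f g] by simp
next
  case (Suc k)
  have ev: "eventually (\<lambda>z. f z = g z) (nhds x)" if "x \<in> S" for x
    using eventually_nhds_in_open[OF assms(1) that] by eventually_elim (rule Suc.prems)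
  have "deriv f x = deriv g x" if "x \<in> S" for x
    by (rule deriv_cong_ev[OF ev[OF that] refl])
  moreover have "f field_differentiable at x \<longleftrightarrow> g field_differentiable at x" if "x \<in> S" for x
    using DERIV_cong_ev[OF refl ev[OF that] refl] by (auto simp: field_differentiable_def)
  ultimately show ?case using Suc.IH[of "deriv f" "deriv g"] Suc.prems by auto
qed

lemma Cb_add:
  assumes "open S" "Cb S k B f" "Cb S k C g"
  shows "Cb S k (B + C) (\<lambda>x. f x + g x)"
  using assms(2,3)
proof (induction k arbitrary: f g)
  case 0
  then show ?case by (force intro: continuous_on_add)
next
  case (Suc k)
  have "Cb S k (B + C) (\<lambda>x. deriv f x + deriv g x)"
    using Suc by auto
  then have "Cb S k (B + C) (deriv (\<lambda>x. f x + g x))"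
    using Suc.prems by (subst Cb_cong[OF assms(1), where g = "\<lambda>x. deriv f x + deriv g x"]) auto
  then show ?case using Suc.prems by (force intro: field_differentiable_add)
qed

lemma Cb_const: "\<bar>a\<bar> \<le> B \<Longrightarrow> Cb S k B (\<lambda>x. a)"
proof (induction k arbitrary: a)
  case (Suc k)
  then show ?case using Suc.IH[of 0] by (simp add: order_trans[OF abs_ge_zero])
qed auto

text \<open>By the Leibniz rule every differentiation doubles the number of products, each bounded
  by \<open>B * C\<close>; hence the factor \<open>2 ^ k\<close>.\<close>

lemma Cb_mult:
  assumes "open S" "Cb S k B f" "Cb S k C g"
  shows "Cb S k (2 ^ k * (B * C)) (\<lambda>x. f x * g x)"
  using assms(2,3)
proof (induction k arbitrary: f g)
  case 0
  then have "\<bar>f x * g x\<bar> \<le> B * C" if "x \<in> S" for x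
    unfolding abs_mult using that by (intro mult_mono) (auto intro: order_trans[OF abs_ge_zero])
  then show ?case using 0 by (auto intro: continuous_on_mult)
next
  case (Suc k)
  have fg: "Cb S k B f" "Cb S k C g" using Suc.prems by (auto intro: Cb_Suc_D simp del: Cb.simps)
  have "Cb S k (2 ^ k * (B * C) + 2 ^ k * (B * C)) (\<lambda>x. f x * deriv g x + deriv f x * g x)"
    using Suc fg by (intro Cb_add[OF assms(1)]) auto
  then have d: "Cb S k (2 ^ Suc k * (B * C)) (deriv (\<lambda>x. f x * g x))"
    using Suc.prems
    by (subst Cb_cong[OF assms(1), where g = "\<lambda>x. f x * deriv g x + deriv f x * g x"]) (auto simp: mult_2[symmetric] mult.assoc)
  have "\<bar>f x * g x\<bar> \<le> 2 ^ Suc k * (B * C)" if "x \<in> S" for x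
  proof -
    have "\<bar>f x * g x\<bar> \<le> B * C"
      unfolding abs_mult using that Suc.prems by (intro mult_mono) (auto intro: order_trans[OF abs_ge_zero])
    also have "\<dots> \<le> 2 ^ Suc k * (B * C)"
      using mult_right_mono[OF one_le_power[of "2::real" "Suc k"], of "B * C"] \<open>\<bar>f x * g x\<bar> \<le> B * C\<close> by simp
    finally show ?thesis .
  qed
  then show ?case using Suc.prems d by (auto intro: field_differentiable_mult)
qed

lemma Cb_cmult:
  assumes "open S" "Cb S k B f"
  shows "Cb S k (\<bar>a\<bar> * B) (\<lambda>x. a * f x)"
  using assms(2)
proof (induction k arbitrary: f)
  case 0
  then show ?case by (auto simp: abs_mult intro!: mult_left_mono continuous_on_mult)
next
  case (Suc k)
  have "Cb S k (\<bar>a\<bar> * B) (deriv (\<lambda>x. a * f x))"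
    using Suc by (subst Cb_cong[OF assms(1), where g = "\<lambda>x. a * deriv f x"]) auto
  then show ?case using Suc.prems 
    by (auto simp: abs_mult intro!: mult_left_mono field_differentiable_mult)
qed

lemma Cb_diff:
  assumes "open S" "Cb S k B f" "Cb S k C g"
  shows "Cb S k (B + C) (\<lambda>x. f x - g x)"
  using Cb_add[OF assms(1,2) Cb_cmult[OF assms(1,3), of "-1"]] by simp

text \<open>The gluing device: a function is treated by different formulas on overlapping open sets,
  with a common bound.\<close>

lemma Cb_Un:
  assumes "open S" "open T" "Cb S k B g" "Cb T k B g"
  shows "Cb (S \<union> T) k B g"
  using assms(3,4)
  by (induction k arbitrary: g) (auto intro: continuous_on_open_Un[OF assms(1,2)])

text \<open>Each derivative brings out a factor \<open>r\<close>, which for \<bar>r\<bar> \<le> 1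
  does not enlarge the bound. Shifts and reflections are the cases that occur.\<close>

lemma Cb_affine:
  assumes "Cb UNIV k B g" "\<bar>r\<bar> \<le> 1"
  shows "Cb UNIV k B (\<lambda>x. g (a + r * x))"
  using assms(1)
proof (induction k arbitrary: g)
  case 0
  then show ?case by (auto intro!: continuous_on_compose2[of UNIV g] continuous_intros)
next
  case (Suc k)
  have D: "((\<lambda>x. g (a + r * x)) has_field_derivative r * deriv g (a + r * x)) (at x)" for x
  proof -
    have "(g has_field_derivative deriv g (a + r * x)) (at (a + r * x))"
      using Suc.prems by (simp add: DERIV_deriv_iff_field_differentiable)
    moreover have "((\<lambda>x. a + r * x) has_field_derivative r) (at x)"
      by (auto intro!: derivative_eq_intros)
    ultimately show ?thesis using DERIV_chain2 by (fastforce simp: mult.commute)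
  qed
  then have "deriv (\<lambda>x. g (a + r * x)) = (\<lambda>x. r * deriv g (a + r * x))"
    by (intro ext DERIV_imp_deriv)
  moreover have "Cb UNIV k (\<bar>r\<bar> * B) (\<lambda>x. r * deriv g (a + r * x))"
    using Suc by (intro Cb_cmult) auto
  moreover have "\<bar>r\<bar> * B \<le> B"
    using Suc.prems assms(2) by (intro mult_left_le_one_le) (auto intro: order_trans[OF abs_ge_zero])
  ultimately show ?case using D Suc.prems Cb_mono[of UNIV k "\<bar>r\<bar> * B" _ B UNIV]
    by (auto simp: field_differentiable_def)
qed

section \<open>Convolution operators and operators of Levy type\<close>

lemma has_field_derivative_lebesgue_integral:
  fixes F F' :: "real \<Rightarrow> 'b \<Rightarrow> real"
  assumes der: "\<And>x w. ((\<lambda>x. F x w) has_field_derivative F' x w) (at x)"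
    and int: "\<And>x. integrable M (F x)" and meas: "\<And>x. F' x \<in> borel_measurable M"
    and bound: "\<And>x w. \<bar>F' x w\<bar> \<le> G w" and G: "integrable M G"
  shows "((\<lambda>x. LINT w|M. F x w) has_field_derivative (LINT w|M. F' x w)) (at x)"
  unfolding has_field_derivative_iff tendsto_at_iff_sequentially
proof (intro allI impI)
  fix X assume X: "\<forall>i. X i \<in> UNIV - {x}" "X \<longlonglongrightarrow> x"
  \<comment> \<open>The mean value theorem makes \<open>G\<close> a dominating function for all
    difference quotients at once.\<close>
  have lip: "\<bar>F y w - F x w\<bar> \<le> G w * \<bar>y - x\<bar>" for y w
    using field_differentiable_bound[of UNIV "\<lambda>x. F x w" "\<lambda>x. F' x w" "G w" y x] der bound by auto
  have "(\<lambda>i. LINT w|M. (F (X i) w - F x w) / (X i - x)) \<longlonglongrightarrow> (LINT w|M. F' x w)"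
  proof (rule integral_dominated_convergence[where w = G])
    show "AE w in M. (\<lambda>i. (F (X i) w - F x w) / (X i - x)) \<longlonglongrightarrow> F' x w"
    proof (rule AE_I2)
      fix w
      show "(\<lambda>i. (F (X i) w - F x w) / (X i - x)) \<longlonglongrightarrow> F' x w"
        using der[of w x] X unfolding has_field_derivative_iff tendsto_at_iff_sequentially by (auto simp: comp_def)
    qed
    show "AE w in M. norm ((F (X i) w - F x w) / (X i - x)) \<le> G w" for i
      using lip[of "X i"] X by (auto simp: divide_simps)
    show "(\<lambda>w. (F (X i) w - F x w) / (X i - x)) \<in> borel_measurable M" for i
      using int by (intro borel_measurable_divide borel_measurable_diff borel_measurable_const) auto
  qed (use meas G in auto)
  then show "((\<lambda>y. ((LINT w|M. F y w) - (LINT w|M. F x w)) / (y - x)) \<circ> X) \<longlonglongrightarrow> (LINT w|M. F' x w)"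
    by (simp add: comp_def int)
qed

lemma isCont_lebesgue_integral:
  fixes F :: "real \<Rightarrow> 'b \<Rightarrow> real"
  assumes cont: "\<And>w. isCont (\<lambda>x. F x w) x"
    and meas: "\<And>x. F x \<in> borel_measurable M"
    and bound: "\<And>x w. \<bar>F x w\<bar> \<le> G w" and G: "integrable M G"
  shows "isCont (\<lambda>x. LINT w|M. F x w) x"
  unfolding continuous_at_sequentially
proof (intro allI impI)
  fix X assume X: "X \<longlonglongrightarrow> x"
  have "(\<lambda>i. LINT w|M. F (X i) w) \<longlonglongrightarrow> (LINT w|M. F x w)"
    using cont X by (intro integral_dominated_convergence[where w = G])
      (auto simp: meas bound G continuous_at_sequentially comp_def)
  then show "((\<lambda>x. LINT w|M. F x w) \<circ> X) \<longlonglongrightarrow> (LINT w|M. F x w)"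
    by (simp add: comp_def)
qed

text \<open>An operator that commutes with differentiation needs a sup bound and continuity only at
  its lowest admissible order \<open>d\<close>: applied to the derivatives, the same constant
  \<open>K\<close> serves for all higher orders.\<close>

lemma Cb_of_derivation:
  assumes bound: "\<And>g B x. Cb UNIV d B g \<Longrightarrow> \<bar>T g x\<bar> \<le> K * B"
    and cont: "\<And>g B x. Cb UNIV d B g \<Longrightarrow> isCont (T g) x"
    and der: "\<And>g B x. Cb UNIV (Suc d) B g \<Longrightarrow> (T g has_field_derivative T (deriv g) x) (at x)"
  shows "Cb UNIV (d + k) B g \<Longrightarrow> Cb UNIV k (K * B) (T g)"
proof (induction k arbitrary: g)
  case 0
  then show ?case using bound cont by (auto intro: continuous_at_imp_continuous_on)
next
  case (Suc k)
  have d: "(T g has_field_derivative T (deriv g) x) (at x)" for x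
    using Suc.prems Cb_antimono[of UNIV "d + Suc k" B g "Suc d"] der by fastforce
  then have "deriv (T g) = T (deriv g)"
    by (auto intro: DERIV_imp_deriv)
  moreover have "\<bar>T g x\<bar> \<le> K * B" for x
    using bound Cb_antimono[OF Suc.prems, of d] by simp
  moreover have "Cb UNIV k (K * B) (T (deriv g))"
    using Suc.prems by (intro Suc.IH) simp
  ultimately show ?case using d by (auto simp: field_differentiable_def)
qed

text \<open>The argument \<open>x + w\<close> makes this the effect of one jump from
  \<open>x\<close>, weighted by the jump density; it is convolution with the reflected density.
  Iterates describe several jumps.\<close>

definition conv_op :: "(real \<Rightarrow> real) \<Rightarrow> (real \<Rightarrow> real) \<Rightarrow> real \<Rightarrow> real" where
  "conv_op r g x = (LBINT w. r w * g (x + w))"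

lemma integrable_conv_op:
  fixes r g :: "real \<Rightarrow> real"
  assumes r: "integrable lborel r" and g: "g \<in> borel_measurable borel" "\<And>x. \<bar>g x\<bar> \<le> B"
  shows "integrable lborel (\<lambda>w. r w * g (x + w))"
proof (rule Bochner_Integration.integrable_bound[of _ "\<lambda>w. r w * B"])
  have "0 \<le> B" using g(2)[of 0] by simp
  then show "AE w in lborel. norm (r w * g (x + w)) \<le> norm (r w * B)"
    using g(2) by (auto simp: abs_mult intro!: mult_left_mono)
  show "(\<lambda>w. r w * g (x + w)) \<in> borel_measurable lborel"
    using g(1) borel_measurable_integrable[OF r] by measurable
qed (use r in simp)

lemma Cb_measurable: "Cb UNIV k B g \<Longrightarrow> g \<in> borel_measurable borel"
  using Cb_continuous[of UNIV k B g] by (simp add: borel_measurable_continuous_onI)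

lemma Cb_nonneg: "Cb UNIV k B g \<Longrightarrow> 0 \<le> B"
  using Cb_bound[of UNIV k B g 0] by simp

lemma conv_op_bound:
  assumes r: "integrable lborel r" and g: "g \<in> borel_measurable borel" "\<And>x. \<bar>g x\<bar> \<le> B"
  shows "\<bar>conv_op r g x\<bar> \<le> (LBINT w. \<bar>r w\<bar>) * B"
proof -
  have "\<bar>conv_op r g x\<bar> \<le> (LBINT w. \<bar>r w * g (x + w)\<bar>)"
    unfolding conv_op_def by (rule integral_abs_bound)
  also have "\<dots> \<le> (LBINT w. \<bar>r w\<bar> * B)"
    by (intro integral_mono integrable_abs integrable_conv_op[OF assms] integrable_mult_left r)
      (auto simp: abs_mult intro!: mult_left_mono g(2))
  finally show ?thesis by simp
qed

lemma Cb_conv_op: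
  assumes r: "integrable lborel r" and "Cb UNIV k B g"
  shows "Cb UNIV k ((LBINT w. \<bar>r w\<bar>) * B) (conv_op r g)"
proof (rule Cb_of_derivation[where d = 0 and T = "conv_op r"])
  have [measurable]: "r \<in> borel_measurable borel" using borel_measurable_integrable[OF r] by simp
  fix f :: "real \<Rightarrow> real" and B x :: real
  show "Cb UNIV 0 B f \<Longrightarrow> \<bar>conv_op r f x\<bar> \<le> (LBINT w. \<bar>r w\<bar>) * B"
    using conv_op_bound[OF r, of f B x] Cb_measurable[of 0 B f] by auto
  show "isCont (conv_op r f) x" if f: "Cb UNIV 0 B f"
    unfolding conv_op_def
  proof (rule isCont_lebesgue_integral[where G = "\<lambda>w. \<bar>r w\<bar> * B"])
    have [measurable]: "f \<in> borel_measurable borel" using Cb_measurable[OF f] .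
    show "isCont (\<lambda>x. r w * f (x + w)) x" for w
      using f by (auto intro!: continuous_intros isCont_o2[of _ "\<lambda>x. x + w" f] simp: continuous_on_eq_continuous_at)
    show "(\<lambda>w. r w * f (x + w)) \<in> borel_measurable lborel" for x by measurable
  qed (use f r in \<open>auto simp: abs_mult intro!: mult_left_mono\<close>)
  show "(conv_op r f has_field_derivative conv_op r (deriv f) x) (at x)" if f: "Cb UNIV (Suc 0) B f"
    unfolding conv_op_def
  proof (rule has_field_derivative_lebesgue_integral[where G = "\<lambda>w. \<bar>r w\<bar> * B"])
    have f': "Cb UNIV 0 B (deriv f)" using f by simp
    have [measurable]: "deriv f \<in> borel_measurable borel" using Cb_measurable[OF f'] .
    show "((\<lambda>x. r w * f (x + w)) has_field_derivative r w * deriv f (x + w)) (at x)" for x w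
    proof -
      have "(f has_field_derivative deriv f (x + w)) (at (x + w))"
        using f by (simp add: DERIV_deriv_iff_field_differentiable)
      then show ?thesis by (auto intro!: derivative_eq_intros simp: DERIV_shift)
    qed
    show "integrable lborel (\<lambda>w. r w * f (x + w))" for x
      using f Cb_measurable[OF f] by (intro integrable_conv_op[OF r, where B = B]) auto
    show "(\<lambda>w. r w * deriv f (x + w)) \<in> borel_measurable lborel" for x by measurable
  qed (use f r in \<open>auto simp: abs_mult intro!: mult_left_mono\<close>)
qed (use assms in simp)

section \<open>Operators with a compensated kernel\<close>

abbreviation lin_rem :: "(real \<Rightarrow> real) \<Rightarrow> real \<Rightarrow> real \<Rightarrow> real" where
  "lin_rem g x w \<equiv> g (x + w) - g x - w * deriv g x"

text \<open>Here \<open>v\<close> is half a variance, and \<open>a\<close> is the drift belonging to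
  full compensation of the jumps, without any cutoff.\<close>

definition levy_op :: "real \<Rightarrow> real \<Rightarrow> (real \<Rightarrow> real) \<Rightarrow> (real \<Rightarrow> real) \<Rightarrow> real \<Rightarrow> real" where
  "levy_op a v q g x = a * deriv g x + v * (deriv ^^ 2) g x
     + (LBINT w. lin_rem g x w * q w)"

lemma Cb_lipschitz:
  assumes "Cb UNIV (Suc k) B g"
  shows "\<bar>g x - g y\<bar> \<le> B * \<bar>x - y\<bar>"
proof -
  have "(g has_field_derivative deriv g z) (at z)" "\<bar>deriv g z\<bar> \<le> B" for z
    using assms Cb_bound[of UNIV k B "deriv g"] by (auto simp: DERIV_deriv_iff_field_differentiable)
  then show ?thesis using field_differentiable_bound[of UNIV g "deriv g" B x y] by auto
qed

text \<open>The mean value theorem is applied to \<open>g z - z * deriv g x\<close>, whose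
  derivative is at most \<open>B * \<bar>w\<bar>\<close> near \<open>x\<close>. The sharp factor 1/2
  is given away.\<close>

lemma Cb_taylor2:
  assumes "Cb UNIV (Suc (Suc k)) B g"
  shows "\<bar>lin_rem g x w\<bar> \<le> B * w\<^sup>2"
proof -
  have D: "(g has_field_derivative deriv g z) (at z)" for z
    using assms by (auto simp: DERIV_deriv_iff_field_differentiable)
  have "\<bar>(g (x + w) - (x + w) * deriv g x) - (g x - x * deriv g x)\<bar> \<le> (B * \<bar>w\<bar>) * \<bar>(x + w) - x\<bar>"
  proof (rule field_differentiable_bound[of "cball x \<bar>w\<bar>", unfolded real_norm_def])
    fix z assume z: "z \<in> cball x \<bar>w\<bar>"
    show "((\<lambda>z. g z - z * deriv g x) has_field_derivative deriv g z - deriv g x) (at z within cball x \<bar>w\<bar>)"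
      using has_field_derivative_at_within[OF D] by (auto intro!: derivative_eq_intros)
    have "\<bar>deriv g z - deriv g x\<bar> \<le> B * \<bar>z - x\<bar>"
      using assms by (intro Cb_lipschitz[of k]) simp
    also have "\<dots> \<le> B * \<bar>w\<bar>"
      using z Cb_nonneg[OF assms] by (intro mult_left_mono) (auto simp: dist_real_def)
    finally show "\<bar>deriv g z - deriv g x\<bar> \<le> B * \<bar>w\<bar>" .
  qed (auto simp: dist_real_def)
  then show ?thesis by (simp add: algebra_simps power2_eq_square)
qed

text \<open>The second-order bound for \<open>deriv g\<close> is integrated once more by the mean
  value theorem.\<close>

lemma Cb_taylor3:
  assumes "Cb UNIV (Suc (Suc (Suc k))) B g"
  shows "\<bar>lin_rem g x w - w\<^sup>2 / 2 * (deriv ^^ 2) g x\<bar> \<le> B * \<bar>w\<bar> ^ 3"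
proof -
  have D: "(g has_field_derivative deriv g z) (at z)" for z
    using assms by (auto simp: DERIV_deriv_iff_field_differentiable)
  let ?h = "\<lambda>z. g z - z * deriv g x - (z - x)\<^sup>2 / 2 * (deriv ^^ 2) g x"
  have "\<bar>?h (x + w) - ?h x\<bar> \<le> (B * w\<^sup>2) * \<bar>(x + w) - x\<bar>"
  proof (rule field_differentiable_bound[of "cball x \<bar>w\<bar>", unfolded real_norm_def])
    fix z assume z: "z \<in> cball x \<bar>w\<bar>"
    show "(?h has_field_derivative deriv g z - deriv g x - (z - x) * (deriv ^^ 2) g x) (at z within cball x \<bar>w\<bar>)"
      using has_field_derivative_at_within[OF D] by (auto intro!: derivative_eq_intros)
    have "\<bar>deriv g z - deriv g x - (z - x) * (deriv ^^ 2) g x\<bar> \<le> B * (z - x)\<^sup>2"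
      using Cb_taylor2[of k B "deriv g" x "z - x"] assms by (simp add: numeral_2_eq_2)
    also have "\<dots> \<le> B * w\<^sup>2"
      using z Cb_nonneg[OF assms] by (intro mult_left_mono) (auto simp: dist_real_def abs_le_square_iff power2_commute)
    finally show "\<bar>deriv g z - deriv g x - (z - x) * (deriv ^^ 2) g x\<bar> \<le> B * w\<^sup>2" .
  qed (auto simp: dist_real_def)
  then show ?thesis by (simp add: algebra_simps power3_eq_cube power2_eq_square)
qed

lemma abs_mult_square_weight: "\<bar>e\<bar> \<le> B * w\<^sup>2 \<Longrightarrow> \<bar>e * q\<bar> \<le> B * \<bar>w\<^sup>2 * q\<bar>" for e B w q :: real
  using mult_right_mono[of "\<bar>e\<bar>" "B * w\<^sup>2" "\<bar>q\<bar>"] by (simp add: abs_mult mult.assoc)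

context
  fixes q :: "real \<Rightarrow> real"
  assumes q [measurable]: "q \<in> borel_measurable borel" and q2: "integrable lborel (\<lambda>w. w\<^sup>2 * q w)"
begin

text \<open>The kernel may be signed and may have infinite mass at 0: the remainder is of order
  \<open>w\<^sup>2\<close> there, which is exactly what \<open>q2\<close> can absorb. Signed kernels
  arise as differences of two kernels.\<close>

lemma integrable_levy_op:
  assumes g: "Cb UNIV (Suc (Suc k)) B g"
  shows "integrable lborel (\<lambda>w. lin_rem g x w * q w)"
proof (rule Bochner_Integration.integrable_bound)
  have [measurable]: "g \<in> borel_measurable borel" using Cb_measurable[OF g] .
  show "integrable lborel (\<lambda>w. B * \<bar>w\<^sup>2 * q w\<bar>)" using q2 by auto
  show "(\<lambda>w. lin_rem g x w * q w) \<in> borel_measurable lborel" by measurable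
  show "AE w in lborel. norm (lin_rem g x w * q w) \<le> norm (B * \<bar>w\<^sup>2 * q w\<bar>)"
    using abs_mult_square_weight[OF Cb_taylor2[OF g]] Cb_nonneg[OF g] by (auto simp: abs_mult[of B])
qed

lemma levy_op_bound:
  assumes g: "Cb UNIV (Suc (Suc k)) B g"
  shows "\<bar>levy_op a v q g x\<bar> \<le> (\<bar>a\<bar> + \<bar>v\<bar> + (LBINT w. \<bar>w\<^sup>2 * q w\<bar>)) * B"
proof -
  have "\<bar>LBINT w. lin_rem g x w * q w\<bar> \<le> (LBINT w. \<bar>lin_rem g x w * q w\<bar>)"
    by (rule integral_abs_bound)
  also have "\<dots> \<le> (LBINT w. B * \<bar>w\<^sup>2 * q w\<bar>)"
    by (intro integral_mono integrable_abs integrable_levy_op[OF g] integrable_mult_right q2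
        abs_mult_square_weight[OF Cb_taylor2[OF g]])
  finally have 1: "\<bar>LBINT w. lin_rem g x w * q w\<bar> \<le> B * (LBINT w. \<bar>w\<^sup>2 * q w\<bar>)" by simp
  have "\<bar>deriv g x\<bar> \<le> B" "\<bar>(deriv ^^ 2) g x\<bar> \<le> B"
    using Cb_bound[OF Cb_funpow[of UNIV 1 "Suc k" B g]] Cb_bound[OF Cb_funpow[of UNIV 2 k B g]] g
    by (simp_all del: Cb.simps)
  then have "\<bar>a * deriv g x\<bar> \<le> \<bar>a\<bar> * B" "\<bar>v * (deriv ^^ 2) g x\<bar> \<le> \<bar>v\<bar> * B"
    by (auto simp: abs_mult intro!: mult_left_mono)
  with 1 show ?thesis unfolding levy_op_def distrib_right mult.commute[of B] by linarith
qed

lemma isCont_levy_op: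
  assumes g: "Cb UNIV (Suc (Suc k)) B g"
  shows "isCont (levy_op a v q g) x"
proof -
  have [measurable]: "g \<in> borel_measurable borel" using Cb_measurable[OF g] .
  have "continuous_on UNIV g" "continuous_on UNIV (deriv g)" "continuous_on UNIV ((deriv ^^ 2) g)"
    using Cb_continuous[OF g] g Cb_continuous[of UNIV "Suc k" B "deriv g"] Cb_continuous[of UNIV k B "deriv (deriv g)"]
    by (auto simp: numeral_2_eq_2)
  then have c: "isCont g z" "isCont (deriv g) z" "isCont ((deriv ^^ 2) g) z" for z
    by (auto simp: continuous_on_eq_continuous_at)
  have "isCont (\<lambda>x. LBINT w. lin_rem g x w * q w) x"
  proof (rule isCont_lebesgue_integral[where G = "\<lambda>w. B * \<bar>w\<^sup>2 * q w\<bar>"])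
    show "isCont (\<lambda>x. lin_rem g x w * q w) x" for w
      using c by (auto intro!: continuous_intros isCont_o2[of _ "\<lambda>x. x + w" g])
    show "\<bar>lin_rem g x w * q w\<bar> \<le> B * \<bar>w\<^sup>2 * q w\<bar>" for x w
      by (rule abs_mult_square_weight[OF Cb_taylor2[OF g]])
  qed (use q2 in auto)
  then show ?thesis unfolding levy_op_def using c by (auto intro!: continuous_intros)
qed

lemma has_field_derivative_levy_op:
  assumes g: "Cb UNIV (Suc (Suc (Suc k))) B g"
  shows "(levy_op a v q g has_field_derivative levy_op a v q (deriv g) x) (at x)"
proof -
  have g': "Cb UNIV (Suc (Suc k)) B (deriv g)" using g by simp
  have [measurable]: "g \<in> borel_measurable borel" "deriv g \<in> borel_measurable borel"
    using Cb_measurable[OF g] Cb_measurable[OF g'] .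
  have D: "(g has_field_derivative deriv g z) (at z)" "(deriv g has_field_derivative deriv (deriv g) z) (at z)"
      "(deriv (deriv g) has_field_derivative deriv (deriv (deriv g)) z) (at z)" for z
    using g by (auto simp: DERIV_deriv_iff_field_differentiable)
  have "((\<lambda>x. LBINT w. lin_rem g x w * q w) has_field_derivative
      (LBINT w. (deriv g (x + w) - deriv g x - w * deriv (deriv g) x) * q w)) (at x)"
  proof (rule has_field_derivative_lebesgue_integral[where G = "\<lambda>w. B * \<bar>w\<^sup>2 * q w\<bar>"])
    show "((\<lambda>x. lin_rem g x w * q w) has_field_derivative
        (deriv g (x + w) - deriv g x - w * deriv (deriv g) x) * q w) (at x)" for x w
      using D(1)[of "x + w"] D by (auto intro!: derivative_eq_intros simp: DERIV_shift)
    show "integrable lborel (\<lambda>w. lin_rem g x w * q w)" for x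
      using integrable_levy_op Cb_Suc_D[OF g] by blast
    show "\<bar>(deriv g (x + w) - deriv g x - w * deriv (deriv g) x) * q w\<bar> \<le> B * \<bar>w\<^sup>2 * q w\<bar>" for x w
      by (rule abs_mult_square_weight[OF Cb_taylor2[OF g']])
  qed (use q2 in auto)
  then show ?thesis unfolding levy_op_def numeral_2_eq_2 using D
    by (auto intro!: derivative_eq_intros)
qed

lemma Cb_levy_op:
  assumes "Cb UNIV (2 + k) B g"
  shows "Cb UNIV k ((\<bar>a\<bar> + \<bar>v\<bar> + (LBINT w. \<bar>w\<^sup>2 * q w\<bar>)) * B) (levy_op a v q g)"
  using assms levy_op_bound[of 0] isCont_levy_op[of 0] has_field_derivative_levy_op[of 0]
  by (intro Cb_of_derivation[where d = 2 and T = "levy_op a v q"]) (simp_all only: numeral_2_eq_2)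

lemma levy_op_diff:
  assumes f: "Cb UNIV (Suc (Suc k)) B f" and g: "Cb UNIV (Suc (Suc k)) C g"
  shows "levy_op a v q (\<lambda>x. f x - g x) = (\<lambda>x. levy_op a v q f x - levy_op a v q g x)"
proof
  fix x
  have d: "deriv (\<lambda>x. f x - g x) = (\<lambda>x. deriv f x - deriv g x)"
    using f g by auto
  have d2: "(deriv ^^ 2) (\<lambda>x. f x - g x) = (\<lambda>x. (deriv ^^ 2) f x - (deriv ^^ 2) g x)"
    using f g by (auto simp: numeral_2_eq_2 d)
  have e: "(f (x + w) - g (x + w) - (f x - g x) - w * (deriv f x - deriv g x)) * q w
     = lin_rem f x w * q w - lin_rem g x w * q w" for w
    by (simp add: algebra_simps)
  show "levy_op a v q (\<lambda>x. f x - g x) x = levy_op a v q f x - levy_op a v q g x"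
    unfolding levy_op_def d d2 e
      Bochner_Integration.integral_diff[OF integrable_levy_op[OF f] integrable_levy_op[OF g]]
      right_diff_distrib[of a] right_diff_distrib[of v] by linarith
qed

lemma Cb_levy_op_iterate:
  assumes K: "\<bar>a\<bar> + \<bar>v\<bar> + (LBINT w. \<bar>w\<^sup>2 * q w\<bar>) \<le> K" 
  shows "Cb UNIV (2 * j + k) B g \<Longrightarrow> Cb UNIV k (K ^ j * B) ((levy_op a v q ^^ j) g)"
proof (induction j arbitrary: B g)
  case (Suc j)
  have "Cb UNIV (2 * j + k) (K * B) (levy_op a v q g)"
    using Suc.prems by (intro Cb_mono[OF Cb_levy_op[of "2 * j + k" B g a v] mult_right_mono[OF K]] Cb_nonneg[OF Suc.prems]) simp_all
  from Suc.IH[OF this] show ?case by (simp del: funpow.simps add: funpow_Suc_right mult_ac)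
qed simp

lemma levy_op_iterate_diff:
  "Cb UNIV (2 * j) B f \<Longrightarrow> Cb UNIV (2 * j) C g \<Longrightarrow>
   (levy_op a v q ^^ j) (\<lambda>x. f x - g x) = (\<lambda>x. (levy_op a v q ^^ j) f x - (levy_op a v q ^^ j) g x)"
proof (induction j arbitrary: B C f g)
  case (Suc j)
  have "Cb UNIV (Suc (Suc (2 * j))) B f" "Cb UNIV (Suc (Suc (2 * j))) C g"
    using Suc.prems by auto
  then have "levy_op a v q (\<lambda>x. f x - g x) = (\<lambda>x. levy_op a v q f x - levy_op a v q g x)"
    by (rule levy_op_diff)
  moreover have "Cb UNIV (2 * j) ((\<bar>a\<bar> + \<bar>v\<bar> + (LBINT w. \<bar>w\<^sup>2 * q w\<bar>)) * B) (levy_op a v q f)"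
    "Cb UNIV (2 * j) ((\<bar>a\<bar> + \<bar>v\<bar> + (LBINT w. \<bar>w\<^sup>2 * q w\<bar>)) * C) (levy_op a v q g)"
    using Suc.prems by (intro Cb_levy_op; simp)+
  ultimately show ?case
    by (simp del: funpow.simps Cb.simps add: funpow_Suc_right Suc.IH)
qed simp

end

lemma levy_op_diff_kernel:
  assumes "q \<in> borel_measurable borel" "integrable lborel (\<lambda>w. w\<^sup>2 * q w)"
    "r \<in> borel_measurable borel" "integrable lborel (\<lambda>w. w\<^sup>2 * r w)"
    and g: "Cb UNIV (Suc (Suc k)) B g"
  shows "levy_op a v q g x - levy_op b u r g x = levy_op (a - b) (v - u) (\<lambda>w. q w - r w) g x"
  unfolding levy_op_def right_diff_distrib[of "g _ - g x - _ * deriv g x"]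
    Bochner_Integration.integral_diff[OF integrable_levy_op[OF assms(1,2) g] integrable_levy_op[OF assms(3,4) g]]
    left_diff_distrib[of a b] left_diff_distrib[of v u] by linarith

text \<open>A kernel \<open>p\<close> concentrated near 0 acts like half its second moment times the
  second derivative, up to its third absolute moment. With \<open>v\<close> taken as minus half a
  variance, the second moment of \<open>p\<close> almost cancels it. The kernel \<open>z\<close> is
  small by its own second moment.\<close>

lemma levy_op_small:
  assumes p: "p \<in> borel_measurable borel" "integrable lborel (\<lambda>w. w\<^sup>2 * p w)" "integrable lborel (\<lambda>w. \<bar>w\<bar> ^ 3 * p w)"
    and z: "z \<in> borel_measurable borel" "integrable lborel (\<lambda>w. w\<^sup>2 * z w)"
    and g: "Cb UNIV (Suc (Suc (Suc k))) B g"
  shows "\<bar>levy_op 0 v (\<lambda>w. p w - z w) g x\<bar>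
    \<le> ((LBINT w. \<bar>\<bar>w\<bar> ^ 3 * p w\<bar>) + \<bar>v + (LBINT w. w\<^sup>2 * p w) / 2\<bar> + (LBINT w. \<bar>w\<^sup>2 * z w\<bar>)) * B"
proof -
  have g2: "Cb UNIV (Suc (Suc k)) B g" by (rule Cb_Suc_D[OF g])
  let ?d = "(deriv ^^ 2) g x"
  have d: "\<bar>?d\<bar> \<le> B"
    using Cb_bound[OF Cb_funpow[of UNIV 2 "Suc k" B g]] g by (simp del: Cb.simps)
  note ip = integrable_levy_op[OF p(1,2) g2, of x] and iz = integrable_levy_op[OF z g2, of x]
  have ie: "integrable lborel (\<lambda>w. lin_rem g x w * p w - ?d / 2 * (w\<^sup>2 * p w))"
    by (intro Bochner_Integration.integrable_diff[OF ip integrable_mult_right[OF p(2)]])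
  have eq: "levy_op 0 v (\<lambda>w. p w - z w) g x =
     (LBINT w. lin_rem g x w * p w - ?d / 2 * (w\<^sup>2 * p w))
     + (v + (LBINT w. w\<^sup>2 * p w) / 2) * ?d - (LBINT w. lin_rem g x w * z w)"
  proof -
    have 1: "(LBINT w. lin_rem g x w * p w - ?d / 2 * (w\<^sup>2 * p w))
      = (LBINT w. lin_rem g x w * p w) - ?d / 2 * (LBINT w. w\<^sup>2 * p w)"
      by (subst Bochner_Integration.integral_diff[OF ip integrable_mult_right[OF p(2)]]) simp
    have "levy_op 0 v (\<lambda>w. p w - z w) g x = levy_op 0 v p g x - levy_op 0 0 z g x"
      using levy_op_diff_kernel[OF p(1,2) z g2, of 0 v x 0 0] by simp
    also have "\<dots> = v * ?d + (LBINT w. lin_rem g x w * p w)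
        - (LBINT w. lin_rem g x w * z w)"
      unfolding levy_op_def by simp
    finally show ?thesis unfolding 1 by (simp only: distrib_right) simp
  qed
  have "\<bar>LBINT w. lin_rem g x w * p w - ?d / 2 * (w\<^sup>2 * p w)\<bar>
     \<le> (LBINT w. \<bar>lin_rem g x w * p w - ?d / 2 * (w\<^sup>2 * p w)\<bar>)"
    by (rule integral_abs_bound)
  also have "\<dots> \<le> (LBINT w. B * \<bar>\<bar>w\<bar> ^ 3 * p w\<bar>)"
  proof (intro integral_mono)
    fix w
    have "\<bar>lin_rem g x w * p w - ?d / 2 * (w\<^sup>2 * p w)\<bar>
      = \<bar>lin_rem g x w - w\<^sup>2 / 2 * ?d\<bar> * \<bar>p w\<bar>"
      unfolding abs_mult[symmetric] by (simp add: algebra_simps)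
    also have "\<dots> \<le> (B * \<bar>w\<bar> ^ 3) * \<bar>p w\<bar>" by (intro mult_right_mono Cb_taylor3[OF g]) auto
    finally show "\<bar>lin_rem g x w * p w - ?d / 2 * (w\<^sup>2 * p w)\<bar> \<le> B * \<bar>\<bar>w\<bar> ^ 3 * p w\<bar>"
      by (simp add: abs_mult mult.assoc power_abs)
  qed (use ie p(3) in auto)
  finally have 1: "\<bar>LBINT w. lin_rem g x w * p w - ?d / 2 * (w\<^sup>2 * p w)\<bar>
     \<le> B * (LBINT w. \<bar>\<bar>w\<bar> ^ 3 * p w\<bar>)" by simp
  have 2: "\<bar>(v + (LBINT w. w\<^sup>2 * p w) / 2) * ?d\<bar> \<le> \<bar>v + (LBINT w. w\<^sup>2 * p w) / 2\<bar> * B"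
    unfolding abs_mult by (intro mult_left_mono d) auto
  have "\<bar>LBINT w. lin_rem g x w * z w\<bar> \<le> (LBINT w. \<bar>w\<^sup>2 * z w\<bar>) * B"
    using levy_op_bound[OF z g2, of 0 0 x] by (simp add: levy_op_def)
  with 1 2 show ?thesis unfolding eq distrib_right by (simp only: mult.commute[of B] abs_le_iff) linarith
qed

text \<open>Telescoping: with A for the kernel \<open>r\<close> and L for the limit operator,
  A^(j+1) - L^(j+1) = A^j (A - L) + (A^j - L^j) L. The difference A - L has kernel
  \<open>p - z\<close>, where \<open>p\<close> imitates the Gaussian part (and whatever drift
  correction is needed) and \<open>z\<close> is the part of \<open>q\<close> that is discarded. It
  consumes three derivatives instead of two, but it occurs only once in each term, hence the order
  \<open>2 * j + 1\<close>.\<close>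

lemma levy_op_iterate_approx:
  assumes q: "q \<in> borel_measurable borel" "integrable lborel (\<lambda>w. w\<^sup>2 * q w)"
      "\<bar>a\<bar> + \<bar>v\<bar> + (LBINT w. \<bar>w\<^sup>2 * q w\<bar>) \<le> K"
    and p: "p \<in> borel_measurable borel" "integrable lborel (\<lambda>w. w\<^sup>2 * p w)" "integrable lborel (\<lambda>w. \<bar>w\<bar> ^ 3 * p w)"
    and z: "z \<in> borel_measurable borel" "integrable lborel (\<lambda>w. w\<^sup>2 * z w)"
    and r: "\<And>w. r w - q w = p w - z w" "\<bar>a\<bar> + (LBINT w. \<bar>w\<^sup>2 * r w\<bar>) \<le> K" and K: "1 \<le> K"
    and \<kappa>: "(LBINT w. \<bar>\<bar>w\<bar> ^ 3 * p w\<bar>) + \<bar>(LBINT w. w\<^sup>2 * p w) / 2 - v\<bar> + (LBINT w. \<bar>w\<^sup>2 * z w\<bar>) \<le> \<kappa>"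
  shows "Cb UNIV (2 * j + 1) B g \<Longrightarrow>
    \<bar>(levy_op a 0 r ^^ j) g x - (levy_op a v q ^^ j) g x\<bar> \<le> j * K ^ j * \<kappa> * B"
proof (induction j arbitrary: g B)
  case (Suc j)
  have re: "r = (\<lambda>w. q w + (p w - z w))" using r(1) by (auto simp: fun_eq_iff algebra_simps)
  have pz: "(\<lambda>w. p w - z w) \<in> borel_measurable borel" "integrable lborel (\<lambda>w. w\<^sup>2 * (p w - z w))"
    using p z by (auto simp: right_diff_distrib)
  have rm: "r \<in> borel_measurable borel" "integrable lborel (\<lambda>w. w\<^sup>2 * r w)"
    unfolding re using q pz(2) by (auto simp: distrib_left intro!: borel_measurable_add pz(1))
  note B = Cb_nonneg[OF Suc.prems]
  have \<kappa>0: "0 \<le> \<kappa>" by (rule order_trans[OF _ \<kappa>]) (auto intro!: add_nonneg_nonneg)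
  let ?A = "levy_op a 0 r" and ?L = "levy_op a v q"
  have 2: "Cb UNIV (2 + (2 * j + 1)) B g" using Suc.prems by simp
  have A: "Cb UNIV (2 * j + 1) (K * B) (?A g)"
    using r(2) B by (intro Cb_mono[OF Cb_levy_op[OF rm 2, of a 0] mult_right_mono]) auto
  have L: "Cb UNIV (2 * j + 1) (K * B) (?L g)"
    using q(3) B by (intro Cb_mono[OF Cb_levy_op[OF q(1,2) 2, of a v] mult_right_mono]) auto
  \<comment> \<open>As the difference commutes with differentiation too, the small constant \<kappa>
    holds for all derivatives that \<open>?A ^^ j\<close> will need.\<close>
  have "Cb UNIV (2 * j) (\<kappa> * B) (levy_op 0 (-v) (\<lambda>w. p w - z w) g)"
  proof (rule Cb_of_derivation[where d = 3 and T = "levy_op 0 (-v) (\<lambda>w. p w - z w)"])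
    fix f x B assume f: "Cb UNIV 3 B f"
    have f3: "Cb UNIV (Suc (Suc (Suc 0))) B f" using f by (simp only: numeral_3_eq_3)
    show "\<bar>levy_op 0 (- v) (\<lambda>w. p w - z w) f x\<bar> \<le> \<kappa> * B"
      using order_trans[OF levy_op_small[OF p z f3, of "-v" x] mult_right_mono[OF _ Cb_nonneg[OF f]]] \<kappa>
      by (simp add: add.commute)
    show "isCont (levy_op 0 (- v) (\<lambda>w. p w - z w) f) x"
      by (rule isCont_levy_op[OF pz Cb_Suc_D[OF f3]])
  next
    fix f x B assume "Cb UNIV (Suc 3) B f"
    then have "Cb UNIV (Suc (Suc (Suc 1))) B f" by (simp only: numeral_3_eq_3 One_nat_def)
    then show "(levy_op 0 (- v) (\<lambda>w. p w - z w) f has_field_derivative levy_op 0 (- v) (\<lambda>w. p w - z w) (deriv f) x) (at x)"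
      by (rule has_field_derivative_levy_op[OF pz])
  qed (use Suc.prems in \<open>simp add: numeral_3_eq_3\<close>)
  moreover have "(\<lambda>x. ?A g x - ?L g x) = levy_op 0 (-v) (\<lambda>w. p w - z w) g"
    using levy_op_diff_kernel[OF rm q(1,2), of "2 * j + 1" B g a 0 _ a v] 2
    by (simp only: r(1) add_2_eq_Suc) simp
  ultimately have D: "Cb UNIV (2 * j) (\<kappa> * B) (\<lambda>x. ?A g x - ?L g x)" by simp
  have "\<bar>(?A ^^ j) (\<lambda>x. ?A g x - ?L g x) x\<bar> \<le> K ^ j * (\<kappa> * B)"
    using Cb_levy_op_iterate[OF rm, of a 0 K j 0 "\<kappa> * B"] D r(2) by simp
  moreover have "(?A ^^ j) (\<lambda>x. ?A g x - ?L g x) = (\<lambda>x. (?A ^^ j) (?A g) x - (?A ^^ j) (?L g) x)"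
    by (rule levy_op_iterate_diff[OF rm Cb_antimono[OF A] Cb_antimono[OF L]]) simp_all
  ultimately have e1: "\<bar>(?A ^^ j) (?A g) x - (?A ^^ j) (?L g) x\<bar> \<le> K ^ j * (\<kappa> * B)" by simp
  have e2: "\<bar>(?A ^^ j) (?L g) x - (?L ^^ j) (?L g) x\<bar> \<le> j * K ^ j * \<kappa> * (K * B)"
    by (rule Suc.IH[OF L])
  \<comment> \<open>The factor \<open>K\<close>, at least 1, brings both error terms to the power
    \<open>K ^ Suc j\<close>.\<close>
  have "K ^ j * (\<kappa> * B) \<le> K * (K ^ j * (\<kappa> * B))"
    using K \<kappa>0 B mult_right_mono[OF K, of "K ^ j * (\<kappa> * B)"] by simp
  with e1 e2 show ?case by (simp del: funpow.simps add: funpow_Suc_right algebra_simps)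
qed simp

text \<open>Taylor's formula with integral remainder. It turns the double integral in
  \<open>L_eps\<close> into a compensated kernel.\<close>

lemma integral_taylor2:
  assumes g: "Cb UNIV 2 B g"
  shows "(LBINT \<beta>:{0..1}. (deriv ^^ 2) g (x + \<beta> * w) * (1 - \<beta>)) * w\<^sup>2 = lin_rem g x w"
proof -
  have D: "(g has_field_derivative deriv g z) (at z)" "(deriv g has_field_derivative (deriv ^^ 2) g z) (at z)"
    "isCont ((deriv ^^ 2) g) z" for z
    using g by (auto simp: DERIV_deriv_iff_field_differentiable numeral_2_eq_2 continuous_on_eq_continuous_at)
  \<comment> \<open>An antiderivative in \<beta>: differentiating the factor
    \<open>1 - \<beta>\<close> produces a term that cancels the derivative of the second
    summand.\<close>
  let ?F = "\<lambda>\<beta>. (1 - \<beta>) * w * deriv g (x + \<beta> * w) + g (x + \<beta> * w)"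
  have "(LBINT \<beta>. ((deriv ^^ 2) g (x + \<beta> * w) * (1 - \<beta>) * w\<^sup>2) * indicator {0..1} \<beta>) = ?F 1 - ?F 0"
  proof (rule integral_FTC_Icc_real)
    fix \<beta> :: real
    have i: "((\<lambda>\<beta>. x + \<beta> * w) has_field_derivative w) (at \<beta>)" by (auto intro!: derivative_eq_intros)
    show "(?F has_field_derivative (deriv ^^ 2) g (x + \<beta> * w) * (1 - \<beta>) * w\<^sup>2) (at \<beta>)"
      using DERIV_chain2[OF D(1) i] DERIV_chain2[OF D(2) i]
      by (auto intro!: derivative_eq_intros simp: algebra_simps power2_eq_square)
    show "isCont (\<lambda>\<beta>. (deriv ^^ 2) g (x + \<beta> * w) * (1 - \<beta>) * w\<^sup>2) \<beta>"
      by (auto intro!: continuous_intros isCont_o2[of _ "\<lambda>\<beta>. x + \<beta> * w", OF _ D(3)])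
  qed simp
  then show ?thesis
    unfolding set_lebesgue_integral_def by (subst integral_mult_left_zero[symmetric]) (simp add: mult_ac)
qed

lemma L_eps_eq_levy_op:
  assumes q: "\<And>w. w \<noteq> 0 \<Longrightarrow> q w = c w * s w" and g: "Cb UNIV 2 B g"
  shows "L_eps c s v b \<nu> g = levy_op (b_eps c b \<nu>) (v / 2) q g"
proof
  fix x
  \<comment> \<open>The linear remainder vanishes at \<open>w = 0\<close>, so the value chosen for
    the density there is immaterial.\<close>
  have e: "lin_rem g x w * c w * s w = lin_rem g x w * q w" for w
    using q[of w] by (cases "w = 0") auto
  show "L_eps c s v b \<nu> g x = levy_op (b_eps c b \<nu>) (v / 2) q g x"
    unfolding L_eps_def levy_op_def integral_taylor2[OF g] e ..
qed

text \<open>The two operators are identified only on functions with two bounded derivatives, so the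
  regularity has to be followed along the iteration.\<close>

lemma L_eps_iterate_eq_levy_op:
  assumes q: "q \<in> borel_measurable borel" "integrable lborel (\<lambda>w. w\<^sup>2 * q w)" "\<And>w. w \<noteq> 0 \<Longrightarrow> q w = c w * s w"
  shows "Cb UNIV (2 * j) B g \<Longrightarrow>
    (L_eps c s v b \<nu> ^^ j) g = (levy_op (b_eps c b \<nu>) (v / 2) q ^^ j) g"
proof (induction j arbitrary: g B)
  case (Suc j)
  have "L_eps c s v b \<nu> g = levy_op (b_eps c b \<nu>) (v / 2) q g"
    using Cb_antimono[OF Suc.prems, of 2] by (intro L_eps_eq_levy_op[OF q(3)]) (simp_all del: Cb.simps)
  moreover have "Cb UNIV (2 + 2 * j) B g" using Suc.prems by simp
  ultimately show ?case using Suc.IH[OF Cb_levy_op[OF q(1,2)], of B g]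
    by (simp del: funpow.simps Cb.simps add: funpow_Suc_right)
qed simp

section \<open>Compound Poisson laws\<close>

text \<open>Geometric growth of the numerators makes the series entire; differentiating termwise
  just shifts the sequence.\<close>

lemma
  fixes a :: "nat \<Rightarrow> real"
  assumes a: "\<And>k. \<bar>a k\<bar> \<le> B * l ^ k"
  shows summable_exp_type: "summable (\<lambda>k. a k / fact k * t ^ k)"
    and has_field_derivative_exp_type:
      "((\<lambda>t. \<Sum>k. a k / fact k * t ^ k) has_field_derivative (\<Sum>k. a (Suc k) / fact k * t ^ k)) (at t)"
proof -
  show s: "summable (\<lambda>k. a k / fact k * t ^ k)" for t
  proof (rule summable_comparison_test')
    show "summable (\<lambda>k. B * (inverse (fact k) * (l * \<bar>t\<bar>) ^ k))"
      by (intro summable_mult summable_exp)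
    show "norm (a k / fact k * t ^ k) \<le> B * (inverse (fact k) * (l * \<bar>t\<bar>) ^ k)" if "0 \<le> k" for k
      using mult_right_mono[OF a[of k], of "\<bar>t\<bar> ^ k / fact k"]
      by (simp add: abs_mult power_abs power_mult_distrib field_simps)
  qed
  have "diffs (\<lambda>k. a k / fact k) = (\<lambda>k. a (Suc k) / fact k)"
    by (auto simp: diffs_def fun_eq_iff divide_simps)
  with termdiffs_strong_converges_everywhere[of "\<lambda>k. a k / fact k", OF s]
  show "((\<lambda>t. \<Sum>k. a k / fact k * t ^ k) has_field_derivative (\<Sum>k. a (Suc k) / fact k * t ^ k)) (at t)"
    by simp
qed

abbreviation mass :: "(real \<Rightarrow> real) \<Rightarrow> real" where
  "mass r \<equiv> integral\<^sup>L lborel r"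

lemma integral_poisson_pmf:
  fixes f :: "nat \<Rightarrow> real"
  assumes "0 < l" "\<And>k. \<bar>f k\<bar> \<le> B"
  shows "(LINT k|measure_pmf (poisson_pmf l). f k) = exp (- l) * (\<Sum>k. f k / fact k * l ^ k)"
proof -
  have s: "summable (\<lambda>k. norm (pmf (poisson_pmf l) k * f k))"
  proof (rule summable_comparison_test')
    show "summable (\<lambda>k. \<bar>f k\<bar> / fact k * l ^ k)"
      by (rule summable_exp_type[of _ B 1]) (simp add: assms)
    show "norm (norm (pmf (poisson_pmf l) k * f k)) \<le> \<bar>f k\<bar> / fact k * l ^ k" if "0 \<le> k" for k
      using assms(1) mult_left_le[of "exp (-l)" "\<bar>f k\<bar> * l ^ k / fact k"] by (auto simp: abs_mult field_simps)
  qed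
  have "(LINT k|measure_pmf (poisson_pmf l). f k) = (\<Sum>k. pmf (poisson_pmf l) k * f k)"
    unfolding measure_pmf_eq_density
    using s by (subst integral_real_density) (auto intro!: integral_count_space_nat simp: integrable_count_space_nat_iff)
  also have "\<dots> = (\<Sum>k. exp (- l) * (f k / fact k * l ^ k))"
    using assms(1) by (intro suminf_cong) simp
  also have "\<dots> = exp (- l) * (\<Sum>k. f k / fact k * l ^ k)"
    by (rule suminf_mult[OF summable_exp_type[of _ B 1]]) (simp add: assms)
  finally show ?thesis .
qed

context
  fixes r :: "real \<Rightarrow> real" 
  assumes r_nonneg: "\<And>w. 0 \<le> r w" and r: "integrable lborel r"
begin

lemma r_measurable: "r \<in> borel_measurable borel"
  using borel_measurable_integrable[OF r] by simp

lemma conv_op_measurable [measurable]: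
  assumes [measurable]: "g \<in> borel_measurable borel"
  shows "conv_op r g \<in> borel_measurable borel"
proof -
  note [measurable] = r_measurable
  show ?thesis unfolding conv_op_def by measurable
qed

lemma abs_conv_op_le:
  assumes "g \<in> borel_measurable borel" "\<And>x. \<bar>g x\<bar> \<le> B"
  shows "\<bar>conv_op r g x\<bar> \<le> mass r * B"
  using conv_op_bound[OF r assms] r_nonneg by simp

lemma conv_op_iterate_measurable [measurable]:
  "g \<in> borel_measurable borel \<Longrightarrow> (conv_op r ^^ k) g \<in> borel_measurable borel"
  by (induction k) auto

lemma abs_conv_op_iterate_le:
  assumes "g \<in> borel_measurable borel" "\<And>x. \<bar>g x\<bar> \<le> B"
  shows "\<bar>(conv_op r ^^ k) g x\<bar> \<le> B * mass r ^ k"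
  using assms
proof (induction k arbitrary: x)
  case (Suc k)
  have "\<bar>conv_op r ((conv_op r ^^ k) g) x\<bar> \<le> mass r * (B * mass r ^ k)"
    by (rule abs_conv_op_le) (use Suc in auto)
  then show ?case by (simp add: mult_ac)
qed simp

text \<open>The expectation of \<open>g (x + Y\<^sub>t)\<close> for the compound Poisson process \<open>Y\<close> with Levy density \<open>r\<close>, as the
  exponential series of its generator \<open>cp_gen\<close>.\<close>

definition cp_expect :: "real \<Rightarrow> (real \<Rightarrow> real) \<Rightarrow> real \<Rightarrow> real" where
  "cp_expect t g x = exp (- t * mass r) * (\<Sum>k. (conv_op r ^^ k) g x / fact k * t ^ k)"

text \<open>\<open>C\<close> is the law of a sum of k independent jumps with density
  \<open>r w / mass r\<close>, built by convolving with one more jump. Multiplying by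
  \<open>mass r ^ k\<close> undoes the normalisation.\<close>

lemma conv_power_law_exists:
  assumes l: "mass r > 0"
  shows "\<exists>C. real_distribution C \<and> (\<forall>g B x. g \<in> borel_measurable borel \<longrightarrow> (\<forall>x. \<bar>g x\<bar> \<le> B) \<longrightarrow>
    (LINT w|C. g (x + w)) * mass r ^ k = (conv_op r ^^ k) g x)"
proof (induction k)
  case 0
  interpret prob_space "return borel (0::real)" by (rule prob_space_return) simp
  have "real_distribution (return borel (0::real))"
    by unfold_locales auto
  then show ?case by (intro exI[of _ "return borel 0"]) (auto simp: integral_return)
next
  case (Suc k)
  note [measurable] = r_measurable
  from Suc obtain C where C: "real_distribution C" and CI: "\<And>g B x. g \<in> borel_measurable borel \<Longrightarrow> (\<And>x. \<bar>g x\<bar> \<le> B) \<Longrightarrow>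
    (LINT w|C. g (x + w)) * mass r ^ k = (conv_op r ^^ k) g x" by metis
  interpret C: real_distribution C by (rule C)
  let ?J = "density lborel (\<lambda>x. ennreal (r x / mass r))"
  have "(\<integral>\<^sup>+x. ennreal (r x / mass r) \<partial>lborel) = 1"
    using r l r_nonneg by (subst nn_integral_eq_integral) auto
  then interpret J: prob_space ?J
    by (intro prob_spaceI) (simp add: emeasure_density)
  interpret P: pair_prob_space ?J C ..
  let ?D = "distr (?J \<Otimes>\<^sub>M C) borel (\<lambda>(a, b). a + b)"
  have [measurable_cong]: "sets C = sets borel" by simp
  have "real_distribution ?D"
    by (intro real_distribution.intro P.prob_space_distr) (auto intro: real_distribution_axioms.intro)
  moreover have "(LINT w|?D. g (x + w)) * mass r ^ Suc k = (conv_op r ^^ Suc k) g x"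
    if [measurable]: "g \<in> borel_measurable borel" and gB: "\<And>x. \<bar>g x\<bar> \<le> B" for g B x
  proof -
    have "(LINT w|?D. g (x + w)) = (LINT p|(?J \<Otimes>\<^sub>M C). g (x + (fst p + snd p)))"
      by (subst integral_distr) (auto simp: case_prod_unfold)
    also have "\<dots> = (LINT a|?J. LINT b|C. g (x + (a + b)))"
    proof -
      have "integrable (?J \<Otimes>\<^sub>M C) (\<lambda>p. g (x + (fst p + snd p)))"
        by (rule P.integrable_const_bound[of _ B]) (auto simp: gB)
      from P.integral_fst'[OF this] show ?thesis by simp
    qed
    also have "\<dots> = (LBINT a. r a / mass r * (LINT b|C. g (x + (a + b))))"
      using r_nonneg l by (subst integral_real_density) auto
    finally have "(LINT w|?D. g (x + w)) * mass r ^ Suc k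
      = (LBINT a. r a / mass r * (LINT b|C. g (x + (a + b))) * mass r ^ Suc k)"
      by (simp only: integral_mult_left_zero)
    also have "\<dots> = (LBINT a. r a * (conv_op r ^^ k) g (x + a))"
      using l CI[OF that, of "x + _"] by (intro Bochner_Integration.integral_cong) (auto simp: add.assoc field_simps)
    finally show ?thesis by (simp add: conv_op_def)
  qed
  ultimately show ?case by blast
qed

text \<open>The Poisson mixture, with mean \<open>t * mass r\<close>, of the laws of k jumps. An
  actual law behind the series gives positivity and contraction, and supplies the distributions for
  the weak limit.\<close>

theorem compound_poisson_exists:
  assumes t: "0 \<le> t"
  shows "\<exists>P. real_distribution P \<and> (\<forall>g B x. g \<in> borel_measurable borel \<longrightarrow> (\<forall>x. \<bar>g x\<bar> \<le> B) \<longrightarrow>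
    (LINT w|P. g (x + w)) = cp_expect t g x)"
proof (cases "0 < t * mass r")
  \<comment> \<open>No jump occurs. The Poisson mixture needs a positive mean, so the point mass at
    0 is treated apart. Only the term \<open>k = 0\<close> survives: either \<open>t ^ k\<close> is
    0, or the iterates are 0 by their bound.\<close>
  case False
  then have 0: "t = 0 \<or> mass r = 0"
    using mult_nonneg_nonneg[OF t Bochner_Integration.integral_nonneg[of lborel r]] r_nonneg by force
  have *: "(\<Sum>k. (conv_op r ^^ k) g x / fact k * t ^ k) = g x"
    if "g \<in> borel_measurable borel" "\<And>x. \<bar>g x\<bar> \<le> B" for g B x
  proof -
    have "(conv_op r ^^ k) g x / fact k * t ^ k = 0" if "k \<noteq> 0" for k
      using 0 abs_conv_op_iterate_le[of g B k x] \<open>k \<noteq> 0\<close> \<open>g \<in> borel_measurable borel\<close> \<open>\<And>x. \<bar>g x\<bar> \<le> B\<close>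
      by (auto simp: power_0_left)
    then show ?thesis by (subst suminf_finite[of "{0}"]) auto
  qed
  then have *: "cp_expect t g x = g x" if "g \<in> borel_measurable borel" "\<And>x. \<bar>g x\<bar> \<le> B" for g B x
  proof -
    have "exp (- t * mass r) = 1" using 0 by auto
    then show ?thesis using *[OF that] by (simp add: cp_expect_def)
  qed
  interpret prob_space "return borel (0::real)" by (rule prob_space_return) simp
  have "real_distribution (return borel (0::real))"
    by unfold_locales auto
  then show ?thesis using *
    by (intro exI[of _ "return borel 0"] conjI allI impI)
      (simp, subst integral_return, simp_all, metis)
next
  case True
  let ?l = "mass r" and ?p = "poisson_pmf (t * mass r)"
  have l: "0 < ?l" using True t by (simp add: zero_less_mult_iff)
  from conv_power_law_exists[OF l] obtain C where C: "\<And>k. real_distribution (C k)"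
    and CI: "\<And>k g B x. g \<in> borel_measurable borel \<Longrightarrow> (\<And>x. \<bar>g x\<bar> \<le> B) \<Longrightarrow>
       (LINT w|C k. g (x + w)) * ?l ^ k = (conv_op r ^^ k) g x" by metis
  have Cp: "prob_space (C k)" for k using C[of k] by (simp add: real_distribution_def)
  have Cs: "sets (C k) = sets borel" for k using C[of k] by (simp add: real_distribution.events_eq_borel)
  have "C k \<in> space (prob_algebra borel)" for k
    using Cp Cs by (simp add: space_prob_algebra)
  then have Cpm: "C \<in> measure_pmf ?p \<rightarrow>\<^sub>M prob_algebra borel"
    by (simp add: measurable_pmf_measure1)
  then have Cm: "C \<in> measure_pmf ?p \<rightarrow>\<^sub>M subprob_algebra borel"
    by (rule measurable_prob_algebraD)
  let ?P = "measure_pmf ?p \<bind> C"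
  have "real_distribution ?P"
  proof (intro real_distribution.intro real_distribution_axioms.intro)
    show "prob_space ?P"
      by (intro measure_pmf.prob_space_bind[OF _ Cm]) (use Cp in auto)
    show "sets ?P = sets borel"
      using Cs by (intro sets_bind) auto
  qed
  moreover have "(LINT w|?P. g (x + w)) = cp_expect t g x"
    if g [measurable]: "g \<in> borel_measurable borel" and gB: "\<And>x. \<bar>g x\<bar> \<le> B" for g B x
  proof -
    have "(LINT w|?P. g (x + w)) = (LINT k|measure_pmf ?p. LINT w|C k. g (x + w))"
      by (rule integral_bind[where K = borel and B = B and B' = 1])
        (use Cm gB Cp in \<open>auto simp: measure_pmf.finite_measure_axioms prob_space.emeasure_space_1\<close>)
    also have "\<dots> = exp (- (t * ?l)) * (\<Sum>k. (LINT w|C k. g (x + w)) / fact k * (t * ?l) ^ k)"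
    proof (rule integral_poisson_pmf[OF True])
      fix k
      interpret C: real_distribution "C k" by (rule C)
      have "\<bar>LINT w|C k. g (x + w)\<bar> \<le> (LINT w|C k. \<bar>g (x + w)\<bar>)" by (rule integral_abs_bound)
      also have "\<dots> \<le> (LINT w|C k. B)"
        by (intro integral_mono C.integrable_const integrable_abs C.integrable_const_bound[of _ B]) (auto simp: gB)
      finally show "\<bar>LINT w|C k. g (x + w)\<bar> \<le> B" using C.prob_space by simp
    qed
    also have "(\<lambda>k. (LINT w|C k. g (x + w)) / fact k * (t * ?l) ^ k) = (\<lambda>k. (conv_op r ^^ k) g x / fact k * t ^ k)"
      by (auto simp: fun_eq_iff CI[OF g gB, symmetric] power_mult_distrib)
    finally show ?thesis by (simp add: cp_expect_def)
  qed
  ultimately show ?thesis by blast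
qed

lemma cp_expect_bound:
  assumes "0 \<le> t" and g [measurable]: "g \<in> borel_measurable borel" and gB: "\<And>x. \<bar>g x\<bar> \<le> B"
  shows "\<bar>cp_expect t g x\<bar> \<le> B"
proof -
  obtain P where P: "real_distribution P" and "(LINT w|P. g (x + w)) = cp_expect t g x"
    using compound_poisson_exists[OF assms(1)] g gB by metis
  interpret real_distribution P by (rule P)
  have "\<bar>LINT w|P. g (x + w)\<bar> \<le> (LINT w|P. \<bar>g (x + w)\<bar>)" by (rule integral_abs_bound)
  also have "\<dots> \<le> (LINT w|P. B)"
    by (intro integral_mono integrable_const integrable_abs integrable_const_bound[of _ B]) (auto simp: gB)
  finally show ?thesis using \<open>(LINT w|P. g (x + w)) = cp_expect t g x\<close> prob_space by simp
qed

text \<open>The time derivative at 0 of the expectation of \<open>g (x + Y\<^sub>t)\<close>: a jump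
  leads from \<open>x\<close> to \<open>x + w\<close> at rate \<open>r w\<close>.\<close>

definition cp_gen :: "(real \<Rightarrow> real) \<Rightarrow> real \<Rightarrow> real" where
  "cp_gen g x = conv_op r g x - mass r * g x"

lemma cp_gen_measurable [measurable]: "g \<in> borel_measurable borel \<Longrightarrow> cp_gen g \<in> borel_measurable borel"
  unfolding cp_gen_def by (intro borel_measurable_diff borel_measurable_times conv_op_measurable) auto

lemma abs_cp_gen_le:
  assumes "g \<in> borel_measurable borel" "\<And>x. \<bar>g x\<bar> \<le> B"
  shows "\<bar>cp_gen g x\<bar> \<le> 2 * mass r * B"
proof -
  have "\<bar>mass r * g x\<bar> \<le> mass r * B"
    using mult_left_mono[OF assms(2) Bochner_Integration.integral_nonneg[of lborel r]] r_nonneg by (simp add: abs_mult)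
  with abs_conv_op_le[OF assms, of x] show ?thesis unfolding cp_gen_def by linarith
qed

lemma cp_gen_iterate_measurable [measurable]:
  "g \<in> borel_measurable borel \<Longrightarrow> (cp_gen ^^ k) g \<in> borel_measurable borel"
  by (induction k) auto

text \<open>This bound involves the mass and is not uniform along the approximation. It only
  supplies the boundedness under which the derivative in time can be taken repeatedly.\<close>

lemma abs_cp_gen_iterate_le:
  assumes "g \<in> borel_measurable borel" "\<And>x. \<bar>g x\<bar> \<le> B"
  shows "\<bar>(cp_gen ^^ k) g x\<bar> \<le> (2 * mass r) ^ k * B"
proof (induction k arbitrary: x)
  case (Suc k)
  have "\<bar>cp_gen ((cp_gen ^^ k) g) x\<bar> \<le> 2 * mass r * ((2 * mass r) ^ k * B)"
    using assms(1) Suc.IH by (intro abs_cp_gen_le cp_gen_iterate_measurable)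
  then show ?case by (simp add: mult.assoc)
qed (simp add: assms)

text \<open>Inserted into the exponential series, this yields the Kolmogorov equation: the time
  derivative of the expectation of \<open>g\<close> is the expectation of its image under the
  generator.\<close>

lemma conv_op_iterate_cp_gen:
  assumes g: "g \<in> borel_measurable borel" "\<And>x. \<bar>g x\<bar> \<le> B"
  shows "(conv_op r ^^ k) (cp_gen g) = (\<lambda>x. (conv_op r ^^ Suc k) g x - mass r * (conv_op r ^^ k) g x)"
proof (induction k)
  case (Suc k)
  note i = integrable_conv_op[OF r conv_op_iterate_measurable[OF g(1)] abs_conv_op_iterate_le[OF g]]
  have "conv_op r (\<lambda>x. (conv_op r ^^ Suc k) g x - mass r * (conv_op r ^^ k) g x) x
    = conv_op r ((conv_op r ^^ Suc k) g) x - mass r * conv_op r ((conv_op r ^^ k) g) x" for x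
    using Bochner_Integration.integral_diff[OF i[of "Suc k" x] integrable_mult_right[OF i[of k x], of "mass r"]]
    unfolding conv_op_def[of r "\<lambda>x. (conv_op r ^^ Suc k) g x - mass r * (conv_op r ^^ k) g x"]
      conv_op_def[of r "(conv_op r ^^ Suc k) g"] conv_op_def[of r "(conv_op r ^^ k) g"]
    by (simp only: right_diff_distrib mult.left_commute[of _ "mass r"] integral_mult_right_zero)
  then have "conv_op r (\<lambda>x. (conv_op r ^^ Suc k) g x - mass r * (conv_op r ^^ k) g x)
    = (\<lambda>x. conv_op r ((conv_op r ^^ Suc k) g) x - mass r * conv_op r ((conv_op r ^^ k) g) x)" ..
  then show ?case unfolding Suc.IH[symmetric] by simp
qed (simp add: cp_gen_def fun_eq_iff)

lemma has_field_derivative_cp_expect: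
  assumes g: "g \<in> borel_measurable borel" "\<And>x. \<bar>g x\<bar> \<le> B"
  shows "((\<lambda>t. cp_expect t g x) has_field_derivative cp_expect t (cp_gen g) x) (at t)"
proof -
  note a = abs_conv_op_iterate_le[OF g, of _ x]
  have a': "\<bar>(conv_op r ^^ Suc k) g x\<bar> \<le> B * mass r * mass r ^ k" for k
    using a[of "Suc k"] by (simp add: mult.assoc)
  have "(\<Sum>k. (conv_op r ^^ k) (cp_gen g) x / fact k * t ^ k)
     = (\<Sum>k. (conv_op r ^^ Suc k) g x / fact k * t ^ k - mass r * ((conv_op r ^^ k) g x / fact k * t ^ k))"
    unfolding conv_op_iterate_cp_gen[OF g] by (intro suminf_cong) (simp add: field_simps del: funpow.simps)
  also have "\<dots> = (\<Sum>k. (conv_op r ^^ Suc k) g x / fact k * t ^ k) - mass r * (\<Sum>k. (conv_op r ^^ k) g x / fact k * t ^ k)"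
    unfolding suminf_mult[OF summable_exp_type[OF a], symmetric]
    by (intro suminf_diff[symmetric] summable_mult summable_exp_type[OF a] summable_exp_type[OF a'])
  finally have e: "(\<Sum>k. (conv_op r ^^ k) (cp_gen g) x / fact k * t ^ k)
    = (\<Sum>k. (conv_op r ^^ Suc k) g x / fact k * t ^ k) - mass r * (\<Sum>k. (conv_op r ^^ k) g x / fact k * t ^ k)" .
  show ?thesis unfolding cp_expect_def e
    using has_field_derivative_exp_type[OF a, of t]
    by (auto intro!: derivative_eq_intros simp: algebra_simps simp del: funpow.simps)
qed

text \<open>The Lagrange remainder is the expectation, at an intermediate time, of the N-th
  generator power, hence at most \<open>C\<close> before the factor \<open>t ^ N / fact N\<close>.
  The mass of \<open>r\<close> does not enter, so a uniform \<open>C\<close> gives a uniform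
  estimate.\<close>

theorem cp_expect_taylor:
  assumes t: "0 < t" and N: "0 < N" and g: "g \<in> borel_measurable borel" "\<And>x. \<bar>g x\<bar> \<le> B"
    and C: "\<And>x. \<bar>(cp_gen ^^ N) g x\<bar> \<le> C"
  shows "\<bar>cp_expect t g x - (\<Sum>m<N. (cp_gen ^^ m) g x / fact m * t ^ m)\<bar> \<le> C / fact N * t ^ N"
proof -
  have "\<exists>s. 0 < s \<and> s < t \<and> cp_expect t g x
    = (\<Sum>m<N. cp_expect 0 ((cp_gen ^^ m) g) x / fact m * t ^ m) + cp_expect s ((cp_gen ^^ N) g) x / fact N * t ^ N"
    using has_field_derivative_cp_expect[OF cp_gen_iterate_measurable[OF g(1)] abs_cp_gen_iterate_le[OF g]]
    by (intro Maclaurin[of t N "\<lambda>m s. cp_expect s ((cp_gen ^^ m) g) x" "\<lambda>s. cp_expect s g x"] t N) auto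
  then obtain s where s: "0 < s" "cp_expect t g x
    = (\<Sum>m<N. cp_expect 0 ((cp_gen ^^ m) g) x / fact m * t ^ m) + cp_expect s ((cp_gen ^^ N) g) x / fact N * t ^ N"
    by auto
  have "cp_expect 0 f x = f x" for f
    using powser_zero[of "\<lambda>k. (conv_op r ^^ k) f x / fact k"] by (simp add: cp_expect_def)
  moreover have "\<bar>cp_expect s ((cp_gen ^^ N) g) x / fact N * t ^ N\<bar> \<le> C / fact N * t ^ N"
    using cp_expect_bound[of s "(cp_gen ^^ N) g" C x] s(1) C g t
    by (auto simp: abs_mult intro!: mult_right_mono divide_right_mono)
  ultimately show ?thesis using s(2) by simp
qed

end

section \<open>Compound Poisson approximation of the small jumps\<close>

text \<open>Adding and subtracting the first moment times the derivative replaces the total mass by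
  the first and second moments, which can be kept bounded along the approximation.\<close>

lemma cp_gen_eq_levy_op:
  assumes r: "\<And>w. 0 \<le> r w" "integrable lborel r" "integrable lborel (\<lambda>w. w * r w)"
    and g: "Cb UNIV (Suc (Suc k)) B g"
  shows "cp_gen r g = levy_op (LBINT w. w * r w) 0 r g"
proof
  fix x
  have gm: "g \<in> borel_measurable borel" using Cb_measurable[OF g] .
  have "integrable lborel (\<lambda>w. r w * g (x + w))"
    using Cb_bound[OF g] by (intro integrable_conv_op[OF r(2) gm, of B]) auto
  moreover have "integrable lborel (\<lambda>w. g x * r w)" "integrable lborel (\<lambda>w. deriv g x * (w * r w))"
    using r by auto
  ultimately have "(LBINT w. (r w * g (x + w) - g x * r w) - deriv g x * (w * r w))
      = (LBINT w. r w * g (x + w)) - (LBINT w. g x * r w) - (LBINT w. deriv g x * (w * r w))"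
    by (simp only: Bochner_Integration.integral_diff Bochner_Integration.integrable_diff)
  moreover have "(r w * g (x + w) - g x * r w) - deriv g x * (w * r w) = lin_rem g x w * r w" for w
    by (simp add: algebra_simps)
  ultimately show "cp_gen r g x = levy_op (LBINT w. w * r w) 0 r g x"
    by (simp add: cp_gen_def[OF r(1,2)] conv_op_def levy_op_def)
qed

lemma cp_gen_iterate_eq_levy_op:
  assumes r: "\<And>w. 0 \<le> r w" "integrable lborel r" "integrable lborel (\<lambda>w. w * r w)" "integrable lborel (\<lambda>w. w\<^sup>2 * r w)"
  shows "Cb UNIV (2 * j) B g \<Longrightarrow> (cp_gen r ^^ j) g = (levy_op (LBINT w. w * r w) 0 r ^^ j) g"
proof (induction j arbitrary: g B)
  case (Suc j)
  have rm: "r \<in> borel_measurable borel" using borel_measurable_integrable[OF r(2)] by simp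
  have g: "Cb UNIV (Suc (Suc (2 * j))) B g" using Suc.prems by (simp only: mult_Suc_right add_2_eq_Suc)
  then have "Cb UNIV (2 + 2 * j) B g" by (simp only: add_2_eq_Suc)
  from Suc.IH[OF Cb_levy_op[OF rm r(4) this]] cp_gen_eq_levy_op[OF r(1-3) g] show ?case
    by (simp del: funpow.simps Cb.simps add: funpow_Suc_right)
qed simp

section \<open>A density with prescribed moments\<close>

lemma has_bochner_integral_power_Icc:
  "a \<le> b \<Longrightarrow> has_bochner_integral lborel (\<lambda>w::real. w ^ k * indicator {a..b} w) ((b ^ Suc k - a ^ Suc k) / Suc k)"
proof -
  assume "a \<le> b"
  have "set_integrable lborel {a..b} (\<lambda>w. w ^ k)"
    by (intro borel_integrable_atLeastAtMost' continuous_intros)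
  with integral_power[OF \<open>a \<le> b\<close>, of k] show ?thesis
    by (simp add: has_bochner_integral_iff set_integrable_def mult.commute)
qed

lemma step_density_moments:
  fixes u l h :: real
  assumes "0 \<le> h"
  defines "p \<equiv> \<lambda>w. u * indicator {0..h} w + l * indicator {-h..0} w"
  shows "has_bochner_integral lborel p ((u + l) * h)"
    and "has_bochner_integral lborel (\<lambda>w. w * p w) ((u - l) * h\<^sup>2 / 2)"
    and "has_bochner_integral lborel (\<lambda>w. w\<^sup>2 * p w) ((u + l) * h ^ 3 / 3)"
    and "has_bochner_integral lborel (\<lambda>w. \<bar>w\<bar> ^ 3 * p w) ((u + l) * h ^ 4 / 4)"
proof -
  have eq: "w ^ k * p w = u * (w ^ k * indicator {0..h} w) + l * (w ^ k * indicator {-h..0} w)" for k w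
    unfolding p_def by (simp add: algebra_simps)
  \<comment> \<open>On the negative half \<open>\<bar>w\<bar> ^ 3\<close> is
    \<open>- (w ^ 3)\<close>; at 0, where both indicators are 1, the power vanishes.\<close>
  have eq3: "\<bar>w\<bar> ^ 3 * p w = u * (w ^ 3 * indicator {0..h} w) - l * (w ^ 3 * indicator {-h..0} w)" for w
    unfolding p_def by (auto simp: algebra_simps indicator_def)
  have *: "has_bochner_integral lborel (\<lambda>w. w ^ k * p w) 
     (u * (h ^ Suc k / Suc k) + l * (- ((- h) ^ Suc k) / Suc k))" for k
    unfolding eq using has_bochner_integral_power_Icc[of 0 h k] has_bochner_integral_power_Icc[of "-h" 0 k] assms(1)
    by (intro has_bochner_integral_add has_bochner_integral_mult_right) auto
  show "has_bochner_integral lborel p ((u + l) * h)"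
    using *[of 0] by (simp add: algebra_simps)
  show "has_bochner_integral lborel (\<lambda>w. w * p w) ((u - l) * h\<^sup>2 / 2)"
    using *[of 1] by (simp add: algebra_simps power2_eq_square diff_divide_distrib)
  show "has_bochner_integral lborel (\<lambda>w. w\<^sup>2 * p w) ((u + l) * h ^ 3 / 3)"
    using *[of 2] by (simp add: algebra_simps power2_eq_square power3_eq_cube add_divide_distrib)
  show "has_bochner_integral lborel (\<lambda>w. \<bar>w\<bar> ^ 3 * p w) ((u + l) * h ^ 4 / 4)"
  proof -
    have "has_bochner_integral lborel (\<lambda>w. \<bar>w\<bar> ^ 3 * p w) 
       (u * ((h ^ Suc 3 - 0 ^ Suc 3) / Suc 3) - l * ((0 ^ Suc 3 - (- h) ^ Suc 3) / Suc 3))"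
      unfolding eq3 using has_bochner_integral_power_Icc[of 0 h 3] has_bochner_integral_power_Icc[of "-h" 0 3] assms(1)
      by (intro has_bochner_integral_diff has_bochner_integral_mult_right) auto
    then show ?thesis by (simp add: algebra_simps add_divide_distrib power4_eq_xxxx)
  qed
qed

text \<open>Drift and Gaussian part are both imitated by a step density on \<open>[-h, h]\<close>: its heights are
  chosen such that the first moment is exact and the second one is exact up to \<open>O(h\<bar>\<beta>\<bar>)\<close>.\<close>

lemma small_jump_approximation:
  fixes q :: "real \<Rightarrow> real"
  assumes q: "\<And>w. 0 \<le> q w" "q \<in> borel_measurable borel" "integrable lborel (\<lambda>w. w\<^sup>2 * q w)"
    and supp: "\<And>w. \<epsilon> < \<bar>w\<bar> \<Longrightarrow> q w = 0" and \<epsilon>: "0 < \<epsilon>" "\<epsilon> \<le> 1" and v: "0 \<le> v" and d: "0 < d" "d \<le> \<epsilon>"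
  defines "I \<equiv> LBINT w. w\<^sup>2 * q w"
  shows "\<exists>r p. let z = (\<lambda>w. indicator {-d..d} w * q w) in
    (\<forall>w. 0 \<le> r w) \<and> integrable lborel r \<and> has_bochner_integral lborel (\<lambda>w. w * r w) a \<and>
    integrable lborel (\<lambda>w. w\<^sup>2 * r w) \<and> (\<forall>w. \<epsilon> < \<bar>w\<bar> \<longrightarrow> r w = 0) \<and>
    p \<in> borel_measurable borel \<and> integrable lborel (\<lambda>w. w\<^sup>2 * p w) \<and> integrable lborel (\<lambda>w. \<bar>w\<bar> ^ 3 * p w) \<and>
    z \<in> borel_measurable borel \<and> integrable lborel (\<lambda>w. w\<^sup>2 * z w) \<and> (\<forall>w. r w - q w = p w - z w) \<and>
    (LBINT w. \<bar>w\<^sup>2 * r w\<bar>) \<le> \<bar>a\<bar> + 2 * v + 2 * I \<and>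
    (LBINT w. \<bar>\<bar>w\<bar> ^ 3 * p w\<bar>) + \<bar>(LBINT w. w\<^sup>2 * p w) / 2 - v\<bar>
       \<le> d * (2 * v + 2 * (\<bar>a\<bar> + I))"
proof -
  \<comment> \<open>The first moment of \<open>q\<close> beyond \<open>d\<close> may be as large as
    \<open>I / d\<close>, and \<beta> inherits this size. With width \<open>d\<^sup>2\<close> the
    product \<open>h * \<bar>\<beta>\<bar>\<close> is still at most
    \<open>d * (\<bar>a\<bar> + I)\<close>.\<close>
  define h where "h = d\<^sup>2"
  have h: "0 < h" "h \<le> d" "h \<le> 1" using d \<epsilon> unfolding h_def
    by (auto simp: power2_eq_square mult_le_one mult_left_le)
  define f where "f = (\<lambda>w. indicator (- {-d..d}) w * q w)"
  define z where "z = (\<lambda>w. indicator {-d..d} w * q w)"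
  note [measurable] = q(2)
  have fz: "q w = f w + z w" for w unfolding f_def z_def by (auto simp: indicator_def)
  have fm [measurable]: "f \<in> borel_measurable borel" "z \<in> borel_measurable borel" unfolding f_def z_def by measurable
  have f0: "0 \<le> f w" "0 \<le> z w" for w using q(1) by (auto simp: f_def z_def)
  have f2i: "integrable lborel (\<lambda>w. w\<^sup>2 * f w)" and z2i: "integrable lborel (\<lambda>w. w\<^sup>2 * z w)"
    by (rule Bochner_Integration.integrable_bound[OF q(3)]; auto simp: f_def z_def indicator_def q(1))+
  have f2I: "(LBINT w. w\<^sup>2 * f w) \<le> I" unfolding I_def
    by (intro integral_mono f2i q(3)) (auto simp: f_def indicator_def q(1))
  have df: "d * \<bar>w\<bar> * f w \<le> w\<^sup>2 * f w" for w
  proof (cases "d < \<bar>w\<bar>")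
    case True
    then show ?thesis using mult_right_mono[of d "\<bar>w\<bar>" "\<bar>w\<bar> * f w"] f0(1)[of w]
      by (simp add: power2_eq_square mult_ac flip: abs_mult)
  qed (auto simp: f_def indicator_def)
  have f1i: "integrable lborel (\<lambda>w. w * f w)"
  proof (rule Bochner_Integration.integrable_bound)
    show "integrable lborel (\<lambda>w. w\<^sup>2 * f w / d)" using f2i by simp
    show "AE w in lborel. norm (w * f w) \<le> norm (w\<^sup>2 * f w / d)"
      using df f0 d by (auto simp: abs_mult field_simps)
    show "(\<lambda>w. w * f w) \<in> borel_measurable lborel" using fm(1) by simp
  qed
  have f0i: "integrable lborel f"
  proof (rule Bochner_Integration.integrable_bound)
    show "integrable lborel (\<lambda>w. \<bar>w * f w\<bar> / d)" using f1i by simp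
    show "AE w in lborel. norm (f w) \<le> norm (\<bar>w * f w\<bar> / d)"
    proof (rule AE_I2)
      fix w
      show "norm (f w) \<le> norm (\<bar>w * f w\<bar> / d)"
      proof (cases "d < \<bar>w\<bar>")
        case True
        then have "d * f w \<le> \<bar>w\<bar> * f w" using f0(1)[of w] by (intro mult_right_mono) auto
        then show ?thesis using d f0(1)[of w] by (simp add: abs_mult field_simps)
      qed (auto simp: f_def indicator_def)
    qed
  qed (simp add: fm)
  define \<beta> where "\<beta> = a - (LBINT w. w * f w)"
  have "\<bar>LBINT w. w * f w\<bar> \<le> (LBINT w. \<bar>w * f w\<bar>)" by (rule integral_abs_bound)
  also have "\<dots> \<le> (LBINT w. w\<^sup>2 * f w / d)"
    using df f0 d by (intro integral_mono integrable_abs f1i integrable_divide f2i) (auto simp: abs_mult field_simps)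
  also have "\<dots> \<le> I / d" using f2I d by (simp add: divide_right_mono)
  finally have "\<bar>\<beta>\<bar> \<le> \<bar>a\<bar> + I / d" unfolding \<beta>_def by linarith
  then have "d * \<bar>\<beta>\<bar> \<le> d * (\<bar>a\<bar> + I / d)" using d by (intro mult_left_mono) auto
  also have "\<dots> \<le> \<bar>a\<bar> + I" using d \<epsilon> mult_right_mono[of d 1 "\<bar>a\<bar>"] by (simp add: algebra_simps)
  finally have "d * (d * \<bar>\<beta>\<bar>) \<le> d * (\<bar>a\<bar> + I)" using d by (intro mult_left_mono) auto
  then have \<beta>h: "h * \<bar>\<beta>\<bar> \<le> d * (\<bar>a\<bar> + I)" by (simp add: h_def power2_eq_square mult_ac)
  have I0: "0 \<le> I" unfolding I_def using q(1) by simp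
  have "d * (\<bar>a\<bar> + I) \<le> \<bar>a\<bar> + I" using d \<epsilon> I0 mult_right_mono[of d 1 "\<bar>a\<bar> + I"] by simp
  with \<beta>h have \<beta>h': "h * \<bar>\<beta>\<bar> \<le> \<bar>a\<bar> + I" by simp
  \<comment> \<open>The symmetric part has second moment \<open>2 * v\<close>, since
    \<open>v\<close> is half a variance. The sign of \<beta> decides on which side the remaining
    part is put, and this keeps both heights nonnegative.\<close>
  define u l where "u = 3 * v / h ^ 3 + 2 * max \<beta> 0 / h\<^sup>2" and "l = 3 * v / h ^ 3 + 2 * max (- \<beta>) 0 / h\<^sup>2"
  have ul0: "0 \<le> u" "0 \<le> l" using v h by (auto simp: u_def l_def)
  have umin: "u - l = 2 * \<beta> / h\<^sup>2" and upl: "u + l = 6 * v / h ^ 3 + 2 * \<bar>\<beta>\<bar> / h\<^sup>2"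
    by (auto simp: u_def l_def max_def abs_if field_simps)
  define p where "p = (\<lambda>w. u * indicator {0..h} w + l * indicator {-h..0} w)"
  have p0: "0 \<le> p w" for w using ul0 by (simp add: p_def)
  have pm [measurable]: "p \<in> borel_measurable borel" unfolding p_def by measurable
  have m1: "(u - l) * h\<^sup>2 / 2 = \<beta>" using h by (simp add: umin)
  have m2: "(u + l) * h ^ 3 / 3 = 2 * v + 2 * (h * \<bar>\<beta>\<bar>) / 3"
    unfolding upl using h by (simp add: field_simps eval_nat_numeral)
  have m3: "(u + l) * h ^ 4 / 4 = 3 * v * h / 2 + h * (h * \<bar>\<beta>\<bar>) / 2"
    unfolding upl using h by (simp add: field_simps eval_nat_numeral)
  note sm = step_density_moments[OF less_imp_le[OF h(1)], where u = u and l = l]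
  have mom: "has_bochner_integral lborel p ((u + l) * h)"
    "has_bochner_integral lborel (\<lambda>w. w * p w) \<beta>"
    "has_bochner_integral lborel (\<lambda>w. w\<^sup>2 * p w) (2 * v + 2 * (h * \<bar>\<beta>\<bar>) / 3)"
    "has_bochner_integral lborel (\<lambda>w. \<bar>w\<bar> ^ 3 * p w) (3 * v * h / 2 + h * (h * \<bar>\<beta>\<bar>) / 2)"
    using sm unfolding p_def m1 m2 m3 by simp_all
  define r where "r = (\<lambda>w. f w + p w)"
  have r1: "has_bochner_integral lborel (\<lambda>w. w * r w) a"
  proof -
    have "has_bochner_integral lborel (\<lambda>w. w * f w + w * p w) ((LBINT w. w * f w) + \<beta>)"
      by (intro has_bochner_integral_add mom(2) has_bochner_integral_integrable f1i)
    then show ?thesis by (simp add: r_def \<beta>_def distrib_left)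
  qed
  have r2: "has_bochner_integral lborel (\<lambda>w. w\<^sup>2 * r w) ((LBINT w. w\<^sup>2 * f w) + (2 * v + 2 * (h * \<bar>\<beta>\<bar>) / 3))"
    unfolding r_def distrib_left
    by (intro has_bochner_integral_add mom(3) has_bochner_integral_integrable f2i)
  have r0: "integrable lborel r" unfolding r_def
    using f0i mom(1) by (auto intro: integrable.intros)
  have "(LBINT w. \<bar>w\<^sup>2 * r w\<bar>) = (LBINT w. w\<^sup>2 * r w)"
    using f0 p0 by (auto simp: r_def)
  also have "\<dots> \<le> \<bar>a\<bar> + 2 * v + 2 * I"
    unfolding has_bochner_integral_integral_eq[OF r2] using f2I \<beta>h' I0 by linarith
  finally have K: "(LBINT w. \<bar>w\<^sup>2 * r w\<bar>) \<le> \<bar>a\<bar> + 2 * v + 2 * I" .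
  have "(LBINT w. \<bar>\<bar>w\<bar> ^ 3 * p w\<bar>) = 3 * v * h / 2 + h * (h * \<bar>\<beta>\<bar>) / 2"
    using has_bochner_integral_integral_eq[OF mom(4)] p0 by simp
  moreover have "\<bar>(LBINT w. w\<^sup>2 * p w) / 2 - v\<bar> = h * \<bar>\<beta>\<bar> / 3"
    unfolding has_bochner_integral_integral_eq[OF mom(3)] using h by (simp add: field_simps)
  moreover have "h * (h * \<bar>\<beta>\<bar>) \<le> h * \<bar>\<beta>\<bar>" using h mult_right_mono[of h 1 "h * \<bar>\<beta>\<bar>"] by simp
  moreover have "v * h \<le> v * d" using h v by (intro mult_left_mono) auto
  moreover have "0 \<le> v * d" "0 \<le> d * (\<bar>a\<bar> + I)" using v d I0 by auto
  ultimately have \<kappa>: "(LBINT w. \<bar>\<bar>w\<bar> ^ 3 * p w\<bar>) + \<bar>(LBINT w. w\<^sup>2 * p w) / 2 - v\<bar> \<le> d * (2 * v + 2 * (\<bar>a\<bar> + I))"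
    using \<beta>h unfolding distrib_left[of d "2 * v"] mult.left_commute[of d 2] mult.commute[of d v] by linarith
  have "r w = 0" if "\<epsilon> < \<bar>w\<bar>" for w
    using that supp[OF that] h d by (auto simp: r_def f_def p_def indicator_def)
  then show ?thesis unfolding Let_def z_def[symmetric]
    using r1 r2 r0 K \<kappa> f0 p0 pm fm z2i mom(3,4)
    by (intro exI[of _ r] exI[of _ p]) (auto simp: fz r_def intro: integrable.intros)
qed

section \<open>Smoothness of the tails of the convolution powers\<close>

lemma CbI:
  assumes "\<And>i x. i < k \<Longrightarrow> x \<in> S \<Longrightarrow> (deriv ^^ i) g field_differentiable at x"
    and "\<And>i x. i \<le> k \<Longrightarrow> x \<in> S \<Longrightarrow> \<bar>(deriv ^^ i) g x\<bar> \<le> B"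
    and "continuous_on S ((deriv ^^ k) g)"
  shows "Cb S k B g"
  using assms
proof (induction k arbitrary: g)
  case 0
  from 0(2)[of 0] 0(3) show ?case by simp
next
  case (Suc k)
  have "Cb S k B (deriv g)"
    using Suc.prems(1)[of "Suc _"] Suc.prems(2)[of "Suc _"] Suc.prems(3)
    by (intro Suc.IH) (simp_all add: funpow_Suc_right del: funpow.simps)
  then show ?case using Suc.prems(1)[of 0] Suc.prems(2)[of 0] by simp
qed

lemma
  assumes "truncation_function \<epsilon> c"
  shows truncation_le_1: "c x \<le> 1" and truncation_nonneg: "0 \<le> c x"
    and truncation_eq_1: "\<bar>x\<bar> \<le> \<epsilon> / 2 \<Longrightarrow> c x = 1" and truncation_eq_0: "\<epsilon> < \<bar>x\<bar> \<Longrightarrow> c x = 0"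
proof -
  have c: "indicator {- \<epsilon> / 2..\<epsilon> / 2} x \<le> c x" "c x \<le> indicator {- \<epsilon>..\<epsilon>} x"
    using assms by (auto simp: truncation_function_def)
  show "c x \<le> 1" "0 \<le> c x" using c by (auto split: split_indicator_asm)
  show "\<bar>x\<bar> \<le> \<epsilon> / 2 \<Longrightarrow> c x = 1" "\<epsilon> < \<bar>x\<bar> \<Longrightarrow> c x = 0"
    using c \<open>c x \<le> 1\<close> \<open>0 \<le> c x\<close> by (auto split: split_indicator_asm)
qed

lemma open_abs_greater: "open {x::real. a < \<bar>x\<bar>}"
  by (intro open_Collect_less continuous_intros)

lemma open_abs_less: "open {x::real. \<bar>x\<bar> < a}"
  by (intro open_Collect_less continuous_intros)

text \<open>Smoothness gives bounds on a compact interval only; beyond \<epsilon> the function is 0.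
  The two open regions overlap between \<epsilon> and \<open>2 * \<epsilon>\<close>.\<close>

lemma truncation_Cb:
  assumes c: "truncation_function \<epsilon> c" and "0 < \<epsilon>"
  shows "\<exists>B. Cb UNIV k B c"
proof -
  have D: "(deriv ^^ i) c field_differentiable at x" for i x
    using c by (auto simp: truncation_function_def smooth_fun_def)
  have cont: "continuous_on S ((deriv ^^ i) c)" for S i
    using D by (intro continuous_at_imp_continuous_on) (auto intro: field_differentiable_imp_continuous_at)
  have "\<exists>B. \<forall>x\<in>{-2*\<epsilon>..2*\<epsilon>}. \<bar>(deriv ^^ i) c x\<bar> \<le> B" for i
    using compact_imp_bounded[OF compact_continuous_image[OF cont compact_Icc]]
    by (fastforce simp: bounded_iff)
  then obtain B where B: "\<And>i x. x \<in> {-2*\<epsilon>..2*\<epsilon>} \<Longrightarrow> \<bar>(deriv ^^ i) c x\<bar> \<le> B i" by metis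
  define C where "C = (\<Sum>i\<le>k. \<bar>B i\<bar>)"
  have C: "B i \<le> C" if "i \<le> k" for i
    using member_le_sum[of i "{..k}" "\<lambda>i. \<bar>B i\<bar>"] that unfolding C_def by auto
  have "Cb {x. \<bar>x\<bar> < 2 * \<epsilon>} k C c"
    using D cont by (intro CbI) (auto intro!: order_trans[OF B C])
  moreover have "Cb {x. \<epsilon> < \<bar>x\<bar>} k C c"
    using Cb_const[of 0 C "{x. \<epsilon> < \<bar>x\<bar>}" k] truncation_eq_0[OF c]
    by (subst Cb_cong[OF open_abs_greater, where g = "\<lambda>_. 0"]) (auto simp: C_def sum_nonneg)
  ultimately have "Cb ({x. \<bar>x\<bar> < 2 * \<epsilon>} \<union> {x. \<epsilon> < \<bar>x\<bar>}) k C c"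
    by (intro Cb_Un open_abs_greater open_abs_less)
  moreover have "{x. \<bar>x\<bar> < 2 * \<epsilon>} \<union> {x. \<epsilon> < \<bar>x\<bar>} = (UNIV :: real set)"
    using \<open>0 < \<epsilon>\<close> by auto
  ultimately show ?thesis by auto
qed

text \<open>A singularity of \<open>s\<close> at 0 is invisible, because \<open>1 - c\<close>
  vanishes up to \<epsilon> / 2; a product estimate applies beyond \<epsilon> / 4, and the regions
  overlap. Differentiability at order \<open>k\<close> itself provides the continuity of the k-th
  derivative.\<close>

lemma sbar_Cb:
  assumes c: "truncation_function \<epsilon> c" and "0 < \<epsilon>"
    and D: "\<And>i x. i \<le> k \<Longrightarrow> x \<noteq> 0 \<Longrightarrow> (deriv ^^ i) s field_differentiable at x"
    and bd: "\<And>i \<delta>. i \<le> k \<Longrightarrow> \<delta> > 0 \<Longrightarrow> bounded ((deriv ^^ i) s ` {x. \<bar>x\<bar> > \<delta>})"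
  shows "\<exists>B. Cb UNIV k B (sbar c s)"
proof -
  let ?S = "{x. \<epsilon> / 4 < \<bar>x\<bar>}" and ?T = "{x. \<bar>x\<bar> < \<epsilon> / 2}"
  have "\<exists>B. \<forall>x\<in>?S. \<bar>(deriv ^^ i) s x\<bar> \<le> B" if "i \<le> k" for i
    using bd[OF that, of "\<epsilon> / 4"] \<open>0 < \<epsilon>\<close> by (fastforce simp: bounded_iff)
  then obtain B where B: "\<And>i x. i \<le> k \<Longrightarrow> x \<in> ?S \<Longrightarrow> \<bar>(deriv ^^ i) s x\<bar> \<le> B i" by metis
  define C where "C = (\<Sum>i\<le>k. \<bar>B i\<bar>)"
  have C: "B i \<le> C" if "i \<le> k" for i
    using member_le_sum[of i "{..k}" "\<lambda>i. \<bar>B i\<bar>"] that unfolding C_def by auto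
  have s: "Cb ?S k C s"
  proof (rule CbI)
    show "continuous_on ?S ((deriv ^^ k) s)" using D \<open>0 < \<epsilon>\<close>
      by (intro continuous_at_imp_continuous_on ballI field_differentiable_imp_continuous_at) auto
    show "\<bar>(deriv ^^ i) s x\<bar> \<le> C" if "i \<le> k" "x \<in> ?S" for i x
      using B[OF that] C[OF that(1)] by linarith
    show "(deriv ^^ i) s field_differentiable at x" if "i < k" "x \<in> ?S" for i x
      using that \<open>0 < \<epsilon>\<close> by (intro D) auto
  qed
  obtain E where E: "Cb UNIV k E c" using truncation_Cb[OF c \<open>0 < \<epsilon>\<close>] by metis
  have "Cb ?S k (1 + E) (\<lambda>x. 1 - c x)"
    using Cb_diff[OF open_UNIV Cb_const[of 1 1] E] by (auto intro: Cb_mono simp del: Cb.simps)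
  from Cb_mult[OF open_abs_greater this s] obtain F where F: "Cb ?S k F (\<lambda>x. (1 - c x) * s x)" by metis
  have "Cb ?S k F (sbar c s)"
    using F by (subst Cb_cong[OF open_abs_greater, where g = "\<lambda>x. (1 - c x) * s x"]) (use \<open>0 < \<epsilon>\<close> in \<open>auto simp: sbar_def\<close>)
  then have 1: "Cb ?S k \<bar>F\<bar> (sbar c s)" by (rule Cb_mono) auto
  have 2: "Cb ?T k \<bar>F\<bar> (sbar c s)"
    using Cb_const[of 0 "\<bar>F\<bar>" ?T k] truncation_eq_1[OF c]
    by (subst Cb_cong[OF open_abs_less, where g = "\<lambda>_. 0"]) (auto simp: sbar_def)
  have "?S \<union> ?T = UNIV" using \<open>0 < \<epsilon>\<close> by auto
  with Cb_Un[OF open_abs_greater open_abs_less 1 2] show ?thesis by auto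
qed

text \<open>Near \<open>z\<close> the tail differs from the fixed tail starting at
  \<open>z - 1\<close> only by an integral over a compact interval, to which the fundamental theorem
  applies.\<close>

lemma has_field_derivative_tail_integral:
  fixes f :: "real \<Rightarrow> real"
  assumes f: "integrable lborel f" "continuous_on UNIV f"
  shows "((\<lambda>z. LBINT u:{z..}. f u) has_field_derivative - f z) (at z)"
proof -
  have si: "set_integrable lborel A f" if "A \<in> sets borel" for A
    using integrable_mult_indicator[of A lborel f] f(1) that by (simp add: set_integrable_def)
  have eq: "(LBINT u:{x..}. f u) = (LBINT u:{z - 1..}. f u) - integral {z - 1..x} f" if "z - 1 < x" for x
  proof -
    have "{z - 1..} = {z - 1..x} \<union> {x<..}" using that by auto
    moreover have "{z - 1..x} \<inter> {x<..} = {}" by auto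
    ultimately have "(LBINT u:{z - 1..}. f u) = (LBINT u:{z - 1..x}. f u) + (LBINT u:{x<..}. f u)"
      using set_integral_Un[OF _ si si, of "{z - 1..x}" "{x<..}"] by simp
    moreover have "(LBINT u:{x<..}. f u) = (LBINT u:{x..}. f u)"
      unfolding set_lebesgue_integral_def
    proof (rule integral_cong_AE)
      show "AE u in lborel. indicator {x<..} u *\<^sub>R f u = indicator {x..} u *\<^sub>R f u"
        using AE_lborel_singleton[of x] by eventually_elim (auto simp: indicator_def)
    qed (use borel_measurable_integrable[OF f(1)] in auto)
    ultimately show ?thesis using set_borel_integral_eq_integral(2)[OF si[of "{z - 1..x}"]] by simp
  qed
  have "((\<lambda>x. integral {z - 1..x} f) has_real_derivative f z) (at z within {z - 1..z + 1})"
    using f(2) by (intro integral_has_real_derivative) (auto intro: continuous_on_subset)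
  then have "((\<lambda>x. integral {z - 1..x} f) has_field_derivative f z) (at z)"
    by (simp add: at_within_Icc_at)
  then have "((\<lambda>x. (LBINT u:{z - 1..}. f u) - integral {z - 1..x} f) has_field_derivative - f z) (at z)"
    by (auto intro!: derivative_eq_intros)
  then show ?thesis
    by (rule has_field_derivative_transform_within_open[where S = "{z - 1<..}"]) (auto simp: eq)
qed

text \<open>The derivative in \<open>x\<close> is \<open>sbar c s (y - x)\<close>, so one order is
  gained over \<open>sbar\<close>. Shift and reflection do not change sup norms, so the bound is
  free of \<open>y\<close>.\<close>

lemma f_hat_1_Cb:
  assumes i: "integrable lborel (sbar c s)" and C: "Cb UNIV k B (sbar c s)"
  shows "Cb UNIV (Suc k) (max B (LBINT u. \<bar>sbar c s u\<bar>)) (f_hat c s y (Suc 0))"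
proof -
  let ?M = "max B (LBINT u. \<bar>sbar c s u\<bar>)"
  have d: "(f_hat c s y (Suc 0) has_field_derivative sbar c s (y - x)) (at x)" for x
  proof -
    have "((\<lambda>x. y - x) has_field_derivative -1) (at x)" by (auto intro!: derivative_eq_intros)
    from DERIV_chain2[OF has_field_derivative_tail_integral[OF i Cb_continuous[OF C]] this]
    show ?thesis unfolding f_hat_def by simp
  qed
  then have "deriv (f_hat c s y (Suc 0)) = (\<lambda>x. sbar c s (y + (-1) * x))"
    by (auto intro!: DERIV_imp_deriv)
  moreover have "Cb UNIV k ?M (\<lambda>x. sbar c s (y + (-1) * x))"
    by (intro Cb_affine Cb_mono[OF C]) auto
  moreover have "\<bar>f_hat c s y (Suc 0) x\<bar> \<le> ?M" for x
  proof -
    have "\<bar>f_hat c s y (Suc 0) x\<bar> \<le> (LBINT u. \<bar>indicator {y - x..} u *\<^sub>R sbar c s u\<bar>)"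
      unfolding f_hat_def set_lebesgue_integral_def by (simp add: integral_abs_bound)
    also have "\<dots> \<le> (LBINT u. \<bar>sbar c s u\<bar>)"
      by (intro integral_mono integrable_abs integrable_mult_indicator i) (auto simp: indicator_def)
    finally show ?thesis by simp
  qed
  ultimately show ?thesis using d by (auto simp: field_differentiable_def simp del: mult_minus1)
qed

section \<open>Convolution powers as iterated operators\<close>

context
  fixes f :: "real \<Rightarrow> real"
  assumes f_nonneg: "\<And>x. 0 \<le> f x" and f: "integrable lborel f"
begin

lemma f_borel: "f \<in> borel_measurable borel"
  using borel_measurable_integrable[OF f] by simp

lemma integrable_convolution_kernel:
  assumes g_nonneg: "\<And>x. 0 \<le> g x" and g: "integrable lborel g"
  shows "integrable (lborel \<Otimes>\<^sub>M lborel) (\<lambda>(u, x). g (x - u) * f u)"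
proof (rule lborel_pair.Fubini_integrable)
  note [measurable] = f_borel
  have [measurable]: "g \<in> borel_measurable borel" using borel_measurable_integrable[OF g] by simp
  show "(\<lambda>(u, x). g (x - u) * f u) \<in> borel_measurable (lborel \<Otimes>\<^sub>M lborel)" by measurable
  have gi: "integrable lborel (\<lambda>x. g (x - u))" for u
    using lborel_integrable_real_affine[OF g, of 1 "-u"] by (simp add: add.commute)
  have "(LBINT x. g (x - u)) = mass g" for u
    using lborel_integral_real_affine[of 1 g "-u"] by (simp add: add.commute)
  then have "(LBINT x. norm (case (u, x) of (u, x) \<Rightarrow> g (x - u) * f u)) = mass g * f u" for u
    using g_nonneg f_nonneg by (simp add: abs_mult)
  then show "integrable lborel (\<lambda>u. LBINT x. norm (case (u, x) of (u, x) \<Rightarrow> g (x - u) * f u))"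
    using f by simp
  show "AE u in lborel. integrable lborel (\<lambda>x. case (u, x) of (u, x) \<Rightarrow> g (x - u) * f u)"
    using gi by simp
qed

lemma conv_power_integrable: "integrable lborel (conv_power f (Suc i)) \<and> (\<forall>x. 0 \<le> conv_power f (Suc i) x)"
proof (induction i)
  case (Suc i)
  then have "integrable (lborel \<Otimes>\<^sub>M lborel) (\<lambda>(u, x). conv_power f (Suc i) (x - u) * f u)"
    by (intro integrable_convolution_kernel) auto
  from lborel_pair.integrable_snd[OF this] Suc show ?case
    using f_nonneg by (auto intro!: Bochner_Integration.integral_nonneg)
qed (auto simp: f f_nonneg)

text \<open>After Fubini the inner integral is again a tail, shifted by the last jump
  \<open>u\<close>. This identifies the functions \<open>f_hat\<close> with the coefficients of the
  exponential series of the compound Poisson part with density \<open>f\<close>.\<close>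

lemma tail_conv_power:
  "(LBINT u:{y - x..}. conv_power f (Suc i) u) = (conv_op f ^^ Suc i) (indicator {y..}) x"
proof (induction i arbitrary: x)
  case 0
  show ?case unfolding set_lebesgue_integral_def
    by (auto simp: conv_op_def indicator_def intro!: Bochner_Integration.integral_cong)
next
  case (Suc i)
  let ?g = "conv_power f (Suc i)"
  have g: "\<And>x. 0 \<le> ?g x" "integrable lborel ?g" using conv_power_integrable by auto
  note int = integrable_convolution_kernel[OF g]
  have int': "integrable (lborel \<Otimes>\<^sub>M lborel) (\<lambda>(u, v). indicator {y - x..} v * (?g (v - u) * f u))"
  proof -
    have "UNIV \<times> {y - x..} \<in> sets (lborel \<Otimes>\<^sub>M lborel)" by simp
    from integrable_mult_indicator[OF this int] show ?thesis
      by (rule Bochner_Integration.integrable_cong[THEN iffD1, rotated 2]) (auto simp: indicator_def)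
  qed
  have "(LBINT v:{y - x..}. conv_power f (Suc (Suc i)) v) = (LBINT v. LBINT u. indicator {y - x..} v * (?g (v - u) * f u))"
    unfolding set_lebesgue_integral_def by simp
  also have "\<dots> = (LBINT u. LBINT v. indicator {y - x..} v * (?g (v - u) * f u))"
    using lborel_pair.Fubini_integral[OF int'] by simp
  also have "\<dots> = (LBINT u. f u * (LBINT v. indicator {y - x..} v * ?g (v - u)))"
    by (simp add: mult_ac flip: integral_mult_right_zero)
  also have "\<dots> = (LBINT u. f u * (LBINT v:{y - (x + u)..}. ?g v))"
  proof (intro Bochner_Integration.integral_cong refl arg_cong[where f = "\<lambda>z. f _ * z"])
    fix u
    have "(LBINT v. indicator {y - x..} v * ?g (v - u)) = (LBINT v. indicator {y - x..} (u + v) * ?g v)"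
      using lborel_integral_real_affine[of 1 "\<lambda>v. indicator {y - x..} v * ?g (v - u)" u] by simp
    also have "\<dots> = (LBINT v:{y - (x + u)..}. ?g v)"
      unfolding set_lebesgue_integral_def by (intro Bochner_Integration.integral_cong) (auto simp: indicator_def)
    finally show "(LBINT v. indicator {y - x..} v * ?g (v - u)) = (LBINT v:{y - (x + u)..}. ?g v)" .
  qed
  finally show ?case
    unfolding Suc funpow.simps(2)[of "Suc i"] o_apply conv_op_def[of f "(conv_op f ^^ Suc i) (indicator {y..})"] .
qed

end

lemma f_hat_eq_conv_op_iterate:
  assumes "\<And>x. 0 \<le> sbar c s x" "integrable lborel (sbar c s)"
  shows "f_hat c s y (Suc i) = (conv_op (sbar c s) ^^ Suc i) (indicator {y..})"
  unfolding f_hat_def using tail_conv_power[OF assms] by (simp add: fun_eq_iff)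

text \<open>\<open>F\<close> is chosen before \<open>y\<close>; this is the source of the uniformity
  in \<open>y\<close>. The extra order comes from the tail of \<open>sbar\<close> itself, and
  further convolutions preserve it.\<close>

lemma f_hat_Cb:
  assumes sb: "\<And>x. 0 \<le> sbar c s x" "integrable lborel (sbar c s)" "Cb UNIV k B (sbar c s)"
  shows "\<exists>F. \<forall>y. Cb UNIV (Suc k) F (f_hat c s y (Suc i))"
proof (induction i)
  case 0
  show ?case using f_hat_1_Cb[OF sb(2,3)] by blast
next
  case (Suc i)
  then obtain F where F: "\<And>y. Cb UNIV (Suc k) F (f_hat c s y (Suc i))" by blast
  have "f_hat c s y (Suc (Suc i)) = conv_op (sbar c s) (f_hat c s y (Suc i))" for y
    unfolding f_hat_eq_conv_op_iterate[OF sb(1,2)] by simp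
  then show ?case using Cb_conv_op[OF sb(2) F] by metis
qed

section \<open>The characteristic function of the process\<close>

lemma set_integral_partition:
  fixes h :: "'e \<Rightarrow> 'b::{banach, second_countable_topology}" and n :: nat
  assumes B: "\<And>i. i < n \<Longrightarrow> B i \<in> sets m" "\<And>i. i < n \<Longrightarrow> emeasure m (B i) < \<infinity>"
    and disj: "disjoint_family_on B {..<n}" and A: "A = (\<Union>i<n. B i)"
    and h: "\<And>i p. i < n \<Longrightarrow> p \<in> B i \<Longrightarrow> h p = v i"
  shows "(LINT p:A|m. h p) = (\<Sum>i<n. measure m (B i) *\<^sub>R v i)"
proof -
  have eq: "indicator A p *\<^sub>R h p = (\<Sum>i<n. indicator (B i) p *\<^sub>R v i)" for p
  proof (cases "p \<in> A")
    case True
    then obtain j where j: "j < n" "p \<in> B j" unfolding A by auto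
    have "indicator (B i) p *\<^sub>R v i = (if i = j then h p else 0)" if "i < n" for i
      using disj j h[OF j] that by (auto simp: disjoint_family_on_def indicator_def)
    then have "(\<Sum>i<n. indicator (B i) p *\<^sub>R v i) = (\<Sum>i<n. if i = j then h p else 0)"
      by (intro sum.cong) auto
    also have "\<dots> = h p" using j(1) sum.delta[of "{..<n}" j "\<lambda>_. h p"] by simp
    finally show ?thesis using True by simp
  qed (auto simp: A)
  have i: "integrable m (indicator (B i) :: 'e \<Rightarrow> real)" if "i < n" for i
    using B[OF that] by (simp add: integrable_indicator_iff)
  have "(LINT p:A|m. h p) = (\<Sum>i<n. LINT p|m. indicator (B i) p *\<^sub>R v i)"
    unfolding set_lebesgue_integral_def eq using i by (intro Bochner_Integration.integral_sum) auto
  also have "\<dots> = (\<Sum>i<n. measure m (B i) *\<^sub>R v i)"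
    using i B(1) sets.sets_into_space[OF B(1)] by (intro sum.cong) (auto simp: Int_absorb2)
  finally show ?thesis .
qed

text \<open>The values of an integrand are discretised, not the space. A bounded integrand then
  takes finitely many values, and its integral becomes a finite combination of counts on disjoint
  sets.\<close>

definition grid :: "nat \<Rightarrow> real \<Rightarrow> real" where
  "grid k x = real_of_int \<lfloor>real (Suc k) * x\<rfloor> / real (Suc k)"

lemma grid_bounds: "x - 1 / real (Suc k) \<le> grid k x" "grid k x \<le> x"
proof -
  show "grid k x \<le> x" unfolding grid_def by (simp add: divide_le_eq mult.commute)
  have "real (Suc k) * x - 1 \<le> real_of_int \<lfloor>real (Suc k) * x\<rfloor>" by linarith
  then have "(real (Suc k) * x - 1) / real (Suc k) \<le> grid k x"
    unfolding grid_def by (intro divide_right_mono) auto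
  then show "x - 1 / real (Suc k) \<le> grid k x" by (simp add: diff_divide_distrib)
qed

lemma grid_tendsto: "(\<lambda>k. grid k x) \<longlonglongrightarrow> x"
proof (rule tendsto_sandwich)
  show "(\<lambda>k. x - 1 / real (Suc k)) \<longlonglongrightarrow> x"
    using tendsto_diff[OF tendsto_const[of x] LIMSEQ_inverse_real_of_nat] by (simp add: inverse_eq_divide)
qed (use grid_bounds in auto)

lemma grid_abs_le: "\<bar>x\<bar> \<le> C \<Longrightarrow> \<bar>grid k x\<bar> \<le> C + 1"
  using grid_bounds[where x = x and k = k] by (simp add: abs_le_iff) (smt (verit) divide_le_eq_1_pos of_nat_0_le_iff)

lemma grid_measurable [measurable]: "grid k \<in> borel_measurable borel"
  unfolding grid_def by measurable

lemma tendsto_set_integral_grid: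
  fixes G :: "real \<Rightarrow> 'b::{banach, second_countable_topology}"
  assumes A: "A \<in> sets m" "emeasure m A < \<infinity>" and [measurable]: "f \<in> borel_measurable m"
    and C: "\<And>p. p \<in> A \<Longrightarrow> \<bar>f p\<bar> \<le> C" and G: "continuous_on UNIV G" and D: "\<And>x. \<bar>x\<bar> \<le> C + 1 \<Longrightarrow> norm (G x) \<le> D"
  shows "(\<lambda>k. LINT p:A|m. G (grid k (f p))) \<longlonglongrightarrow> (LINT p:A|m. G (f p))"
  unfolding set_lebesgue_integral_def
proof (rule integral_dominated_convergence)
  have [measurable]: "G \<in> borel_measurable borel" using G by (rule borel_measurable_continuous_onI)
  note A(1)[measurable]
  show "(\<lambda>p. indicator A p *\<^sub>R G (f p)) \<in> borel_measurable m" by measurable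
  show "(\<lambda>p. indicator A p *\<^sub>R G (grid k (f p))) \<in> borel_measurable m" for k by measurable
  show "integrable m (\<lambda>p. D * indicator A p)" using A by (intro integrable_mult_right) (simp add: integrable_indicator_iff)
  show "AE p in m. (\<lambda>k. indicator A p *\<^sub>R G (grid k (f p))) \<longlonglongrightarrow> indicator A p *\<^sub>R G (f p)"
  proof (rule AE_I2)
    fix p
    have "isCont G (f p)" using G by (simp add: continuous_on_eq_continuous_at)
    from isCont_tendsto_compose[OF this grid_tendsto]
    show "(\<lambda>k. indicator A p *\<^sub>R G (grid k (f p))) \<longlonglongrightarrow> indicator A p *\<^sub>R G (f p)"
      by (intro tendsto_scaleR tendsto_const)
  qed
  show "AE p in m. norm (indicator A p *\<^sub>R G (grid k (f p))) \<le> D * indicator A p" for k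
    using D[OF grid_abs_le[OF C]] by (intro AE_I2) (auto simp: indicator_def)
qed

context
  fixes M :: "'w measure" and N :: "'e measure" and \<mu> :: "'w \<Rightarrow> 'e measure"
  assumes prm: "poisson_random_measure M N \<mu>"
begin

interpretation prob_space M
  using prm by (simp add: poisson_random_measure_def)

lemma prm_sets: "\<omega> \<in> space M \<Longrightarrow> sets (\<mu> \<omega>) = sets N"
  and prm_measurable [measurable]: "A \<in> sets N \<Longrightarrow> (\<lambda>\<omega>. emeasure (\<mu> \<omega>) A) \<in> borel_measurable M"
  and prm_prob: "A \<in> sets N \<Longrightarrow> emeasure N A < \<infinity> \<Longrightarrow>
    prob {\<omega>\<in>space M. emeasure (\<mu> \<omega>) A = of_nat k} = exp (- measure N A) * measure N A ^ k / fact k"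
  using prm by (auto simp: poisson_random_measure_def)

text \<open>The definition prescribes only the probabilities of the single integer values; as they
  sum to 1, nothing is left for other values, infinity included.\<close>

lemma prm_AE_nat:
  assumes A: "A \<in> sets N" "emeasure N A < \<infinity>"
  shows "AE \<omega> in M. \<exists>k::nat. emeasure (\<mu> \<omega>) A = of_nat k"
proof -
  let ?E = "\<lambda>k::nat. {\<omega>\<in>space M. emeasure (\<mu> \<omega>) A = of_nat k}"
  note [measurable] = prm_measurable[OF A(1)]
  have E: "?E k \<in> events" for k by measurable
  have "disjoint_family ?E" unfolding disjoint_family_on_def by auto
  then have "(\<lambda>k. prob (?E k)) sums prob (\<Union>k. ?E k)"
    using E by (intro finite_measure_UNION) auto
  moreover have "(\<lambda>k. exp (- measure N A) * (measure N A ^ k /\<^sub>R fact k)) sums (exp (- measure N A) * exp (measure N A))"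
    by (intro sums_mult exp_converges)
  then have "(\<lambda>k. prob (?E k)) sums 1"
    by (simp add: prm_prob[OF A] exp_minus field_simps)
  ultimately have "prob (\<Union>k. ?E k) = 1" by (rule sums_unique2)
  then have "AE \<omega> in M. \<omega> \<in> (\<Union>k. ?E k)" by (rule AE_prob_1)
  then show ?thesis by eventually_elim auto
qed

lemma prm_AE_finite:
  assumes A: "A \<in> sets N" "emeasure N A < \<infinity>"
  shows "AE \<omega> in M. emeasure (\<mu> \<omega>) A < \<infinity>"
  using prm_AE_nat[OF assms] by eventually_elim (auto simp: of_nat_less_top)

lemma prm_char:
  assumes A: "A \<in> sets N" "emeasure N A < \<infinity>"
  shows "(CLINT \<omega>|M. iexp (a * enn2real (emeasure (\<mu> \<omega>) A))) = exp (measure N A * (iexp a - 1))"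
proof -
  note [measurable] = prm_measurable[OF A(1)]
  let ?l = "measure N A"
  \<comment> \<open>Rounding changes the count on a null set only and makes it a natural number,
    whose law is determined by singletons.\<close>
  define \<kappa> where "\<kappa> = (\<lambda>\<omega>. nat \<lfloor>enn2real (emeasure (\<mu> \<omega>) A)\<rfloor>)"
  have \<kappa>m [measurable]: "\<kappa> \<in> M \<rightarrow>\<^sub>M count_space UNIV" unfolding \<kappa>_def by measurable
  let ?p = "\<lambda>k. exp (- ?l) * ?l ^ k / fact k"
  have D: "distr M (count_space UNIV) \<kappa> = density (count_space UNIV) (\<lambda>k. ennreal (?p k))"
  proof (rule measure_eqI_countable[where A = UNIV])
    fix k :: nat
    have "emeasure (distr M (count_space UNIV) \<kappa>) {k} = emeasure M (\<kappa> -` {k} \<inter> space M)"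
      by (subst emeasure_distr) auto
    also have "\<dots> = emeasure M {\<omega>\<in>space M. emeasure (\<mu> \<omega>) A = of_nat k}"
    proof (rule emeasure_eq_AE)
      show "AE \<omega> in M. (\<omega> \<in> \<kappa> -` {k} \<inter> space M) = (\<omega> \<in> {\<omega>\<in>space M. emeasure (\<mu> \<omega>) A = of_nat k})"
        using prm_AE_nat[OF A] by eventually_elim (auto simp: \<kappa>_def)
      show "\<kappa> -` {k} \<inter> space M \<in> events" by (rule measurable_sets[OF \<kappa>m]) auto
    qed measurable
    also have "\<dots> = ennreal (?p k)" by (simp add: emeasure_eq_measure prm_prob[OF A])
    also have "\<dots> = emeasure (density (count_space UNIV) (\<lambda>k. ennreal (?p k))) {k}"
      by (subst emeasure_density) (auto simp: nn_integral_indicator_singleton)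
    finally show "emeasure (distr M (count_space UNIV) \<kappa>) {k} = emeasure (density (count_space UNIV) (\<lambda>k. ennreal (?p k))) {k}" .
  qed auto
  have s: "summable (\<lambda>k. norm (?p k *\<^sub>R iexp (a * real k)))"
    using summable_mult[OF summable_exp[of ?l], of "exp (- ?l)"] by (simp add: field_simps)
  have "(CLINT \<omega>|M. iexp (a * enn2real (emeasure (\<mu> \<omega>) A))) = (CLINT \<omega>|M. iexp (a * real (\<kappa> \<omega>)))"
  proof (rule integral_cong_AE)
    show "AE \<omega> in M. iexp (a * enn2real (emeasure (\<mu> \<omega>) A)) = iexp (a * real (\<kappa> \<omega>))"
      using prm_AE_nat[OF A] by eventually_elim (auto simp: \<kappa>_def)
  qed measurable
  also have "\<dots> = (CLINT k|distr M (count_space UNIV) \<kappa>. iexp (a * real k))"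
    by (subst integral_distr) auto
  also have "\<dots> = (CLINT k|count_space UNIV. ?p k *\<^sub>R iexp (a * real k))"
    unfolding D by (subst integral_density) auto
  also have "\<dots> = (\<Sum>k. ?p k *\<^sub>R iexp (a * real k))"
    using s by (intro integral_count_space_nat) (simp add: integrable_count_space_nat_iff)
  also have "\<dots> = (\<Sum>k. exp (- complex_of_real ?l) * ((complex_of_real ?l * iexp a) ^ k /\<^sub>R fact k))"
    by (intro suminf_cong) (simp add: scaleR_conv_of_real exp_of_real[symmetric] power_mult_distrib exp_of_nat_mult[symmetric] field_simps)
  also have "\<dots> = exp (- complex_of_real ?l) * exp (complex_of_real ?l * iexp a)"
    by (intro sums_unique[symmetric] sums_mult exp_converges)
  also have "\<dots> = exp (measure N A * (iexp a - 1))"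
    by (simp add: exp_add[symmetric] algebra_simps)
  finally show ?thesis .
qed

definition prm_events :: "'w set set" where
  "prm_events = sigma_sets (space M) {(\<lambda>\<omega>. emeasure (\<mu> \<omega>) A) -` B \<inter> space M | A B. A \<in> sets N \<and> B \<in> sets borel}"

text \<open>\<open>V\<close> is carried along because the Brownian part must be joined to the jumps.
  \<open>Y\<close> is measurable for the sigma-algebra generated by the counts, hence independent of
  \<open>V\<close>; independence over disjoint sets then produces a product of Poisson
  factors.\<close>

lemma prm_simple_char:
  fixes n :: nat and v :: "nat \<Rightarrow> real"
  assumes A: "\<And>i. i < n \<Longrightarrow> A i \<in> sets N" "\<And>i. i < n \<Longrightarrow> emeasure N (A i) < \<infinity>"
    and disj: "disjoint_family_on A {..<n}"
    and V: "V \<in> borel_measurable M" 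
    and indep: "indep_set (sigma_sets (space M) {V -` B \<inter> space M | B. B \<in> sets borel}) prm_events"
  defines "Y \<equiv> \<lambda>\<omega>. \<Sum>i<n. enn2real (emeasure (\<mu> \<omega>) (A i)) * v i"
  shows "Y \<in> borel_measurable M"
    and "(CLINT \<omega>|M. iexp (u * (V \<omega> + Y \<omega>)))
      = (CLINT \<omega>|M. iexp (u * V \<omega>)) * exp (\<Sum>i<n. measure N (A i) *\<^sub>R (iexp (u * v i) - 1))"
proof -
  note [measurable] = V
  show Ym [measurable]: "Y \<in> borel_measurable M" unfolding Y_def
    using prm_measurable[OF A(1)]
    by (intro borel_measurable_sum borel_measurable_times borel_measurable_enn2real) auto
  let ?G = "sigma (space M) {(\<lambda>\<omega>. emeasure (\<mu> \<omega>) A) -` B \<inter> space M | A B. A \<in> sets N \<and> B \<in> sets borel}"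
  have sG: "sets ?G = prm_events" unfolding prm_events_def by (intro sets_measure_of) auto
  have spG: "space ?G = space M" by (intro space_measure_of) auto
  have "(\<lambda>\<omega>. emeasure (\<mu> \<omega>) (A i)) \<in> borel_measurable ?G" if "i < n" for i
  proof (rule measurableI)
    fix B :: "ennreal set" assume "B \<in> sets borel"
    then show "(\<lambda>\<omega>. emeasure (\<mu> \<omega>) (A i)) -` B \<inter> space ?G \<in> sets ?G"
      unfolding sG spG prm_events_def using A(1)[OF that] by (intro sigma_sets.Basic) auto
  qed auto
  then have "Y \<in> borel_measurable ?G" unfolding Y_def
    by (intro borel_measurable_sum borel_measurable_times borel_measurable_enn2real) auto
  then have "{Y -` B \<inter> space M | B. B \<in> sets borel} \<subseteq> sets ?G"
    using measurable_sets[of Y ?G borel] spG by auto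
  then have "sigma_sets (space M) {Y -` B \<inter> space M | B. B \<in> sets borel} \<subseteq> prm_events"
    using sets.sigma_sets_subset[of _ ?G] spG sG by auto
  then have "indep_set (sigma_sets (space M) {V -` B \<inter> space M | B. B \<in> sets borel})
      (sigma_sets (space M) {Y -` B \<inter> space M | B. B \<in> sets borel})"
    using indep unfolding indep_set_def by (rule_tac indep_sets_mono_sets) (auto split: bool.splits)
  then have "indep_var borel V borel Y" unfolding indep_var_eq by simp
  from char_distr_add[OF this, of u]
  have 1: "(CLINT \<omega>|M. iexp (u * (V \<omega> + Y \<omega>))) = (CLINT \<omega>|M. iexp (u * V \<omega>)) * char (distr M borel Y) u"
    by (simp add: char_def integral_distr)
  have "indep_vars (\<lambda>_. borel) (\<lambda>i \<omega>. emeasure (\<mu> \<omega>) (A i)) {..<n}"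
    using prm A(1) disj by (simp add: poisson_random_measure_def)
  then have "indep_vars (\<lambda>_. borel) (\<lambda>i \<omega>. enn2real (emeasure (\<mu> \<omega>) (A i)) * v i) {..<n}"
    by (rule indep_vars_compose2[where Y = "\<lambda>i x. enn2real x * v i"]) measurable
  from char_distr_sum[OF this, of u]
  have "char (distr M borel Y) u = (\<Prod>i<n. char (distr M borel (\<lambda>\<omega>. enn2real (emeasure (\<mu> \<omega>) (A i)) * v i)) u)"
    unfolding Y_def .
  also have "\<dots> = (\<Prod>i<n. exp (measure N (A i) *\<^sub>R (iexp (u * v i) - 1)))"
  proof (intro prod.cong refl)
    fix i assume "i \<in> {..<n}"
    then have i: "A i \<in> sets N" "emeasure N (A i) < \<infinity>" using A by auto
    note [measurable] = prm_measurable[OF i(1)]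
    have "char (distr M borel (\<lambda>\<omega>. enn2real (emeasure (\<mu> \<omega>) (A i)) * v i)) u
       = (CLINT \<omega>|M. iexp ((u * v i) * enn2real (emeasure (\<mu> \<omega>) (A i))))"
      unfolding char_def by (subst integral_distr) (auto simp: mult_ac)
    then show "char (distr M borel (\<lambda>\<omega>. enn2real (emeasure (\<mu> \<omega>) (A i)) * v i)) u = exp (measure N (A i) *\<^sub>R (iexp (u * v i) - 1))"
      using prm_char[OF i, of "u * v i"] by (simp add: scaleR_conv_of_real)
  qed
  finally show "(CLINT \<omega>|M. iexp (u * (V \<omega> + Y \<omega>)))
      = (CLINT \<omega>|M. iexp (u * V \<omega>)) * exp (\<Sum>i<n. measure N (A i) *\<^sub>R (iexp (u * v i) - 1))"
    unfolding 1 by (simp add: exp_sum)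
qed

text \<open>The claim holds for the discretised integrand by the preceding lemma and passes to the
  limit by dominated convergence. \<open>Y\<close> is a measurable version of the random integral,
  with which it is identified only almost surely.\<close>

lemma prm_integral_char:
  assumes A: "A \<in> sets N" "emeasure N A < \<infinity>" and f [measurable]: "f \<in> borel_measurable N"
    and C: "\<And>p. p \<in> A \<Longrightarrow> \<bar>f p\<bar> \<le> C"
    and V [measurable]: "V \<in> borel_measurable M" 
    and indep: "indep_set (sigma_sets (space M) {V -` B \<inter> space M | B. B \<in> sets borel}) prm_events"
  shows "\<exists>Y\<in>borel_measurable M. (AE \<omega> in M. Y \<omega> = (LINT p:A|\<mu> \<omega>. f p)) \<and>
    (\<forall>u. (CLINT \<omega>|M. iexp (u * (V \<omega> + Y \<omega>))) = (CLINT \<omega>|M. iexp (u * V \<omega>)) * exp (CLINT p:A|N. iexp (u * f p) - 1))"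
proof -
  \<comment> \<open>The integer part of \<open>real (Suc k) * f p\<close> lies between
    \<open>- J k\<close> and \<open>J k\<close>. Shifted by \<open>J k\<close> it ranges over
    \<open>2 * J k + 1\<close> cells numbered from 0.\<close>
  define J where "J k = nat \<lceil>real (Suc k) * C\<rceil> + 1" for k
  define B where "B k i = {p\<in>A. \<lfloor>real (Suc k) * f p\<rfloor> = int i - int (J k)}" for k i
  define v where "v k i = real_of_int (int i - int (J k)) / real (Suc k)" for k i
  define Y where "Y k \<omega> = (\<Sum>i<2 * J k + 1. enn2real (emeasure (\<mu> \<omega>) (B k i)) * v k i)" for k \<omega>
  have "B k i = A \<inter> {p\<in>space N. \<lfloor>real (Suc k) * f p\<rfloor> = int i - int (J k)}" for k i
    using sets.sets_into_space[OF A(1)] by (auto simp: B_def)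
  then have B: "B k i \<in> sets N" for k i using A(1) by auto
  have Bfin: "emeasure m (B k i) < \<infinity>" if "emeasure m A < \<infinity>" "sets m = sets N" for m k i
    using that emeasure_mono[of "B k i" A m] A(1) by (auto simp: B_def intro: le_less_trans)
  have disj: "disjoint_family_on (B k) {..<2 * J k + 1}" for k
    by (auto simp: disjoint_family_on_def B_def)
  have AB: "A = (\<Union>i<2 * J k + 1. B k i)" for k
  proof -
    have "\<exists>i<2 * J k + 1. p \<in> B k i" if "p \<in> A" for p
    proof -
      have "\<bar>real (Suc k) * f p\<bar> \<le> real (Suc k) * C"
        using C[OF that] by (simp add: abs_mult mult_left_mono del: of_nat_Suc)
      then have "- int (J k) \<le> \<lfloor>real (Suc k) * f p\<rfloor>" "\<lfloor>real (Suc k) * f p\<rfloor> \<le> int (J k)"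
        unfolding J_def by linarith+
      then show ?thesis using that
        by (intro exI[of _ "nat (\<lfloor>real (Suc k) * f p\<rfloor> + int (J k))"]) (auto simp: B_def)
    qed
    then show ?thesis by (auto simp: B_def)
  qed
  have val: "grid k (f p) = v k i" if "p \<in> B k i" for k i p
    using that by (simp add: B_def v_def grid_def)
  have Ym [measurable]: "Y k \<in> borel_measurable M" for k
    unfolding Y_def by (rule prm_simple_char(1)[OF B Bfin[OF A(2) refl] disj V indep])
  have Yc: "(CLINT \<omega>|M. iexp (u * (V \<omega> + Y k \<omega>)))
      = (CLINT \<omega>|M. iexp (u * V \<omega>)) * exp (CLINT p:A|N. iexp (u * grid k (f p)) - 1)" for k u
  proof -
    have "(CLINT p:A|N. iexp (u * grid k (f p)) - 1) = (\<Sum>i<2 * J k + 1. measure N (B k i) *\<^sub>R (iexp (u * v k i) - 1))"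
      by (rule set_integral_partition[OF B Bfin[OF A(2) refl] disj AB]) (simp add: val)
    then show ?thesis
      using prm_simple_char(2)[where A = "B k" and n = "2 * J k + 1" and v = "v k" and u = u,
          OF B Bfin[OF A(2) refl] disj V indep] unfolding Y_def by simp
  qed
  have Yi: "(\<lambda>k. Y k \<omega>) \<longlonglongrightarrow> (LINT p:A|\<mu> \<omega>. f p)" if \<omega>: "\<omega> \<in> space M" "emeasure (\<mu> \<omega>) A < \<infinity>" for \<omega>
  proof -
    note s = prm_sets[OF \<omega>(1)]
    have "Y k \<omega> = (LINT p:A|\<mu> \<omega>. grid k (f p))" for k
    proof -
      have "B k i \<in> sets (\<mu> \<omega>)" for i using B s by simp
      from set_integral_partition[OF this Bfin[OF \<omega>(2) s] disj AB val]
      show ?thesis by (simp add: Y_def measure_def)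
    qed
    moreover have "(\<lambda>k. LINT p:A|\<mu> \<omega>. grid k (f p)) \<longlonglongrightarrow> (LINT p:A|\<mu> \<omega>. f p)"
      using A(1) \<omega>(2) f C s measurable_cong_sets[OF s refl]
      by (intro tendsto_set_integral_grid[where G = "\<lambda>x. x" and C = C and D = "C + 1"]) auto
    ultimately show ?thesis by simp
  qed
  \<comment> \<open>The limit is measurable on the whole space, whatever value \<open>lim\<close>
    takes on the null set where \<open>A\<close> has infinite measure.\<close>
  define Z where "Z \<omega> = lim (\<lambda>k. Y k \<omega>)" for \<omega>
  have Zm [measurable]: "Z \<in> borel_measurable M" unfolding Z_def by (rule borel_measurable_lim_metric) (rule Ym)
  have AEfin: "AE \<omega> in M. \<omega> \<in> space M \<and> emeasure (\<mu> \<omega>) A < \<infinity>"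
    using prm_AE_finite[OF A] AE_space by eventually_elim auto
  have "AE \<omega> in M. Z \<omega> = (LINT p:A|\<mu> \<omega>. f p)"
    using AEfin by eventually_elim (metis Z_def limI[OF Yi])
  moreover have "(CLINT \<omega>|M. iexp (u * (V \<omega> + Z \<omega>))) = (CLINT \<omega>|M. iexp (u * V \<omega>)) * exp (CLINT p:A|N. iexp (u * f p) - 1)" for u
  proof (rule LIMSEQ_unique)
    show "(\<lambda>k. CLINT \<omega>|M. iexp (u * (V \<omega> + Y k \<omega>))) \<longlonglongrightarrow> (CLINT \<omega>|M. iexp (u * (V \<omega> + Z \<omega>)))"
    proof (rule integral_dominated_convergence[where w = "\<lambda>_. 1"])
      show "AE \<omega> in M. (\<lambda>k. iexp (u * (V \<omega> + Y k \<omega>))) \<longlonglongrightarrow> iexp (u * (V \<omega> + Z \<omega>))"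
        using AEfin by eventually_elim (auto simp: Z_def limI[OF Yi] intro!: tendsto_intros Yi)
    qed auto
    show "(\<lambda>k. CLINT \<omega>|M. iexp (u * (V \<omega> + Y k \<omega>))) \<longlonglongrightarrow>
       (CLINT \<omega>|M. iexp (u * V \<omega>)) * exp (CLINT p:A|N. iexp (u * f p) - 1)"
      unfolding Yc
      by (intro tendsto_intros tendsto_set_integral_grid[where G = "\<lambda>x. iexp (u * x) - 1" and C = C and D = 2] A f C)
        (auto intro!: continuous_intros order_trans[OF norm_triangle_ineq4])
  qed
  ultimately show ?thesis using Zm by blast
qed
end

section \<open>Strips of the mean measure and the Levy-Khintchine integrand\<close>

lemma jump_mean_measure_strip:
  assumes "sigma_finite_measure \<nu>" and \<nu>: "sets \<nu> = sets borel" and t: "0 \<le> t" and S: "S \<in> sets borel"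
  shows "{0<..t} \<times> S \<in> sets (jump_mean_measure \<nu>)"
    and "emeasure (jump_mean_measure \<nu>) ({0<..t} \<times> S) = ennreal t * emeasure \<nu> S"
proof -
  interpret \<nu>: sigma_finite_measure \<nu> by fact
  have I: "{0<..t} \<in> sets (restrict_space lborel {0..})"
    by (auto simp: sets_restrict_space image_iff intro!: bexI[of _ "{0<..t}"])
  then show "{0<..t} \<times> S \<in> sets (jump_mean_measure \<nu>)"
    unfolding jump_mean_measure_def using S \<nu> by auto
  have "emeasure (restrict_space lborel {0..}) {0<..t} = ennreal t"
    using t by (subst emeasure_restrict_space) auto
  then show "emeasure (jump_mean_measure \<nu>) ({0<..t} \<times> S) = ennreal t * emeasure \<nu> S"
    unfolding jump_mean_measure_def using \<nu>.emeasure_pair_measure_Times[OF I, of S] S \<nu> by simp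
qed

lemma set_integrable_bounded_on:
  fixes g :: "'a \<Rightarrow> 'b::{banach, second_countable_topology}"
  assumes S: "S \<in> sets m" "emeasure m S < \<infinity>" and [measurable]: "g \<in> borel_measurable m"
    and B: "\<And>x. x \<in> S \<Longrightarrow> norm (g x) \<le> B"
  shows "set_integrable m S g"
  unfolding set_integrable_def
proof (rule Bochner_Integration.integrable_bound)
  show "integrable m (\<lambda>x. B * indicator S x)" using S by (intro integrable_mult_right) (simp add: integrable_indicator_iff)
  note S(1)[measurable]
  show "(\<lambda>x. indicat_real S x *\<^sub>R g x) \<in> borel_measurable m" by measurable
  show "AE x in m. norm (indicat_real S x *\<^sub>R g x) \<le> norm (B * indicat_real S x)"
    using B by (intro AE_I2) (auto simp: indicator_def intro: order_trans[OF _ abs_ge_self])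
qed

lemma integral_jump_mean_measure_strip:
  fixes g :: "real \<Rightarrow> 'b::{banach, second_countable_topology}"
  assumes "sigma_finite_measure \<nu>" and \<nu>: "sets \<nu> = sets borel" and t: "0 \<le> t"
    and S: "S \<in> sets borel" "emeasure \<nu> S < \<infinity>" and [measurable]: "g \<in> borel_measurable borel"
    and B: "\<And>x. x \<in> S \<Longrightarrow> norm (g x) \<le> B"
  shows "(LINT p:{0<..t} \<times> S|jump_mean_measure \<nu>. g (snd p)) = t *\<^sub>R (LINT x:S|\<nu>. g x)"
proof -
  interpret \<nu>: sigma_finite_measure \<nu> by fact
  interpret R: sigma_finite_measure "restrict_space lborel {0::real..}"
    by (rule sigma_finite_measure_restrict_space) (auto simp: lborel.sigma_finite_measure_axioms)
  interpret P: pair_sigma_finite "restrict_space lborel {0::real..}" \<nu> ..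
  have gm: "g \<in> borel_measurable \<nu>" unfolding measurable_cong_sets[OF \<nu> refl] by measurable
  have "set_integrable (restrict_space lborel {0..} \<Otimes>\<^sub>M \<nu>) ({0<..t} \<times> S) (\<lambda>p. g (snd p))"
    using jump_mean_measure_strip[OF assms(1-4)] S(2) B measurable_compose[OF measurable_snd gm]
    unfolding jump_mean_measure_def
    by (intro set_integrable_bounded_on[where B = B]) (auto simp: ennreal_mult_less_top)
  then have "integrable (restrict_space lborel {0..} \<Otimes>\<^sub>M \<nu>) (\<lambda>p. indicator ({0<..t} \<times> S) p *\<^sub>R g (snd p))"
    unfolding set_integrable_def .
  from P.integral_fst'[OF this]
  have "(LINT p:{0<..t} \<times> S|jump_mean_measure \<nu>. g (snd p))
     = (LINT r|restrict_space lborel {0..}. LINT x|\<nu>. indicator {0<..t} r *\<^sub>R (indicator S x *\<^sub>R g x))"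
    unfolding set_lebesgue_integral_def jump_mean_measure_def by (simp add: indicator_times)
  also have "\<dots> = (LINT r|restrict_space lborel {0..}. indicator {0<..t} r *\<^sub>R (LINT x:S|\<nu>. g x))"
    unfolding set_lebesgue_integral_def by (simp only: integral_scaleR_right)
  also have "\<dots> = (LINT r|lborel. indicator {0..} r *\<^sub>R (indicator {0<..t} r *\<^sub>R (LINT x:S|\<nu>. g x)))"
    by (subst integral_restrict_space) (auto simp: set_lebesgue_integral_def)
  also have "\<dots> = (LINT r|lborel. indicator {0<..t} r *\<^sub>R (LINT x:S|\<nu>. g x))"
    by (intro Bochner_Integration.integral_cong) (auto simp: indicator_def)
  also have "\<dots> = t *\<^sub>R (LINT x:S|\<nu>. g x)"
    using t by (subst integral_scaleR_left) auto
  finally show ?thesis .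
qed

lemma levy_measure_integrable:
  assumes "levy_measure \<nu>"
  shows "integrable \<nu> (\<lambda>x. min 1 (x\<^sup>2))"
  using assms measurable_cong_sets[of \<nu> borel borel borel] unfolding levy_measure_def
  by (intro integrableI_bounded) auto

text \<open>A Markov inequality: on \<open>S\<close> the indicator is at most
  \<open>min 1 (x\<^sup>2) / min 1 (\<delta>\<^sup>2)\<close>.\<close>

lemma levy_measure_finite_away:
  assumes \<nu>: "levy_measure \<nu>" and "0 < \<delta>" and S: "S \<in> sets borel" "\<And>x. x \<in> S \<Longrightarrow> \<delta> < \<bar>x\<bar>"
  shows "emeasure \<nu> S < \<infinity>"
proof -
  have s: "S \<in> sets \<nu>" using \<nu> S by (simp add: levy_measure_def)
  have "integrable \<nu> (indicator S :: real \<Rightarrow> real)"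
  proof (rule Bochner_Integration.integrable_bound)
    show "integrable \<nu> (\<lambda>x. min 1 (x\<^sup>2) / min 1 (\<delta>\<^sup>2))" using levy_measure_integrable[OF \<nu>] by simp
    show "AE x in \<nu>. norm (indicator S x :: real) \<le> norm (min 1 (x\<^sup>2) / min 1 (\<delta>\<^sup>2))"
    proof (rule AE_I2)
      fix x
      have "min 1 (\<delta>\<^sup>2) \<le> min 1 (x\<^sup>2)" if "x \<in> S"
        using S(2)[OF that] \<open>0 < \<delta>\<close> power_mono[of \<delta> "\<bar>x\<bar>" 2] by (intro min.mono) auto
      moreover have "0 < min 1 (\<delta>\<^sup>2)" using \<open>0 < \<delta>\<close> by simp
      ultimately show "norm (indicator S x :: real) \<le> norm (min 1 (x\<^sup>2) / min 1 (\<delta>\<^sup>2))"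
        by (auto simp: indicator_def)
    qed
  qed (use s in simp)
  then show ?thesis using s sets.sets_into_space[OF s] by (simp add: integrable_indicator_iff Int_absorb2)
qed

text \<open>The Levy-Khintchine integrand, with the same closed cutoff \<bar>x\<bar> \<le> 1 as the
  compensated jumps of the triplet.\<close>

definition levy_integrand :: "real \<Rightarrow> real \<Rightarrow> complex" where
  "levy_integrand u x = iexp (u * x) - 1 - indicator {-1..1} x *\<^sub>R (\<i> * of_real (u * x))"

lemma levy_integrand_measurable [measurable]: "levy_integrand u \<in> borel_measurable borel"
  unfolding levy_integrand_def by measurable

lemma norm_levy_integrand: "norm (levy_integrand u x) \<le> (u\<^sup>2 + 2) * min 1 (x\<^sup>2)"
proof (cases "\<bar>x\<bar> \<le> 1")
  case True
  have "norm (levy_integrand u x) \<le> (u * x)\<^sup>2 / 2"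
    using iexp_approx1[of "u * x" 1] True by (simp add: levy_integrand_def abs_le_iff algebra_simps power2_eq_square)
  also have "\<dots> \<le> (u\<^sup>2 + 2) * x\<^sup>2" by (simp add: power_mult_distrib algebra_simps)
  also have "x\<^sup>2 = min 1 (x\<^sup>2)" using True by (simp add: abs_square_le_1)
  finally show ?thesis .
next
  case False
  have "norm (levy_integrand u x) \<le> 2"
    using False norm_triangle_ineq4[of "iexp (u * x)" 1] by (auto simp: levy_integrand_def abs_le_iff)
  moreover have "min 1 (x\<^sup>2) = 1" using False one_le_power[of "\<bar>x\<bar>" 2] by simp
  ultimately show ?thesis by (smt (verit) mult_cancel_left2 zero_le_power2)
qed

lemma levy_integrand_integrable:
  assumes "levy_measure \<nu>"
  shows "integrable \<nu> (levy_integrand u)"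
proof (rule Bochner_Integration.integrable_bound)
  show "integrable \<nu> (\<lambda>x. (u\<^sup>2 + 2) * min 1 (x\<^sup>2))" using levy_measure_integrable[OF assms] by simp
  show "AE x in \<nu>. norm (levy_integrand u x) \<le> norm ((u\<^sup>2 + 2) * min 1 (x\<^sup>2))"
    using norm_levy_integrand by (intro AE_I2) (auto intro: order_trans[OF _ abs_ge_self])
  show "levy_integrand u \<in> borel_measurable \<nu>"
    using levy_integrand_measurable assms measurable_cong_sets[of \<nu> borel borel borel] by (auto simp: levy_measure_def)
qed

text \<open>The definition fixes the law of increments only, hence the passage through
  \<open>W t - W 0\<close> and the almost sure value 0 at time 0.\<close>

lemma brownian_char:
  assumes W: "standard_brownian_motion M W" and t: "0 < t"
  shows "(CLINT \<omega>|M. iexp (u * (a + \<sigma> * W t \<omega>))) = exp (\<i> * of_real (u * a) - of_real (\<sigma>\<^sup>2 * u\<^sup>2 * t / 2))"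
proof -
  interpret prob_space M using W by (simp add: standard_brownian_motion_def)
  let ?D = "\<lambda>\<omega>. W t \<omega> - W 0 \<omega>"
  have [measurable]: "W t \<in> borel_measurable M" "W 0 \<in> borel_measurable M"
    using W t by (auto simp: standard_brownian_motion_def)
  have "distributed M lborel ?D (\<lambda>x. ennreal (normal_density 0 (sqrt t) x))"
  proof -
    have "\<forall>r\<ge>0. \<forall>t>r. distributed M lborel (\<lambda>\<omega>. W t \<omega> - W r \<omega>) (\<lambda>x. ennreal (normal_density 0 (sqrt (t - r)) x))"
      using W unfolding standard_brownian_motion_def by blast
    from this[rule_format, of 0 t] t show ?thesis by simp
  qed
  then have d: "distributed M lborel (\<lambda>\<omega>. (?D \<omega> - 0) / sqrt t) std_normal_density"
    using t normal_standard_normal_convert[of "sqrt t" ?D 0] by simp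
  have "(CLINT \<omega>|M. iexp (u * (a + \<sigma> * W t \<omega>))) = (CLINT \<omega>|M. iexp (u * a) * iexp ((u * \<sigma> * sqrt t) * ((?D \<omega> - 0) / sqrt t)))"
  proof (rule integral_cong_AE)
    have "AE \<omega> in M. W 0 \<omega> = 0" using W by (simp add: standard_brownian_motion_def)
    then show "AE \<omega> in M. iexp (u * (a + \<sigma> * W t \<omega>)) = iexp (u * a) * iexp ((u * \<sigma> * sqrt t) * ((?D \<omega> - 0) / sqrt t))"
    proof eventually_elim
      case (elim \<omega>)
      have "(u * \<sigma> * sqrt t) * ((?D \<omega> - 0) / sqrt t) = u * \<sigma> * W t \<omega>" using t elim by simp
      then show ?case by (simp only: exp_add[symmetric] of_real_add[symmetric] distrib_left[symmetric] mult.assoc)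
    qed
  qed measurable
  also have "\<dots> = iexp (u * a) * (CLINT x|distr M lborel (\<lambda>\<omega>. (?D \<omega> - 0) / sqrt t). iexp ((u * \<sigma> * sqrt t) * x))"
    by (subst integral_distr) auto
  also have "(CLINT x|distr M lborel (\<lambda>\<omega>. (?D \<omega> - 0) / sqrt t). iexp ((u * \<sigma> * sqrt t) * x)) = char std_normal_distribution (u * \<sigma> * sqrt t)"
    unfolding distributed_distr_eq_density[OF d] char_def ..
  also have "\<dots> = exp (- of_real (\<sigma>\<^sup>2 * u\<^sup>2 * t / 2))"
    unfolding char_std_normal_distribution using t by (simp add: power_mult_distrib mult_ac exp_of_real[symmetric])
  finally show ?thesis by (simp only: diff_conv_add_uminus exp_add)
qed

text \<open>The map \<open>iexp\<close> is 1-Lipschitz, and the first absolute moment is bounded by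
  the root of the second because a variance is nonnegative. Stating the second moment as a
  nonnegative integral makes integrability a consequence.\<close>

lemma (in prob_space) norm_integral_diff_iexp_le:
  assumes [measurable]: "S \<in> borel_measurable M" "T \<in> borel_measurable M"
    and fin: "(\<integral>\<^sup>+\<omega>. ennreal ((S \<omega> - T \<omega>)\<^sup>2) \<partial>M) \<le> ennreal e" and e: "0 \<le> e"
  shows "norm ((CLINT \<omega>|M. iexp (u * S \<omega>)) - (CLINT \<omega>|M. iexp (u * T \<omega>))) \<le> \<bar>u\<bar> * sqrt e"
proof -
  let ?D = "\<lambda>\<omega>. \<bar>S \<omega> - T \<omega>\<bar>"
  have i2: "integrable M (\<lambda>\<omega>. (?D \<omega>)\<^sup>2)"
    using fin by (intro integrableI_bounded) (auto simp: top_unique less_top[symmetric])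
  have i1: "integrable M ?D" by (rule square_integrable_imp_integrable[OF _ i2]) measurable
  have E2: "expectation (\<lambda>\<omega>. (?D \<omega>)\<^sup>2) \<le> e"
    using fin e nn_integral_eq_integral[OF i2] by (simp add: ennreal_le_iff)
  have "(expectation ?D)\<^sup>2 \<le> expectation (\<lambda>\<omega>. (?D \<omega>)\<^sup>2)"
    using variance_positive[of ?D] variance_eq[OF i1 i2] by simp
  with E2 have "expectation ?D \<le> sqrt e" by (intro real_le_rsqrt) simp
  have ii: "integrable M (\<lambda>\<omega>. iexp (u * S \<omega>))" "integrable M (\<lambda>\<omega>. iexp (u * T \<omega>))"
    by (rule integrable_const_bound[of _ 1]; simp)+
  have "norm ((CLINT \<omega>|M. iexp (u * S \<omega>)) - (CLINT \<omega>|M. iexp (u * T \<omega>)))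
      = norm (CLINT \<omega>|M. iexp (u * S \<omega>) - iexp (u * T \<omega>))"
    using ii by simp
  also have "\<dots> \<le> (LINT \<omega>|M. norm (iexp (u * S \<omega>) - iexp (u * T \<omega>)))"
    by (rule integral_norm_bound)
  also have "\<dots> \<le> (LINT \<omega>|M. \<bar>u\<bar> * ?D \<omega>)"
  proof (intro integral_mono integrable_norm Bochner_Integration.integrable_diff ii integrable_mult_right i1)
    fix \<omega>
    have "iexp (u * S \<omega>) - iexp (u * T \<omega>) = iexp (u * T \<omega>) * (iexp (u * (S \<omega> - T \<omega>)) - 1)"
      by (simp add: algebra_simps exp_add[symmetric])
    then have "norm (iexp (u * S \<omega>) - iexp (u * T \<omega>)) = norm (iexp (u * (S \<omega> - T \<omega>)) - 1)"
      by (simp add: norm_mult)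
    also have "\<dots> \<le> \<bar>u * (S \<omega> - T \<omega>)\<bar>"
      using iexp_approx1[of "u * (S \<omega> - T \<omega>)" 0] by simp
    finally show "norm (iexp (u * S \<omega>) - iexp (u * T \<omega>)) \<le> \<bar>u\<bar> * ?D \<omega>" by (simp add: abs_mult)
  qed
  also have "\<dots> \<le> \<bar>u\<bar> * sqrt e"
    using \<open>expectation ?D \<le> sqrt e\<close> by (simp add: mult_left_mono)
  finally show ?thesis .
qed

text \<open>The jumps in \<open>1/(m+2) < \<bar>x\<bar> \<le> m+1\<close> are used for both limits at once: the compensated small
  ones converge in mean square, the big ones are eventually constant almost surely.\<close>

theorem levy_triplet_char:
  assumes P: "prob_space M" and X: "has_levy_triplet M X v b \<nu>" and Xm: "X t \<in> borel_measurable M"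
    and \<sigma>f: "sigma_finite_measure \<nu>" and t: "0 < t"
  shows "(CLINT \<omega>|M. iexp (u * X t \<omega>))
    = exp (of_real t * (\<i> * of_real (u * b) - of_real (v * u\<^sup>2 / 2) + (CLINT x|\<nu>. levy_integrand u x)))"
proof -
  interpret prob_space M by (rule P)
  obtain \<sigma> W \<mu> Z where v: "v = \<sigma>\<^sup>2" and \<nu>: "levy_measure \<nu>"
    and W: "standard_brownian_motion M W"
    and prm: "poisson_random_measure M (jump_mean_measure \<nu>) \<mu>"
    and ind: "independent_process_random_measure M W (jump_mean_measure \<nu>) \<mu>"
    and Zall: "\<forall>t\<ge>0. is_compensated_small_jumps M \<nu> \<mu> t (Z t)"
    and Xall: "\<forall>t\<ge>0. AE \<omega> in M. X t \<omega> = b * t + \<sigma> * W t \<omega> + Z t \<omega> + (LINT p:{0<..t} \<times> {x. \<bar>x\<bar> > 1}|\<mu> \<omega>. snd p)"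
    using X unfolding has_levy_triplet_def by blast
  have Z: "is_compensated_small_jumps M \<nu> \<mu> t (Z t)"
    and Xeq: "AE \<omega> in M. X t \<omega> = b * t + \<sigma> * W t \<omega> + Z t \<omega> + (LINT p:{0<..t} \<times> {x. \<bar>x\<bar> > 1}|\<mu> \<omega>. snd p)"
    using Zall Xall t by simp_all
  have s\<nu>: "sets \<nu> = sets borel" using \<nu> by (simp add: levy_measure_def)
  have t0: "0 \<le> t" using t by simp
  note strip = jump_mean_measure_strip[OF \<sigma>f s\<nu> t0]
  let ?N = "jump_mean_measure \<nu>"
  define V where "V \<omega> = b * t + \<sigma> * W t \<omega>" for \<omega>
  have [measurable]: "W t \<in> borel_measurable M" using W t by (simp add: standard_brownian_motion_def)
  have Vm [measurable]: "V \<in> borel_measurable M" unfolding V_def by measurable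
  have Zm [measurable]: "Z t \<in> borel_measurable M" using Z by (simp add: is_compensated_small_jumps_def)
  note Xm [measurable]
  have indep: "indep_set (sigma_sets (space M) {V -` B \<inter> space M | B. B \<in> sets borel}) (prm_events M ?N \<mu>)"
  proof -
    let ?G = "sigma (space M) {W t -` B \<inter> space M | t B. t \<ge> 0 \<and> B \<in> sets borel}"
    have sG: "sets ?G = sigma_sets (space M) {W t -` B \<inter> space M | t B. t \<ge> 0 \<and> B \<in> sets borel}"
      by (intro sets_measure_of) auto
    have spG: "space ?G = space M" by (intro space_measure_of) auto
    have "W t \<in> borel_measurable ?G"
    proof (rule measurableI)
      fix B :: "real set" assume "B \<in> sets borel"
      then show "W t -` B \<inter> space ?G \<in> sets ?G"
        unfolding sG spG using t0 by (intro sigma_sets.Basic) auto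
    qed auto
    then have "V \<in> borel_measurable ?G" unfolding V_def by measurable
    then have "{V -` B \<inter> space M | B. B \<in> sets borel} \<subseteq> sets ?G"
      using measurable_sets[of V ?G borel] spG by auto
    then have "sigma_sets (space M) {V -` B \<inter> space M | B. B \<in> sets borel} \<subseteq> sets ?G"
      using sets.sigma_sets_subset[of _ ?G] spG by auto
    then show ?thesis
      using ind unfolding independent_process_random_measure_def prm_events_def[OF prm] indep_set_def sG
      by (rule_tac indep_sets_mono_sets) (auto split: bool.splits)
  qed
  \<comment> \<open>The index shifts ensure 1/(m+2) < 1 \<le> m+1 for every m, so
    \<open>S' m\<close> is contained in \<open>S m\<close> and the difference consists of jumps
    larger than 1.\<close>
  define S where "S m = {x::real. 1 / real (m + 2) < \<bar>x\<bar> \<and> \<bar>x\<bar> \<le> real (m + 1)}" for m :: nat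
  define S' where "S' m = {x::real. 1 / real (m + 2) < \<bar>x\<bar> \<and> \<bar>x\<bar> \<le> 1}" for m :: nat
  define C where "C m = {x::real. real (m + 1) < \<bar>x\<bar>}" for m :: nat
  have Sb [measurable]: "S m \<in> sets borel" "S' m \<in> sets borel" "C m \<in> sets borel" for m
    unfolding S_def S'_def C_def by measurable
  have Sfin: "emeasure \<nu> (S m) < \<infinity>" "emeasure \<nu> (S' m) < \<infinity>" "emeasure \<nu> (C m) < \<infinity>" for m
  proof -
    show "emeasure \<nu> (S m) < \<infinity>" "emeasure \<nu> (S' m) < \<infinity>"
      by (rule levy_measure_finite_away[OF \<nu>, of "1 / real (m + 2)"]; simp add: S_def S'_def)+
    show "emeasure \<nu> (C m) < \<infinity>"
      by (rule levy_measure_finite_away[OF \<nu>, of "real (m + 1)"]) (simp_all add: C_def)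
  qed
  have Nfin: "emeasure ?N ({0<..t} \<times> B) < \<infinity>" if "B \<in> sets borel" "emeasure \<nu> B < \<infinity>" for B
    using strip(2)[OF that(1)] that(2) by (simp add: ennreal_mult_less_top)
  have sndm: "snd \<in> borel_measurable ?N"
    unfolding jump_mean_measure_def using measurable_snd[of "restrict_space lborel {0..}" \<nu>] measurable_cong_sets[OF refl s\<nu>] by auto
  define Q where "Q m Y \<longleftrightarrow> Y \<in> borel_measurable M \<and> (AE \<omega> in M. Y \<omega> = (LINT p:{0<..t} \<times> S m|\<mu> \<omega>. snd p)) \<and>
    (CLINT \<omega>|M. iexp (u * (V \<omega> + Y \<omega>))) = (CLINT \<omega>|M. iexp (u * V \<omega>)) * exp (CLINT p:{0<..t} \<times> S m|?N. iexp (u * snd p) - 1)" for m Y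
  have "\<forall>m. \<exists>Y. Q m Y"
  proof
    fix m
    have "\<bar>snd p\<bar> \<le> real (m + 1)" if "p \<in> {0<..t} \<times> S m" for p using that by (auto simp: S_def)
    from prm_integral_char[OF prm strip(1)[OF Sb(1)] Nfin[OF Sb(1) Sfin(1)] sndm this Vm indep]
    show "\<exists>Y. Q m Y" unfolding Q_def by blast
  qed
  from choice[OF this] obtain Y where Yall: "\<forall>m. Q m (Y m)" ..
  have Ym [measurable]: "Y m \<in> borel_measurable M"
    and Y: "AE \<omega> in M. Y m \<omega> = (LINT p:{0<..t} \<times> S m|\<mu> \<omega>. snd p)"
    and Yc: "(CLINT \<omega>|M. iexp (u * (V \<omega> + Y m \<omega>))) = (CLINT \<omega>|M. iexp (u * V \<omega>)) * exp (CLINT p:{0<..t} \<times> S m|?N. iexp (u * snd p) - 1)" for m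
    using Yall unfolding Q_def by simp_all
  have "\<forall>m. \<exists>Y. Y \<in> borel_measurable M \<and> (AE \<omega> in M. Y \<omega> = (LINT p:{0<..t} \<times> S' m|\<mu> \<omega>. snd p))"
  proof
    fix m
    have "\<bar>snd p\<bar> \<le> 1" if "p \<in> {0<..t} \<times> S' m" for p using that by (auto simp: S'_def)
    from prm_integral_char[OF prm strip(1)[OF Sb(2)] Nfin[OF Sb(2) Sfin(2)] sndm this Vm indep]
    show "\<exists>Y. Y \<in> borel_measurable M \<and> (AE \<omega> in M. Y \<omega> = (LINT p:{0<..t} \<times> S' m|\<mu> \<omega>. snd p))"
      by blast
  qed
  from choice[OF this] obtain Y' where Y'all: "\<forall>m. Y' m \<in> borel_measurable M \<and> (AE \<omega> in M. Y' m \<omega> = (LINT p:{0<..t} \<times> S' m|\<mu> \<omega>. snd p))" ..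
  have Y'm [measurable]: "Y' m \<in> borel_measurable M"
    and Y': "AE \<omega> in M. Y' m \<omega> = (LINT p:{0<..t} \<times> S' m|\<mu> \<omega>. snd p)" for m
    using Y'all by simp_all
  define k where "k m = (LINT p:{0<..t} \<times> S' m|?N. snd p)" for m
  have k: "k m = t * (LINT x:S' m|\<nu>. x)" for m
    using integral_jump_mean_measure_strip[where g = "\<lambda>x::real. x" and B = 1, OF \<sigma>f s\<nu> t0 Sb(2) Sfin(2), of m] by (auto simp: k_def S'_def)

  define e where "e m = enn2real (\<integral>\<^sup>+\<omega>. ennreal ((Y' m \<omega> - k m - Z t \<omega>)\<^sup>2) \<partial>M)" for m
  have L2: "(\<lambda>m. \<integral>\<^sup>+\<omega>. ennreal ((Y' m \<omega> - k m - Z t \<omega>)\<^sup>2) \<partial>M) \<longlonglongrightarrow> 0"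
  proof -
    have "filterlim (\<lambda>m. 1 / real (m + 2)) (at_right 0) sequentially"
    proof (rule filterlim_at_withinI)
      show "(\<lambda>m. 1 / real (m + 2)) \<longlonglongrightarrow> 0"
        using LIMSEQ_ignore_initial_segment[OF lim_1_over_n[where 'a = real], of 2] by simp
    qed auto
    from filterlim_compose[OF _ this] Z
    have "(\<lambda>m. \<integral>\<^sup>+\<omega>. ennreal (((LINT p:{0<..t} \<times> S' m|\<mu> \<omega>. snd p) - k m - Z t \<omega>)\<^sup>2) \<partial>M) \<longlonglongrightarrow> 0"
      unfolding is_compensated_small_jumps_def S'_def k_def by fast
    moreover have "(\<integral>\<^sup>+\<omega>. ennreal (((LINT p:{0<..t} \<times> S' m|\<mu> \<omega>. snd p) - k m - Z t \<omega>)\<^sup>2) \<partial>M)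
       = (\<integral>\<^sup>+\<omega>. ennreal ((Y' m \<omega> - k m - Z t \<omega>)\<^sup>2) \<partial>M)" for m
      by (rule nn_integral_cong_AE) (use Y'[of m] in eventually_elim, simp)
    ultimately show ?thesis by simp
  qed
  then have e0: "e \<longlonglongrightarrow> 0"
    unfolding e_def by (intro tendsto_enn2real) simp_all
  \<comment> \<open>Only eventually: as long as the integral is infinite, \<open>enn2real\<close>
    returns 0 and the bound would fail.\<close>
  have efin: "eventually (\<lambda>m. (\<integral>\<^sup>+\<omega>. ennreal ((Y' m \<omega> - k m - Z t \<omega>)\<^sup>2) \<partial>M) \<le> ennreal (e m)) sequentially"
    using order_tendstoD(2)[OF L2 zero_less_one]
  proof eventually_elim
    case (elim m)
    then have "(\<integral>\<^sup>+\<omega>. ennreal ((Y' m \<omega> - k m - Z t \<omega>)\<^sup>2) \<partial>M) < \<top>" by (rule less_trans) simp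
    then show ?case by (simp add: e_def)
  qed

  have Bdisj: "S m = S' m \<union> (S m - S' m)" for m unfolding S_def S'_def by auto
  have jumps: "AE \<omega> in M. (\<lambda>m. Y m \<omega> - Y' m \<omega>) \<longlonglongrightarrow> (LINT p:{0<..t} \<times> {x. \<bar>x\<bar> > 1}|\<mu> \<omega>. snd p)"
  proof -
    have "(\<lambda>m. measure ?N ({0<..t} \<times> C m)) \<longlonglongrightarrow> 0"
    proof -
      have "(\<lambda>m. measure \<nu> (C m)) \<longlonglongrightarrow> measure \<nu> (\<Inter>m. C m)"
        using Sb(3) Sfin(3) s\<nu> by (intro Lim_measure_decseq) (auto simp: decseq_def C_def less_top)
      moreover have "(\<Inter>m. C m) = {}"
      proof -
        have "\<exists>m. x \<notin> C m" for x
        proof -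
          obtain m where "\<bar>x\<bar> \<le> real m" using real_arch_simple by blast
          then show ?thesis by (intro exI[of _ m]) (simp add: C_def)
        qed
        then show ?thesis by auto
      qed
      ultimately have "(\<lambda>m. t * measure \<nu> (C m)) \<longlonglongrightarrow> 0" by (auto intro: tendsto_mult_right_zero)
      moreover have "measure ?N ({0<..t} \<times> C m) = t * measure \<nu> (C m)" for m
        unfolding measure_def strip(2)[OF Sb(3)] using t0 by (simp add: enn2real_mult)
      ultimately show ?thesis by simp
    qed
    then have lim1: "(\<lambda>m. exp (- measure ?N ({0<..t} \<times> C m))) \<longlonglongrightarrow> 1"
      using tendsto_exp[OF tendsto_minus] by fastforce
    \<comment> \<open>No jump larger than m+1 up to time \<open>t\<close>. The probabilities tend to
      1, so almost surely one of these events occurs, and from then on the big jumps are completely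
      collected.\<close>
    let ?E = "\<lambda>m. {\<omega>\<in>space M. emeasure (\<mu> \<omega>) ({0<..t} \<times> C m) = of_nat 0}"
    note [measurable] = prm_measurable[OF prm strip(1)[OF Sb(3)]]
    have Em: "?E m \<in> events" for m by measurable
    have "exp (- measure ?N ({0<..t} \<times> C m)) \<le> prob (\<Union>m. ?E m)" for m
    proof -
      have "prob (?E m) = exp (- measure ?N ({0<..t} \<times> C m))"
        using prm_prob[OF prm strip(1)[OF Sb(3)] Nfin[OF Sb(3) Sfin(3)], of m 0] by simp
      moreover have "prob (?E m) \<le> prob (\<Union>m. ?E m)" using Em by (intro finite_measure_mono) auto
      ultimately show ?thesis by simp
    qed
    then have "1 \<le> prob (\<Union>m. ?E m)" by (intro LIMSEQ_le_const2[OF lim1]) auto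
    then have "prob (\<Union>m. ?E m) = 1" using prob_le_1 by (intro antisym) auto
    then have A1: "AE \<omega> in M. \<omega> \<in> (\<Union>m. ?E m)" by (rule AE_prob_1)
    have A2: "AE \<omega> in M. \<forall>m. emeasure (\<mu> \<omega>) ({0<..t} \<times> S m) < \<infinity> \<and> Y m \<omega> = (LINT p:{0<..t} \<times> S m|\<mu> \<omega>. snd p)
         \<and> Y' m \<omega> = (LINT p:{0<..t} \<times> S' m|\<mu> \<omega>. snd p)"
      unfolding AE_all_countable
    proof
      fix m
      show "AE \<omega> in M. emeasure (\<mu> \<omega>) ({0<..t} \<times> S m) < \<infinity> \<and> Y m \<omega> = (LINT p:{0<..t} \<times> S m|\<mu> \<omega>. snd p)
         \<and> Y' m \<omega> = (LINT p:{0<..t} \<times> S' m|\<mu> \<omega>. snd p)"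
        using Y[of m] Y'[of m] prm_AE_finite[OF prm strip(1)[OF Sb(1)] Nfin[OF Sb(1) Sfin(1)], of m]
        by eventually_elim simp
    qed
    from A1 A2 AE_space show ?thesis
    proof eventually_elim
      case (elim \<omega>)
      then obtain m0 where m0: "emeasure (\<mu> \<omega>) ({0<..t} \<times> C m0) = 0" by auto
      have sets: "{0<..t} \<times> B \<in> sets (\<mu> \<omega>)" if "B \<in> sets borel" for B
        using strip(1)[OF that] prm_sets[OF prm elim(3)] by simp
      have snd\<mu>: "snd \<in> borel_measurable (\<mu> \<omega>)" using sndm measurable_cong_sets[OF prm_sets[OF prm elim(3)] refl] by auto
      have "Y m \<omega> - Y' m \<omega> = (LINT p:{0<..t} \<times> {x. \<bar>x\<bar> > 1}|\<mu> \<omega>. snd p)" if "m0 \<le> m" for m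
      proof -
        have fin: "emeasure (\<mu> \<omega>) ({0<..t} \<times> B) < \<infinity>" if "B \<in> sets borel" "B \<subseteq> S m" for B
        proof -
          have "emeasure (\<mu> \<omega>) ({0<..t} \<times> B) \<le> emeasure (\<mu> \<omega>) ({0<..t} \<times> S m)"
            using that(2) by (intro emeasure_mono Sigma_mono sets[OF Sb(1)]) simp_all
          also have "\<dots> < \<infinity>" using elim(2) by blast
          finally show ?thesis .
        qed
        have i: "set_integrable (\<mu> \<omega>) ({0<..t} \<times> B) snd" if "B \<in> sets borel" "B \<subseteq> S m" for B
          using that by (intro set_integrable_bounded_on[where B = "real (m + 1)"] sets fin snd\<mu>) (auto simp: S_def)
        have eq: "{0<..t} \<times> S m = {0<..t} \<times> S' m \<union> {0<..t} \<times> (S m - S' m)" using Bdisj by blast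
        have "S' m \<subseteq> S m" unfolding S_def S'_def by auto
        then have "(LINT p:{0<..t} \<times> S m|\<mu> \<omega>. snd p) = (LINT p:{0<..t} \<times> S' m|\<mu> \<omega>. snd p) + (LINT p:{0<..t} \<times> (S m - S' m)|\<mu> \<omega>. snd p)"
          unfolding eq by (intro set_integral_Un i) auto
        moreover have "(LINT p:{0<..t} \<times> (S m - S' m)|\<mu> \<omega>. snd p) = (LINT p:{0<..t} \<times> {x. \<bar>x\<bar> > 1}|\<mu> \<omega>. snd p)"
          unfolding set_lebesgue_integral_def
        proof (rule integral_cong_AE)
          have "AE p in \<mu> \<omega>. p \<notin> {0<..t} \<times> C m0"
            using m0 sets[OF Sb(3)] by (intro AE_not_in) (auto simp: null_sets_def)
          then show "AE p in \<mu> \<omega>. indicat_real ({0<..t} \<times> (S m - S' m)) p *\<^sub>R snd p = indicat_real ({0<..t} \<times> {x. 1 < \<bar>x\<bar>}) p *\<^sub>R snd p"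
          proof eventually_elim
            case (elim p)
            have le: "real (m0 + 1) \<le> real (m + 1)" "1 / real (m + 2) \<le> 1" using \<open>m0 \<le> m\<close> by auto
            have "snd p \<in> S m - S' m \<longleftrightarrow> 1 < \<bar>snd p\<bar>" if "fst p \<in> {0<..t}"
            proof -
              have "\<bar>snd p\<bar> \<le> real (m0 + 1)" using elim that by (cases p) (simp add: C_def)
              then show ?thesis unfolding S_def S'_def Diff_iff mem_Collect_eq using le by linarith
            qed
            then have "p \<in> {0<..t} \<times> (S m - S' m) \<longleftrightarrow> p \<in> {0<..t} \<times> {x. 1 < \<bar>x\<bar>}"
              by (auto simp only: mem_Times_iff mem_Collect_eq)
            then show ?case by (simp add: indicator_def)
          qed
        qed (use sets snd\<mu> in \<open>auto intro!: borel_measurable_scaleR borel_measurable_indicator\<close>)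
        ultimately show ?thesis using elim(2) by simp
      qed
      then show "(\<lambda>m. Y m \<omega> - Y' m \<omega>) \<longlonglongrightarrow> (LINT p:{0<..t} \<times> {x. \<bar>x\<bar> > 1}|\<mu> \<omega>. snd p)"
        by (intro tendsto_eventually eventually_sequentiallyI[of m0])
    qed
  qed

  \<comment> \<open>\<open>R\<close> contains the limiting small jumps \<open>Z t\<close> and tends
    to \<open>X t\<close> almost surely; \<open>T\<close> contains their approximation and has an
    explicit characteristic function. They differ by \<open>Y' m - k m - Z t\<close>, which is small
    in mean square, so nothing about the joint law of \<open>Z t\<close> and the other terms is
    required.\<close>
  define R where "R m \<omega> = V \<omega> + Z t \<omega> + (Y m \<omega> - Y' m \<omega>)" for m \<omega>
  define T where "T m \<omega> = V \<omega> + Y m \<omega> - k m" for m \<omega>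
  have [measurable]: "R m \<in> borel_measurable M" "T m \<in> borel_measurable M" for m
    unfolding R_def T_def by measurable
  have "(\<lambda>m. CLINT \<omega>|M. iexp (u * R m \<omega>)) \<longlonglongrightarrow> (CLINT \<omega>|M. iexp (u * X t \<omega>))"
  proof (rule integral_dominated_convergence[where w = "\<lambda>_. 1"])
    show "AE \<omega> in M. (\<lambda>m. iexp (u * R m \<omega>)) \<longlonglongrightarrow> iexp (u * X t \<omega>)"
      using jumps Xeq
    proof eventually_elim
      case (elim \<omega>)
      then show ?case unfolding R_def V_def elim(2) by (intro tendsto_intros)
    qed
  qed auto
  moreover have "(\<lambda>m. (CLINT \<omega>|M. iexp (u * T m \<omega>)) - (CLINT \<omega>|M. iexp (u * R m \<omega>))) \<longlonglongrightarrow> 0"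
  proof (rule Lim_null_comparison)
    show "eventually (\<lambda>m. norm ((CLINT \<omega>|M. iexp (u * T m \<omega>)) - (CLINT \<omega>|M. iexp (u * R m \<omega>))) \<le> \<bar>u\<bar> * sqrt (e m)) sequentially"
      using efin
    proof eventually_elim
      case (elim m)
      have "T m \<omega> - R m \<omega> = Y' m \<omega> - k m - Z t \<omega>" for \<omega> by (simp add: T_def R_def)
      with elim show ?case by (intro norm_integral_diff_iexp_le) (auto simp: e_def)
    qed
    show "(\<lambda>m. \<bar>u\<bar> * sqrt (e m)) \<longlonglongrightarrow> 0"
      using tendsto_mult[OF tendsto_const tendsto_real_sqrt[OF e0], of "\<bar>u\<bar>"] by simp
  qed
  ultimately have lim1: "(\<lambda>m. CLINT \<omega>|M. iexp (u * T m \<omega>)) \<longlonglongrightarrow> (CLINT \<omega>|M. iexp (u * X t \<omega>))"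
    using tendsto_add by fastforce

  \<comment> \<open>Within \<open>S m\<close> the compensator of the integrand lives exactly on
    \<open>S' m\<close>; its integral over the strip is the constant \<open>k m\<close> subtracted
    in \<open>T\<close>.\<close>
  have Tc: "(CLINT \<omega>|M. iexp (u * T m \<omega>)) = (CLINT \<omega>|M. iexp (u * V \<omega>)) * exp (of_real t * (CLINT x:S m|\<nu>. levy_integrand u x))" for m
  proof -
    have gm: "(\<lambda>x. iexp (u * x) - 1) \<in> borel_measurable \<nu>"
      unfolding measurable_cong_sets[OF s\<nu> refl] by measurable
    have i1: "set_integrable \<nu> (S m) (\<lambda>x. iexp (u * x) - 1)"
    proof (rule set_integrable_bounded_on[OF _ Sfin(1) gm])
      show "norm (iexp (u * x) - 1) \<le> 2" for x
        using norm_triangle_ineq4[of "iexp (u * x)" 1] by simp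
    qed (simp add: s\<nu> Sb)
    have i2: "set_integrable \<nu> (S' m) (\<lambda>x. \<i> * complex_of_real (u * x))"
    proof (rule set_integrable_bounded_on[OF _ Sfin(2)])
      show "norm (\<i> * complex_of_real (u * x)) \<le> \<bar>u\<bar>" if "x \<in> S' m" for x
        using mult_left_mono[of "\<bar>x\<bar>" 1 "\<bar>u\<bar>"] that by (simp add: norm_mult abs_mult S'_def)
      show "(\<lambda>x. \<i> * complex_of_real (u * x)) \<in> borel_measurable \<nu>"
        unfolding measurable_cong_sets[OF s\<nu> refl] by measurable
    qed (simp add: s\<nu> Sb)
    have "(CLINT x:S m|\<nu>. levy_integrand u x) = (CLINT x|\<nu>. indicator (S m) x *\<^sub>R (iexp (u * x) - 1) - indicator (S' m) x *\<^sub>R (\<i> * complex_of_real (u * x)))"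
      unfolding set_lebesgue_integral_def levy_integrand_def
      by (intro Bochner_Integration.integral_cong) (auto simp: S_def S'_def indicator_def)
    also have "\<dots> = (CLINT x:S m|\<nu>. iexp (u * x) - 1) - (CLINT x:S' m|\<nu>. \<i> * complex_of_real (u * x))"
      using i1 i2 unfolding set_integrable_def set_lebesgue_integral_def by simp
    also have "(CLINT x:S' m|\<nu>. \<i> * complex_of_real (u * x)) = \<i> * complex_of_real (u * (LINT x:S' m|\<nu>. x))"
      by (simp add: set_integral_complex_of_real)
    finally have 0: "(CLINT x:S m|\<nu>. levy_integrand u x) = (CLINT x:S m|\<nu>. iexp (u * x) - 1) - \<i> * complex_of_real (u * (LINT x:S' m|\<nu>. x))" .
    have 1: "of_real t * (CLINT x:S m|\<nu>. levy_integrand u x) = t *\<^sub>R (CLINT x:S m|\<nu>. iexp (u * x) - 1) - \<i> * complex_of_real (u * k m)"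
      unfolding 0 right_diff_distrib k by (simp add: scaleR_conv_of_real mult_ac)
    have 2: "(CLINT p:{0<..t} \<times> S m|?N. iexp (u * snd p) - 1) = t *\<^sub>R (CLINT x:S m|\<nu>. iexp (u * x) - 1)"
      by (rule integral_jump_mean_measure_strip[OF \<sigma>f s\<nu> t0 Sb(1) Sfin(1), where g = "\<lambda>x. iexp (u * x) - 1" and B = 2])
        (auto intro: order_trans[OF norm_triangle_ineq4])
    have "(CLINT \<omega>|M. iexp (u * T m \<omega>)) = (CLINT \<omega>|M. exp (- (\<i> * complex_of_real (u * k m))) * iexp (u * (V \<omega> + Y m \<omega>)))"
      unfolding T_def exp_add[symmetric] by (intro Bochner_Integration.integral_cong refl arg_cong[where f = exp]) (simp add: algebra_simps)
    also have "\<dots> = exp (- (\<i> * complex_of_real (u * k m))) * ((CLINT \<omega>|M. iexp (u * V \<omega>)) * exp (t *\<^sub>R (CLINT x:S m|\<nu>. iexp (u * x) - 1)))"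
      unfolding Yc[symmetric] 2[symmetric] by (rule integral_mult_right_zero)
    finally show ?thesis unfolding 1 by (simp add: exp_diff exp_minus field_simps)
  qed
  have "(\<lambda>m. CLINT x:S m|\<nu>. levy_integrand u x) \<longlonglongrightarrow> (CLINT x|\<nu>. levy_integrand u x)"
    unfolding set_lebesgue_integral_def
  proof (rule integral_dominated_convergence[where w = "\<lambda>x. norm (levy_integrand u x)"])
    have lm: "levy_integrand u \<in> borel_measurable \<nu>" by (rule borel_measurable_integrable[OF levy_integrand_integrable[OF \<nu>]])
    then show "levy_integrand u \<in> borel_measurable \<nu>" .
    show "(\<lambda>x. indicat_real (S m) x *\<^sub>R levy_integrand u x) \<in> borel_measurable \<nu>" for m
      using lm Sb(1) s\<nu> by (intro borel_measurable_scaleR borel_measurable_indicator) auto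
    show "integrable \<nu> (\<lambda>x. norm (levy_integrand u x))"
      using levy_integrand_integrable[OF \<nu>] by simp
    show "AE x in \<nu>. (\<lambda>m. indicat_real (S m) x *\<^sub>R levy_integrand u x) \<longlonglongrightarrow> levy_integrand u x"
    proof (rule AE_I2, cases)
      \<comment> \<open>No \<open>S m\<close> contains 0, but the integrand vanishes there.\<close>
      fix x :: real assume "x = 0"
      then show "(\<lambda>m. indicat_real (S m) x *\<^sub>R levy_integrand u x) \<longlonglongrightarrow> levy_integrand u x"
        by (simp add: levy_integrand_def)
    next
      fix x :: real assume "x \<noteq> 0"
      then obtain m1 where m1: "1 / real (m1 + 1) < \<bar>x\<bar>"
        using reals_Archimedean[of "\<bar>x\<bar>"] by (auto simp: inverse_eq_divide)
      obtain m2 where m2: "\<bar>x\<bar> \<le> real m2" using real_arch_simple by blast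
      have "x \<in> S m" if "max m1 m2 \<le> m" for m
      proof -
        have "1 / real (m + 2) \<le> 1 / real (m1 + 1)" using that by (intro divide_left_mono) auto
        then show ?thesis using m1 m2 that by (auto simp: S_def)
      qed
      then show "(\<lambda>m. indicat_real (S m) x *\<^sub>R levy_integrand u x) \<longlonglongrightarrow> levy_integrand u x"
        by (intro tendsto_eventually eventually_sequentiallyI[of "max m1 m2"]) auto
    qed
    show "AE x in \<nu>. norm (indicat_real (S m) x *\<^sub>R levy_integrand u x) \<le> norm (levy_integrand u x)" for m
      by (intro AE_I2) (auto simp: indicator_def)
  qed
  then have lim2: "(\<lambda>m. CLINT \<omega>|M. iexp (u * T m \<omega>)) \<longlonglongrightarrow> (CLINT \<omega>|M. iexp (u * V \<omega>)) * exp (of_real t * (CLINT x|\<nu>. levy_integrand u x))"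
    unfolding Tc by (intro tendsto_intros)
  have "(CLINT \<omega>|M. iexp (u * V \<omega>)) = exp (\<i> * of_real (u * (b * t)) - of_real (\<sigma>\<^sup>2 * u\<^sup>2 * t / 2))"
    unfolding V_def by (rule brownian_char[OF W t])
  with LIMSEQ_unique[OF lim1 lim2] show ?thesis
    by (simp add: v exp_add[symmetric] algebra_simps)
qed

section \<open>Expansion for the approximating laws\<close>

text \<open>The law of an independent sum, built on a product space. The nesting keeps the two kinds
  of jumps apart: the inner expectation is over the jumps with density \<open>s\<close>, the outer
  one over those with density \<open>r\<close>.\<close>

lemma compound_poisson_pair_exists:
  assumes r: "\<And>w. 0 \<le> r w" "integrable lborel r" and s: "\<And>w. 0 \<le> s w" "integrable lborel s" and t: "0 \<le> t"
  shows "\<exists>P. real_distribution P \<and> (\<forall>g B. g \<in> borel_measurable borel \<longrightarrow> (\<forall>x. \<bar>g x\<bar> \<le> B) \<longrightarrow>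
    (LINT w|P. g w) = cp_expect r t (cp_expect s t g) 0)"
proof -
  obtain P where P: "real_distribution P" and PI: "\<forall>g B x. g \<in> borel_measurable borel \<longrightarrow> (\<forall>x. \<bar>g x\<bar> \<le> B) \<longrightarrow>
    (LINT w|P. g (x + w)) = cp_expect r t g x"
    using compound_poisson_exists[OF r t] by blast
  obtain Q where Q: "real_distribution Q" and QI: "\<forall>g B x. g \<in> borel_measurable borel \<longrightarrow> (\<forall>x. \<bar>g x\<bar> \<le> B) \<longrightarrow>
    (LINT w|Q. g (x + w)) = cp_expect s t g x"
    using compound_poisson_exists[OF s t] by blast
  interpret P: real_distribution P by (rule P)
  interpret Q: real_distribution Q by (rule Q)
  interpret PQ: pair_prob_space P Q ..
  have [measurable_cong]: "sets P = sets borel" "sets Q = sets borel" by simp_all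
  let ?D = "distr (P \<Otimes>\<^sub>M Q) borel (\<lambda>(a, b). a + b)"
  have "real_distribution ?D"
    by (intro real_distribution.intro PQ.prob_space_distr) (auto intro: real_distribution_axioms.intro)
  moreover have "(LINT w|?D. g w) = cp_expect r t (cp_expect s t g) 0"
    if [measurable]: "g \<in> borel_measurable borel" and gB: "\<And>x. \<bar>g x\<bar> \<le> B" for g B
  proof -
    have q: "(LINT b|Q. g (a + b)) = cp_expect s t g a" for a
      using QI that by blast
    \<comment> \<open>Measurability of \<open>cp_expect s t g\<close> is read off from its
      representation as an integral with a parameter.\<close>
    have "(\<lambda>a. LINT b|Q. g (a + b)) \<in> borel_measurable borel" by measurable
    then have m: "cp_expect s t g \<in> borel_measurable borel" unfolding q .
    have b: "\<bar>cp_expect s t g a\<bar> \<le> B" for a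
      by (rule cp_expect_bound[OF s t that])
    have "(LINT w|?D. g w) = (LINT p|(P \<Otimes>\<^sub>M Q). g (fst p + snd p))"
      by (subst integral_distr) (auto simp: case_prod_unfold)
    also have "\<dots> = (LINT a|P. LINT b|Q. g (a + b))"
    proof -
      have "integrable (P \<Otimes>\<^sub>M Q) (\<lambda>p. g (fst p + snd p))"
        by (rule PQ.integrable_const_bound[of _ B]) (auto simp: gB)
      from PQ.integral_fst'[OF this] show ?thesis by simp
    qed
    also have "\<dots> = cp_expect r t (cp_expect s t g) 0"
      unfolding q using PI[rule_format, OF m b, of 0] by simp
    finally show ?thesis .
  qed
  ultimately show ?thesis by blast
qed

text \<open>Real parts of exponentials are enough to recover characteristic functions, and the
  generators, defined on real functions only, apply to them.\<close>

definition wave :: "real \<Rightarrow> complex \<Rightarrow> real \<Rightarrow> real" where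
  "wave u z x = Re (z * iexp (u * x))"

definition fourier :: "(real \<Rightarrow> real) \<Rightarrow> real \<Rightarrow> complex" where
  "fourier r u = (CLINT w|lborel. r w *\<^sub>R iexp (u * w))"

lemma abs_wave_le: "\<bar>wave u z x\<bar> \<le> norm z"
  using abs_Re_le_cmod[of "z * iexp (u * x)"] by (simp add: wave_def norm_mult)

lemma wave_measurable [measurable]: "wave u z \<in> borel_measurable borel"
  unfolding wave_def by measurable

lemma has_field_derivative_wave: "(wave u z has_field_derivative wave u (z * (\<i> * u)) x) (at x)"
  unfolding wave_def
  by (auto intro!: derivative_eq_intros simp: Re_exp Im_exp algebra_simps)

lemma deriv_wave: "deriv (wave u z) = wave u (z * (\<i> * u))"
  by (intro ext DERIV_imp_deriv has_field_derivative_wave)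

text \<open>Each derivative multiplies the amplitude by \<open>\<bar>u\<bar>\<close>; the maximum
  with 1 lets the same bound cover the lower orders.\<close>

lemma Cb_wave: "Cb UNIV k (norm z * max 1 \<bar>u\<bar> ^ k) (wave u z)"
proof (induction k arbitrary: z)
  case 0
  show ?case using abs_wave_le
    by (auto intro!: continuous_at_imp_continuous_on DERIV_isCont[OF has_field_derivative_wave])
next
  case (Suc k)
  have "Cb UNIV k (norm (z * (\<i> * u)) * max 1 \<bar>u\<bar> ^ k) (wave u (z * (\<i> * u)))" by (rule Suc.IH)
  moreover have "norm (z * (\<i> * u)) * max 1 \<bar>u\<bar> ^ k \<le> norm z * max 1 \<bar>u\<bar> ^ Suc k"
    by (simp add: norm_mult mult.assoc mult_left_mono mult_right_mono)
  ultimately have "Cb UNIV k (norm z * max 1 \<bar>u\<bar> ^ Suc k) (deriv (wave u z))"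
    unfolding deriv_wave by (rule Cb_mono) simp
  moreover have "\<bar>wave u z x\<bar> \<le> norm z * max 1 \<bar>u\<bar> ^ Suc k" for x
    by (rule order_trans[OF abs_wave_le]) (metis mult.right_neutral mult_left_mono norm_ge_zero max.cobounded1 one_le_power)
  ultimately show ?case using has_field_derivative_wave by (simp add: field_differentiable_def del: power_Suc) blast
qed

section \<open>Action of the operators on trigonometric functions\<close>

lemma integrable_iexp:
  fixes r :: "real \<Rightarrow> real"
  assumes "integrable lborel r"
  shows "integrable lborel (\<lambda>w. r w *\<^sub>R iexp (u * w))"
  by (rule Bochner_Integration.integrable_bound[OF assms])
    (use borel_measurable_integrable[OF assms] in auto)

lemma conv_op_wave:
  assumes "integrable lborel r"
  shows "conv_op r (wave u z) = wave u (z * fourier r u)"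
proof
  fix x
  have bl: "bounded_linear (\<lambda>c. Re (z * iexp (u * x) * c))"
    by (intro bounded_linear_compose[OF bounded_linear_Re bounded_linear_mult_right])
  have "conv_op r (wave u z) x = (LBINT w. Re (z * iexp (u * x) * (r w *\<^sub>R iexp (u * w))))"
    unfolding conv_op_def wave_def
    by (intro Bochner_Integration.integral_cong) (simp_all add: exp_add distrib_left mult_ac)
  also have "\<dots> = Re (z * iexp (u * x) * fourier r u)"
    unfolding fourier_def by (rule integral_bounded_linear[OF bl integrable_iexp[OF assms]])
  finally show "conv_op r (wave u z) x = wave u (z * fourier r u) x" by (simp add: wave_def mult_ac)
qed

text \<open>A convolution only multiplies the complex amplitude by \<open>fourier r u\<close>, so
  the exponential series of the operator becomes that of a number.\<close>

lemma cp_expect_wave: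
  assumes r: "\<And>w. 0 \<le> r w" "integrable lborel r"
  shows "cp_expect r t (wave u z) = wave u (z * exp (of_real t * (fourier r u - of_real (mass r))))"
proof
  fix x
  have it: "(conv_op r ^^ k) (wave u z) = wave u (z * fourier r u ^ k)" for k
    by (induction k) (simp_all add: conv_op_wave[OF r(2)] mult_ac)
  have "(\<lambda>k. z * iexp (u * x) * ((of_real t * fourier r u) ^ k /\<^sub>R fact k)) sums (z * iexp (u * x) * exp (of_real t * fourier r u))"
    by (intro sums_mult exp_converges)
  then have "(\<lambda>k. Re (z * iexp (u * x) * ((of_real t * fourier r u) ^ k /\<^sub>R fact k))) sums Re (z * iexp (u * x) * exp (of_real t * fourier r u))"
    by (rule sums_Re)
  moreover have "Re (z * iexp (u * x) * ((of_real t * fourier r u) ^ k /\<^sub>R fact k)) = (conv_op r ^^ k) (wave u z) x / fact k * t ^ k" for k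
  proof -
    have "z * iexp (u * x) * ((of_real t * fourier r u) ^ k /\<^sub>R fact k) = (t ^ k / fact k) *\<^sub>R (z * fourier r u ^ k * iexp (u * x))"
      by (simp add: scaleR_conv_of_real power_mult_distrib field_simps)
    then show ?thesis unfolding it wave_def by simp
  qed
  ultimately have "(\<Sum>k. (conv_op r ^^ k) (wave u z) x / fact k * t ^ k) = Re (z * iexp (u * x) * exp (of_real t * fourier r u))"
    by (simp add: sums_iff)
  then have "cp_expect r t (wave u z) x = exp (- t * mass r) * Re (z * iexp (u * x) * exp (of_real t * fourier r u))"
    by (simp add: cp_expect_def[OF r])
  also have "\<dots> = Re (exp (- t * mass r) *\<^sub>R (z * iexp (u * x) * exp (of_real t * fourier r u)))"
    by simp
  also have "exp (- t * mass r) *\<^sub>R (z * iexp (u * x) * exp (of_real t * fourier r u))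
     = z * exp (of_real t * (fourier r u - of_real (mass r))) * iexp (u * x)"
    by (simp add: scaleR_conv_of_real exp_of_real[symmetric] exp_diff exp_minus right_diff_distrib field_simps)
  also have "Re (z * exp (of_real t * (fourier r u - of_real (mass r))) * iexp (u * x))
      = wave u (z * exp (of_real t * (fourier r u - of_real (mass r)))) x"
    by (rule wave_def[symmetric])
  finally show "cp_expect r t (wave u z) x = wave u (z * exp (of_real t * (fourier r u - of_real (mass r)))) x" .
qed

lemma complex_eqI_Re: "(\<And>z. Re (z * a) = Re (z * b)) \<Longrightarrow> a = b"
  using complex_eqI[of a b] by (metis Re_i_times mult_1 neg_equal_iff_equal)

lemma char_compound_poisson_pair:
  assumes r: "\<And>w. 0 \<le> r w" "integrable lborel r" and s: "\<And>w. 0 \<le> s w" "integrable lborel s"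
    and P: "real_distribution P" 
    and PI: "\<And>g B. g \<in> borel_measurable borel \<Longrightarrow> (\<And>x. \<bar>g x\<bar> \<le> B) \<Longrightarrow> (LINT w|P. g w) = cp_expect r t (cp_expect s t g) 0"
  shows "char P u = exp (of_real t * (fourier s u - of_real (mass s))) * exp (of_real t * (fourier r u - of_real (mass r)))"
    (is "_ = ?R")
proof (rule complex_eqI_Re)
  fix z :: complex
  interpret real_distribution P by (rule P)
  have bl: "bounded_linear (\<lambda>c. Re (z * c))"
    by (intro bounded_linear_compose[OF bounded_linear_Re bounded_linear_mult_right])
  have "Re (z * char P u) = (LINT w|P. wave u z w)"
    unfolding char_def wave_def using integral_bounded_linear[OF bl, of P "\<lambda>x. iexp (u * x)"]
    by (simp add: integrable_iexp)
  also have "\<dots> = wave u (z * exp (of_real t * (fourier s u - of_real (mass s))) * exp (of_real t * (fourier r u - of_real (mass r)))) 0"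
    using PI[OF wave_measurable abs_wave_le] by (simp add: cp_expect_wave[OF r] cp_expect_wave[OF s])
  finally show "Re (z * char P u) = Re (z * ?R)"
    by (simp add: wave_def mult.assoc)
qed

text \<open>At 0 a generator applied to a wave is the real part of \<open>z\<close> times a Levy
  exponent, here for compound Poisson and in \<open>levy_op_wave\<close> for the limit. Convergence
  of generators thus contains convergence of exponents.\<close>

lemma cp_gen_wave:
  assumes r: "\<And>w. 0 \<le> r w" "integrable lborel r"
  shows "cp_gen r (wave u z) 0 = Re (z * (fourier r u - mass r))"
  by (simp add: cp_gen_def[OF r] conv_op_wave[OF r(2)] wave_def right_diff_distrib)

lemma small_exponent_integrable:
  assumes q: "q \<in> borel_measurable borel" "integrable lborel (\<lambda>w. w\<^sup>2 * q w)"
  shows "integrable lborel (\<lambda>w. q w *\<^sub>R (iexp (u * w) - 1 - \<i> * (u * w)))"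
proof (rule Bochner_Integration.integrable_bound)
  note [measurable] = q(1)
  show "integrable lborel (\<lambda>w. u\<^sup>2 / 2 * (w\<^sup>2 * q w))" using q(2) by simp
  show "(\<lambda>w. q w *\<^sub>R (iexp (u * w) - 1 - \<i> * (u * w))) \<in> borel_measurable lborel" by measurable
  show "AE w in lborel. norm (q w *\<^sub>R (iexp (u * w) - 1 - \<i> * (u * w))) \<le> norm (u\<^sup>2 / 2 * (w\<^sup>2 * q w))"
  proof (rule AE_I2)
    fix w
    have "norm (iexp (u * w) - 1 - \<i> * (u * w)) \<le> (u * w)\<^sup>2 / 2"
      using iexp_approx1[of "u * w" 1] by (simp add: algebra_simps power2_eq_square)
    from mult_left_mono[OF this, of "\<bar>q w\<bar>"]
    show "norm (q w *\<^sub>R (iexp (u * w) - 1 - \<i> * (u * w))) \<le> norm (u\<^sup>2 / 2 * (w\<^sup>2 * q w))"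
      by (simp add: abs_mult power_mult_distrib mult_ac)
  qed
qed

lemma levy_op_wave:
  assumes q: "q \<in> borel_measurable borel" "integrable lborel (\<lambda>w. w\<^sup>2 * q w)"
  shows "levy_op a v q (wave u z) 0 = Re (z * (\<i> * (u * a) - v * u\<^sup>2
    + (CLINT w|lborel. q w *\<^sub>R (iexp (u * w) - 1 - \<i> * (u * w)))))"
proof -
  have bl: "bounded_linear (\<lambda>c. Re (z * c))"
    by (intro bounded_linear_compose[OF bounded_linear_Re bounded_linear_mult_right])
  have "(LBINT w. (wave u z (0 + w) - wave u z 0 - w * deriv (wave u z) 0) * q w)
    = (LBINT w. Re (z * (q w *\<^sub>R (iexp (u * w) - 1 - \<i> * (u * w)))))"
    by (intro Bochner_Integration.integral_cong) (simp_all add: deriv_wave wave_def algebra_simps)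
  also have "\<dots> = Re (z * (CLINT w|lborel. q w *\<^sub>R (iexp (u * w) - 1 - \<i> * (u * w))))"
    by (rule integral_bounded_linear[OF bl small_exponent_integrable[OF q]])
  finally have 1: "(LBINT w. (wave u z (0 + w) - wave u z 0 - w * deriv (wave u z) 0) * q w)
    = Re (z * (CLINT w|lborel. q w *\<^sub>R (iexp (u * w) - 1 - \<i> * (u * w))))" .
  show ?thesis unfolding levy_op_def 1
    by (simp add: deriv_wave numeral_2_eq_2 wave_def algebra_simps power2_eq_square)
qed

text \<open>Finite propagation: every application of the generator looks at most \<epsilon>
  further.\<close>

lemma cp_gen_iterate_vanishes:
  fixes \<epsilon> R :: real
  assumes r: "\<And>w. 0 \<le> r w" "integrable lborel r" and supp: "\<And>w. \<epsilon> < \<bar>w\<bar> \<Longrightarrow> r w = 0"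
  shows "(\<And>x. \<bar>x\<bar> \<le> R + j * \<epsilon> \<Longrightarrow> h x = 0) \<Longrightarrow> 0 \<le> \<epsilon> \<Longrightarrow> \<bar>x\<bar> \<le> R \<Longrightarrow> (cp_gen r ^^ j) h x = 0"
proof (induction j arbitrary: x R)
  case (Suc j)
  have "r w * (cp_gen r ^^ j) h (x + w) = 0" for w
  proof (cases "\<bar>w\<bar> \<le> \<epsilon>")
    case True
    have "(cp_gen r ^^ j) h (x + w) = 0"
      using True Suc.prems by (intro Suc.IH[of "R + \<epsilon>"]) (auto simp: algebra_simps)
    then show ?thesis by simp
  qed (simp add: supp)
  then have "(LBINT w. r w * (cp_gen r ^^ j) h (x + w)) = 0" by (simp only: integral_zero)
  moreover have "(cp_gen r ^^ j) h x = 0"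
    using Suc.prems by (intro Suc.IH[of "R + \<epsilon>"]) (auto simp: algebra_simps)
  ultimately show ?case
    unfolding funpow.simps o_apply cp_gen_def[OF r, of "(cp_gen r ^^ j) h"] conv_op_def[of r "(cp_gen r ^^ j) h"] by simp
qed simp

text \<open>The interface to the rest of the proof: the bound asks for \<open>2 * j\<close>
  derivatives and is uniform in the index of the sequence, while convergence asks for one
  more.\<close>

lemma small_jump_sequence:
  fixes q :: "real \<Rightarrow> real"
  assumes q: "\<And>w. 0 \<le> q w" "q \<in> borel_measurable borel" "integrable lborel (\<lambda>w. w\<^sup>2 * q w)"
    and supp: "\<And>w. \<epsilon> < \<bar>w\<bar> \<Longrightarrow> q w = 0" and \<epsilon>: "0 < \<epsilon>" "\<epsilon> \<le> 1" and v: "0 \<le> v"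
  shows "\<exists>r K. 1 \<le> K \<and> (\<forall>m w. 0 \<le> r m w) \<and> (\<forall>m. integrable lborel (r m)) \<and> (\<forall>m w. \<epsilon> < \<bar>w\<bar> \<longrightarrow> r m w = 0) \<and>
    (\<forall>m j B g x. Cb UNIV (2 * j) B g \<longrightarrow> \<bar>(cp_gen (r m) ^^ j) g x\<bar> \<le> K ^ j * B) \<and>
    (\<forall>j B g x. Cb UNIV (2 * j + 1) B g \<longrightarrow> (\<lambda>m. (cp_gen (r m) ^^ j) g x) \<longlonglongrightarrow> (levy_op a v q ^^ j) g x)"
proof -
  define I where "I = (LBINT w. w\<^sup>2 * q w)"
  have I0: "0 \<le> I" unfolding I_def using q(1) by simp
  define d where "d m = \<epsilon> / real (Suc m)" for m
  have d: "0 < d m" "d m \<le> \<epsilon>" for m using \<epsilon> by (auto simp: d_def divide_le_eq mult_left_mono[of 1])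
  have d0: "d \<longlonglongrightarrow> 0"
    using tendsto_mult[OF tendsto_const LIMSEQ_inverse_real_of_nat, of \<epsilon>] by (simp add: d_def[abs_def] divide_inverse)
  define z where "z m = (\<lambda>w. indicator {-d m..d m} w * q w)" for m
  define Q where "Q m r p \<longleftrightarrow> (\<forall>w. 0 \<le> r w) \<and> integrable lborel r \<and> has_bochner_integral lborel (\<lambda>w. w * r w) a \<and>
    integrable lborel (\<lambda>w. w\<^sup>2 * r w) \<and> (\<forall>w. \<epsilon> < \<bar>w\<bar> \<longrightarrow> r w = 0) \<and>
    p \<in> borel_measurable borel \<and> integrable lborel (\<lambda>w. w\<^sup>2 * p w) \<and> integrable lborel (\<lambda>w. \<bar>w\<bar> ^ 3 * p w) \<and>
    z m \<in> borel_measurable borel \<and> integrable lborel (\<lambda>w. w\<^sup>2 * z m w) \<and> (\<forall>w. r w - q w = p w - z m w) \<and>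
    (LBINT w. \<bar>w\<^sup>2 * r w\<bar>) \<le> \<bar>a\<bar> + 2 * v + 2 * I \<and>
    (LBINT w. \<bar>\<bar>w\<bar> ^ 3 * p w\<bar>) + \<bar>(LBINT w. w\<^sup>2 * p w) / 2 - v\<bar> \<le> d m * (2 * v + 2 * (\<bar>a\<bar> + I))"
    for m and r p :: "real \<Rightarrow> real"
  have "\<forall>m. \<exists>rp. Q m (fst rp) (snd rp)"
    using small_jump_approximation[OF q supp \<epsilon> v d, of _ a] unfolding Q_def Let_def z_def I_def by simp
  from choice[OF this] obtain rp where rp: "\<forall>m. Q m (fst (rp m)) (snd (rp m))" ..
  define r where "r m = fst (rp m)" for m
  define p where "p m = snd (rp m)" for m
  note rp = rp[folded r_def p_def, unfolded Q_def, rule_format]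
  have r0: "0 \<le> r m w" and ri: "integrable lborel (r m)"
    and r1: "has_bochner_integral lborel (\<lambda>w. w * r m w) a" and r2: "integrable lborel (\<lambda>w. w\<^sup>2 * r m w)"
    and p: "p m \<in> borel_measurable borel" "integrable lborel (\<lambda>w. w\<^sup>2 * p m w)" "integrable lborel (\<lambda>w. \<bar>w\<bar> ^ 3 * p m w)"
    and z: "z m \<in> borel_measurable borel" "integrable lborel (\<lambda>w. w\<^sup>2 * z m w)"
    and rq: "r m w - q w = p m w - z m w"
    and rK: "(LBINT w. \<bar>w\<^sup>2 * r m w\<bar>) \<le> \<bar>a\<bar> + 2 * v + 2 * I"
    and pk: "(LBINT w. \<bar>\<bar>w\<bar> ^ 3 * p m w\<bar>) + \<bar>(LBINT w. w\<^sup>2 * p m w) / 2 - v\<bar> \<le> d m * (2 * v + 2 * (\<bar>a\<bar> + I))" for m w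
    using rp[of m] by blast+
  have rs: "r m w = 0" if "\<epsilon> < \<bar>w\<bar>" for m w using rp[of m] that by blast
  \<comment> \<open>One constant that is at least 1 and dominates the operator constants of all
    approximations and of the limit.\<close>
  define K where "K = 1 + 2 * \<bar>a\<bar> + 2 * v + 2 * I"
  define \<kappa> where "\<kappa> m = d m * (2 * v + 2 * (\<bar>a\<bar> + I)) + (LBINT w. \<bar>w\<^sup>2 * z m w\<bar>)" for m
  have K1: "1 \<le> K" using v I0 by (simp add: K_def)
  have Kr: "\<bar>a\<bar> + (LBINT w. \<bar>w\<^sup>2 * r m w\<bar>) \<le> K" for m using rK[of m] by (simp add: K_def)
  have Kq: "\<bar>a\<bar> + \<bar>v\<bar> + (LBINT w. \<bar>w\<^sup>2 * q w\<bar>) \<le> K" using q(1) v I0 by (simp add: K_def I_def)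
  \<comment> \<open>The second moment of the part of \<open>q\<close> cut out around 0 tends to 0;
    at the point 0 itself the weight \<open>w\<^sup>2\<close> vanishes.\<close>
  have "(\<lambda>m. LBINT w. \<bar>w\<^sup>2 * z m w\<bar>) \<longlonglongrightarrow> integral\<^sup>L lborel (\<lambda>w::real. 0)"
  proof (rule integral_dominated_convergence[where f = "\<lambda>w. 0" and s = "\<lambda>m w. \<bar>w\<^sup>2 * z m w\<bar>" and w = "\<lambda>w. w\<^sup>2 * q w"])
    show "AE w in lborel. (\<lambda>m. \<bar>w\<^sup>2 * z m w\<bar>) \<longlonglongrightarrow> 0"
    proof (rule AE_I2, cases)
      fix w :: real assume "w \<noteq> 0"
      then have "eventually (\<lambda>m. d m < \<bar>w\<bar>) sequentially" using order_tendstoD(2)[OF d0, of "\<bar>w\<bar>"] by simp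
      then have "eventually (\<lambda>m. \<bar>w\<^sup>2 * z m w\<bar> = 0) sequentially"
        by eventually_elim (auto simp: z_def indicator_def)
      then show "(\<lambda>m. \<bar>w\<^sup>2 * z m w\<bar>) \<longlonglongrightarrow> 0" by (rule tendsto_eventually)
    qed simp
    show "(\<lambda>w. \<bar>w\<^sup>2 * z m w\<bar>) \<in> borel_measurable lborel" for m
      using borel_measurable_integrable[OF z(2)[of m]] by simp
    show "AE w in lborel. norm \<bar>w\<^sup>2 * z m w\<bar> \<le> w\<^sup>2 * q w" for m
      using q(1) by (intro AE_I2) (auto simp: z_def indicator_def)
  qed (use q in auto)
  then have "\<kappa> \<longlonglongrightarrow> 0 * (2 * v + 2 * (\<bar>a\<bar> + I)) + 0"
    unfolding \<kappa>_def by (intro tendsto_intros d0) simp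
  then have \<kappa>0: "\<kappa> \<longlonglongrightarrow> 0" by simp
  have gen: "(cp_gen (r m) ^^ j) g = (levy_op a 0 (r m) ^^ j) g" if "Cb UNIV (2 * j) B g" for m j B g
    using cp_gen_iterate_eq_levy_op[OF r0 ri _ r2 that, of m] r1[of m] by (simp add: has_bochner_integral_iff)
  have bd: "\<bar>(cp_gen (r m) ^^ j) g x\<bar> \<le> K ^ j * B" if "Cb UNIV (2 * j) B g" for m j B g x
  proof -
    have rm: "r m \<in> borel_measurable borel" using borel_measurable_integrable[OF ri] by simp
    have "\<bar>a\<bar> + \<bar>0\<bar> + (LBINT w. \<bar>w\<^sup>2 * r m w\<bar>) \<le> K" using Kr[of m] by simp
    moreover have "Cb UNIV (2 * j + 0) B g" using that by simp
    ultimately have "Cb UNIV 0 (K ^ j * B) ((levy_op a 0 (r m) ^^ j) g)"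
      by (rule Cb_levy_op_iterate[OF rm r2])
    then show ?thesis unfolding gen[OF that] using Cb_bound by blast
  qed
  have lim: "(\<lambda>m. (cp_gen (r m) ^^ j) g x) \<longlonglongrightarrow> (levy_op a v q ^^ j) g x" if g: "Cb UNIV (2 * j + 1) B g" for j B g x
  proof (rule Lim_transform2[OF tendsto_const], rule Lim_null_comparison)
    have g2: "Cb UNIV (2 * j) B g" by (rule Cb_antimono[OF g]) simp
    have "\<bar>(levy_op a 0 (r m) ^^ j) g x - (levy_op a v q ^^ j) g x\<bar> \<le> j * K ^ j * \<kappa> m * B" for m
      using pk[of m] by (intro levy_op_iterate_approx[OF q(2,3) Kq p z rq Kr K1 _ g]) (simp add: \<kappa>_def)
    then show "eventually (\<lambda>m. norm ((levy_op a v q ^^ j) g x - (cp_gen (r m) ^^ j) g x) \<le> j * K ^ j * B * \<kappa> m) sequentially"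
      unfolding gen[OF g2] by (intro always_eventually allI) (simp add: abs_minus_commute mult_ac)
    show "(\<lambda>m. j * K ^ j * B * \<kappa> m) \<longlonglongrightarrow> 0" using tendsto_mult_right_zero[OF \<kappa>0] .
  qed
  show ?thesis using K1 r0 ri rs bd lim by blast
qed

text \<open>For \<open>t\<close> at most 1 every power beyond the N-th is at most
  \<open>t ^ N\<close>, and the remaining coefficients sum to at most \<open>exp l\<close>.\<close>

lemma exp_tail_bound:
  fixes a :: "nat \<Rightarrow> real"
  assumes a: "\<And>k. \<bar>a k\<bar> \<le> l ^ k" and l: "0 \<le> l" and t: "0 \<le> t" "t \<le> 1"
  shows "\<bar>(\<Sum>k. a k / fact k * t ^ k) - (\<Sum>k<N. a k / fact k * t ^ k)\<bar> \<le> exp l * t ^ N"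
proof -
  have s: "summable (\<lambda>k. a k / fact k * t ^ k)" by (rule summable_exp_type[of _ 1 l]) (simp add: a)
  have sl: "summable (\<lambda>k. l ^ k / fact k)" using summable_exp[of l] by (simp add: field_simps)
  have bd: "\<bar>a (k + N) / fact (k + N) * t ^ (k + N)\<bar> \<le> l ^ (k + N) / fact (k + N) * t ^ N" for k
  proof -
    have "\<bar>a (k + N) / fact (k + N) * t ^ (k + N)\<bar> = \<bar>a (k + N)\<bar> / fact (k + N) * (t ^ k * t ^ N)"
      using t by (simp add: abs_mult power_add)
    also have "\<dots> \<le> l ^ (k + N) / fact (k + N) * (1 * t ^ N)"
      using t a l by (intro mult_mono divide_right_mono power_le_one mult_nonneg_nonneg) auto
    finally show ?thesis by simp
  qed
  have sb: "summable (\<lambda>k. l ^ (k + N) / fact (k + N) * t ^ N)"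
    using sl summable_iff_shift[of "\<lambda>k. l ^ k / fact k" N] by (intro summable_mult2) blast
  have sa: "summable (\<lambda>k. \<bar>a (k + N) / fact (k + N) * t ^ (k + N)\<bar>)"
    by (rule summable_comparison_test'[OF sb, of 0]) (use bd in simp)
  have "(\<Sum>k. a k / fact k * t ^ k) - (\<Sum>k<N. a k / fact k * t ^ k) = (\<Sum>k. a (k + N) / fact (k + N) * t ^ (k + N))"
    using suminf_split_initial_segment[OF s, of N] by simp
  also have "\<bar>\<dots>\<bar> \<le> (\<Sum>k. \<bar>a (k + N) / fact (k + N) * t ^ (k + N)\<bar>)" by (rule summable_rabs[OF sa])
  also have "\<dots> \<le> (\<Sum>k. l ^ (k + N) / fact (k + N) * t ^ N)" by (rule suminf_le[OF bd sa sb])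
  also have "\<dots> = (\<Sum>k. l ^ (k + N) / fact (k + N)) * t ^ N"
    using sl summable_iff_shift[of "\<lambda>k. l ^ k / fact k" N] by (intro suminf_mult2[symmetric]) blast
  also have "(\<Sum>k. l ^ (k + N) / fact (k + N)) \<le> exp l"
  proof -
    have "exp l = (\<Sum>k. l ^ k / fact k)" by (simp add: exp_def divide_inverse mult.commute)
    also have "\<dots> = (\<Sum>k. l ^ (k + N) / fact (k + N)) + (\<Sum>k<N. l ^ k / fact k)"
      by (rule suminf_split_initial_segment[OF sl])
    finally show ?thesis using sum_nonneg[of "{..<N}" "\<lambda>k. l ^ k / fact k"] l by simp
  qed
  finally show ?thesis using t by (simp add: mult_right_mono)
qed

text \<open>The series in the number of large jumps splits into three parts, each integrated against
  the law of the small jumps. No large jump: the nonsmooth \<open>g\<close> is replaced by the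
  majorant \<open>h\<close>. One to n large jumps: Taylor expansion in time. More than n: a factor
  \<open>t ^ (n + 1)\<close> is already present. The three parts give the three summands of the
  constant.\<close>

lemma cp_pair_expansion:
  fixes \<epsilon> :: real
  assumes r: "\<And>w. 0 \<le> r w" "integrable lborel r" and supp: "\<And>w. \<epsilon> < \<bar>w\<bar> \<Longrightarrow> r w = 0" and \<epsilon>: "0 \<le> \<epsilon>"
    and s: "\<And>w. 0 \<le> s w" "integrable lborel s"
    and K: "1 \<le> K" "\<And>j B g x. Cb UNIV (2 * j) B g \<Longrightarrow> \<bar>(cp_gen r ^^ j) g x\<bar> \<le> K ^ j * B"
    and g [measurable]: "g \<in> borel_measurable borel" and g01: "\<And>x. 0 \<le> g x" "\<And>x. g x \<le> 1" "\<And>x. g x \<le> h x"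
    and h: "Cb UNIV (2 * (n + 1)) H h" "\<And>x. \<bar>x\<bar> \<le> n * \<epsilon> \<Longrightarrow> h x = 0"
    and f: "\<And>i. 1 \<le> i \<Longrightarrow> i \<le> n \<Longrightarrow> f i = (conv_op s ^^ i) g" "\<And>i. 1 \<le> i \<Longrightarrow> i \<le> n \<Longrightarrow> Cb UNIV (2 * n) F (f i)"
    and F: "0 \<le> F" and t: "0 < t" "t \<le> 1"
  shows "\<bar>cp_expect r t (cp_expect s t g) 0 - exp (- t * mass s) *
      (\<Sum>i=1..n. (\<Sum>l<n + 1 - i. (cp_gen r ^^ l) (f i) 0 / fact l * t ^ l) / fact i * t ^ i)\<bar>
    \<le> (K ^ (n + 1) * H + n * (K ^ (n + 1) * F) + exp (mass s)) * t ^ (n + 1)"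
proof -
  let ?l = "mass s"
  have l: "0 \<le> ?l" by (rule Bochner_Integration.integral_nonneg) (rule s(1))
  have t0: "0 \<le> t" using t by simp
  obtain P where P: "real_distribution P" and PI': "\<forall>g B x. g \<in> borel_measurable borel \<longrightarrow> (\<forall>x. \<bar>g x\<bar> \<le> B) \<longrightarrow>
    (LINT w|P. g (x + w)) = cp_expect r t g x"
    using compound_poisson_exists[OF r t0] by blast
  interpret P: real_distribution P by (rule P)
  have [measurable_cong]: "sets P = sets borel" by simp
  have PI: "(LINT w|P. g w) = cp_expect r t g 0" if "g \<in> borel_measurable borel" "\<And>x. \<bar>g x\<bar> \<le> B" for g and B :: real
    using PI'[rule_format, OF that, of 0] by simp
  have int: "integrable P g" if [measurable]: "g \<in> borel_measurable borel" and "\<And>x. \<bar>g x\<bar> \<le> B" for g and B :: real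
    by (rule P.integrable_const_bound[of _ B]) (use that in auto)
  have gB: "\<bar>g x\<bar> \<le> 1" for x using g01[of x] by simp
  define S where "S x = (\<Sum>k. (conv_op s ^^ k) g x / fact k * t ^ k)" for x
  define R where "R x = S x - (\<Sum>k<n + 1. (conv_op s ^^ k) g x / fact k * t ^ k)" for x
  note Jm = conv_op_iterate_measurable[OF s g]
  have Jb: "\<bar>(conv_op s ^^ k) g x\<bar> \<le> ?l ^ k" for k x
    using abs_conv_op_iterate_le[OF s g gB, of k x] by simp
  have Sm: "S \<in> borel_measurable borel" unfolding S_def[abs_def] using Jm by measurable
  have Rm: "R \<in> borel_measurable borel" unfolding R_def[abs_def] using Sm Jm by measurable
  have Rb: "\<bar>R x\<bar> \<le> exp ?l * t ^ (n + 1)" for x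
    unfolding R_def S_def by (rule exp_tail_bound[OF Jb l t0 t(2)])
  have fm: "f i \<in> borel_measurable borel" "\<And>x. \<bar>f i x\<bar> \<le> F" if "i \<in> {1..n}" for i
    using f(2)[of i] that Cb_measurable Cb_bound by force+
  have split: "S x = g x + (\<Sum>i=1..n. f i x / fact i * t ^ i) + R x" for x
  proof -
    have "{..<n + 1} = insert 0 {1..n}" by auto
    then have "(\<Sum>k<n + 1. (conv_op s ^^ k) g x / fact k * t ^ k) = g x + (\<Sum>k=1..n. (conv_op s ^^ k) g x / fact k * t ^ k)"
      by simp
    also have "(\<Sum>k=1..n. (conv_op s ^^ k) g x / fact k * t ^ k) = (\<Sum>i=1..n. f i x / fact i * t ^ i)"
      using f(1) by (intro sum.cong) auto
    finally show ?thesis unfolding R_def by simp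
  qed
  have Sb: "\<bar>S x\<bar> \<le> exp (t * ?l)" for x
  proof -
    have "\<bar>cp_expect s t g x\<bar> \<le> 1" by (rule cp_expect_bound[OF s t0 g gB])
    then have "exp (t * ?l) * \<bar>exp (- t * ?l) * S x\<bar> \<le> exp (t * ?l) * 1"
      unfolding cp_expect_def[OF s] S_def by (intro mult_left_mono) auto
    then show ?thesis by (simp add: abs_mult mult.assoc[symmetric] exp_add[symmetric])
  qed
  have "cp_expect s t g = (\<lambda>x. exp (- t * ?l) * S x)"
    by (simp add: fun_eq_iff cp_expect_def[OF s] S_def)
  moreover have "cp_expect s t g \<in> borel_measurable borel"
    unfolding \<open>cp_expect s t g = _\<close> using Sm by measurable
  ultimately have 1: "cp_expect r t (cp_expect s t g) 0 = exp (- t * ?l) * (LINT w|P. S w)"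
    using PI[of "cp_expect s t g" 1] cp_expect_bound[OF s t0 g gB] by simp
  have "(LINT w|P. S w) = (LINT w|P. g w + (\<Sum>i=1..n. f i w / fact i * t ^ i) + R w)"
    by (intro Bochner_Integration.integral_cong) (simp_all add: split)
  also have "\<dots> = (LINT w|P. g w) + (\<Sum>i=1..n. (LINT w|P. f i w) / fact i * t ^ i) + (LINT w|P. R w)"
  proof -
    have i: "integrable P (\<lambda>w. f i w / fact i * t ^ i)" if "i \<in> {1..n}" for i
      by (intro integrable_mult_left integrable_divide int[OF fm] that)
    then have si: "integrable P (\<lambda>w. \<Sum>i=1..n. f i w / fact i * t ^ i)" by (intro Bochner_Integration.integrable_sum)
    have "(LINT w|P. (\<Sum>i=1..n. f i w / fact i * t ^ i)) = (\<Sum>i=1..n. LINT w|P. f i w / fact i * t ^ i)"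
      using i by (rule Bochner_Integration.integral_sum)
    then show ?thesis
      unfolding Bochner_Integration.integral_add[OF Bochner_Integration.integrable_add[OF int[OF g gB] si] int[OF Rm Rb]]
        Bochner_Integration.integral_add[OF int[OF g gB] si] by simp
  qed
  also have "(\<Sum>i=1..n. (LINT w|P. f i w) / fact i * t ^ i) = (\<Sum>i=1..n. cp_expect r t (f i) 0 / fact i * t ^ i)"
    using PI[OF fm] by (intro sum.cong) auto
  finally have 2: "(LINT w|P. S w) = (LINT w|P. g w) + (\<Sum>i=1..n. cp_expect r t (f i) 0 / fact i * t ^ i) + (LINT w|P. R w)" .

  have R: "\<bar>LINT w|P. R w\<bar> \<le> exp ?l * t ^ (n + 1)"
  proof -
    have "\<bar>LINT w|P. R w\<bar> \<le> (LINT w|P. \<bar>R w\<bar>)" by (rule integral_abs_bound)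
    also have "\<dots> \<le> (LINT w|P. exp ?l * t ^ (n + 1))"
      by (intro integral_mono integrable_abs int[OF Rm Rb] P.integrable_const Rb)
    finally show ?thesis using P.prob_space by simp
  qed
  have H0: "0 \<le> H" and hm: "h \<in> borel_measurable borel" and hB: "\<And>x. \<bar>h x\<bar> \<le> H"
    using Cb_nonneg[OF h(1)] Cb_measurable[OF h(1)] Cb_bound[OF h(1)] by auto
  have G: "\<bar>LINT w|P. g w\<bar> \<le> K ^ (n + 1) * H * t ^ (n + 1)"
  proof -
    \<comment> \<open>All Taylor terms of \<open>h\<close> up to order n disappear, so only the
      remainder of order n+1 is left.\<close>
    have "(cp_gen r ^^ m) h 0 = 0" if "m < n + 1" for m
    proof (rule cp_gen_iterate_vanishes[OF r supp, of \<epsilon> 0])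
      fix x assume "\<bar>x\<bar> \<le> 0 + real m * \<epsilon>"
      moreover have "real m * \<epsilon> \<le> n * \<epsilon>" using that \<epsilon> by (intro mult_right_mono) auto
      ultimately show "h x = 0" by (intro h(2)) simp
    qed (use \<epsilon> in auto)
    then have "\<bar>cp_expect r t h 0\<bar> \<le> K ^ (n + 1) * H / fact (n + 1) * t ^ (n + 1)"
      using cp_expect_taylor[OF r t(1) _ hm hB K(2)[OF h(1)], of 0] by simp
    also have "\<dots> \<le> K ^ (n + 1) * H * t ^ (n + 1)"
    proof (intro mult_right_mono)
      have "K ^ (n + 1) * H / fact (n + 1) \<le> K ^ (n + 1) * H / 1"
        using K(1) H0 fact_ge_1[of "n + 1", where 'a = real] by (intro divide_left_mono) auto
      then show "K ^ (n + 1) * H / fact (n + 1) \<le> K ^ (n + 1) * H" by simp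
    qed (use t0 in simp)
    finally have "(LINT w|P. h w) \<le> K ^ (n + 1) * H * t ^ (n + 1)" using PI[OF hm hB] by simp
    moreover have "(LINT w|P. g w) \<le> (LINT w|P. h w)" by (intro integral_mono int[OF g gB] int[OF hm hB] g01)
    moreover have "0 \<le> (LINT w|P. g w)" by (intro Bochner_Integration.integral_nonneg g01)
    ultimately show ?thesis by simp
  qed
  have f': "\<bar>cp_expect r t (f i) 0 / fact i * t ^ i - (\<Sum>l<n + 1 - i. (cp_gen r ^^ l) (f i) 0 / fact l * t ^ l) / fact i * t ^ i\<bar>
      \<le> K ^ (n + 1) * F * t ^ (n + 1)" (is "\<bar>?a / _ * _ - ?b / _ * _\<bar> \<le> _") if i: "i \<in> {1..n}" for i
  proof -
    \<comment> \<open>The factor \<open>t ^ i\<close> already supplies i orders, so the expansion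
      stops at order n - i. As i is at least 1, \<open>2 * n\<close> derivatives suffice for the
      remainder.\<close>
    have c: "Cb UNIV (2 * (n + 1 - i)) F (f i)" using i by (intro Cb_antimono[OF f(2)]) auto
    have N: "0 < n + 1 - i" using i by auto
    have "\<bar>?a - ?b\<bar> \<le> K ^ (n + 1 - i) * F / fact (n + 1 - i) * t ^ (n + 1 - i)"
      by (rule cp_expect_taylor[OF r t(1) N fm[OF i] K(2)[OF c]])
    also have "\<dots> \<le> K ^ (n + 1) * F * t ^ (n + 1 - i)"
    proof (intro mult_right_mono)
      have "K ^ (n + 1 - i) * F / fact (n + 1 - i) \<le> K ^ (n + 1 - i) * F / 1"
        using K(1) F fact_ge_1[of "n + 1 - i", where 'a = real] by (intro divide_left_mono) auto
      also have "\<dots> \<le> K ^ (n + 1) * F" using K(1) F by (simp add: mult_right_mono power_increasing del: power_Suc)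
      finally show "K ^ (n + 1 - i) * F / fact (n + 1 - i) \<le> K ^ (n + 1) * F" .
    qed (use t0 in simp)
    finally have d: "\<bar>?a - ?b\<bar> \<le> K ^ (n + 1) * F * t ^ (n + 1 - i)" .
    have "\<bar>?a / fact i * t ^ i - ?b / fact i * t ^ i\<bar> = \<bar>?a - ?b\<bar> * (t ^ i / fact i)"
      using t0 by (simp add: diff_divide_distrib[symmetric] left_diff_distrib[symmetric] abs_mult del: of_nat_Suc)
    also have "\<dots> \<le> (K ^ (n + 1) * F * t ^ (n + 1 - i)) * (t ^ i / 1)"
      using d t0 K(1) F fact_ge_1[of i, where 'a = real] by (intro mult_mono divide_left_mono mult_nonneg_nonneg) auto
    also have "\<dots> = K ^ (n + 1) * F * t ^ (n + 1)" using i by (simp add: power_add[symmetric] del: power_Suc)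
    finally show ?thesis .
  qed
  let ?E = "\<Sum>i=1..n. (\<Sum>l<n + 1 - i. (cp_gen r ^^ l) (f i) 0 / fact l * t ^ l) / fact i * t ^ i"
  have "\<bar>(\<Sum>i=1..n. cp_expect r t (f i) 0 / fact i * t ^ i) - ?E\<bar> \<le> (\<Sum>i=1..n. K ^ (n + 1) * F * t ^ (n + 1))"
    unfolding sum_subtractf[symmetric] by (rule order_trans[OF sum_abs sum_mono[OF f']])
  with G R have 3: "\<bar>(LINT w|P. S w) - ?E\<bar> \<le> (K ^ (n + 1) * H + n * (K ^ (n + 1) * F) + exp ?l) * t ^ (n + 1)"
    unfolding 2 distrib_right by (simp only: sum_constant card_atLeastAtMost) (simp add: algebra_simps)
  have "\<bar>exp (- t * ?l) * (LINT w|P. S w) - exp (- t * ?l) * ?E\<bar> = exp (- t * ?l) * \<bar>(LINT w|P. S w) - ?E\<bar>"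
    by (simp add: right_diff_distrib[symmetric] abs_mult)
  also have "\<dots> \<le> 1 * \<bar>(LINT w|P. S w) - ?E\<bar>"
    using l t0 by (intro mult_right_mono) auto
  also have "\<dots> \<le> (K ^ (n + 1) * H + n * (K ^ (n + 1) * F) + exp ?l) * t ^ (n + 1)"
    using 3 by (simp only: mult_1)
  finally show ?thesis unfolding 1 .
qed

text \<open>With l = j - i the binomial coefficient over \<open>fact j\<close> splits into the
  reciprocals of \<open>fact i\<close> and \<open>fact l\<close>, and the triangle 1 \<le> i \<le> j
  \<le> n becomes i \<ge> 1, i + l \<le> n.\<close>

lemma expansion_reindex:
  fixes a :: "nat \<Rightarrow> nat \<Rightarrow> real"
  shows "(\<Sum>j=1..n. (\<Sum>i=1..j. real (j choose i) * a (j - i) i) * t ^ j / fact j)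
    = (\<Sum>i=1..n. (\<Sum>l<n + 1 - i. a l i / fact l * t ^ l) / fact i * t ^ i)"
proof -
  have "(\<Sum>j=1..n. (\<Sum>i=1..j. real (j choose i) * a (j - i) i) * t ^ j / fact j)
    = (\<Sum>j=1..n. \<Sum>i=1..j. a (j - i) i / fact (j - i) / fact i * t ^ (j - i) * t ^ i)"
  proof (intro sum.cong refl)
    fix j
    have "real (j choose i) * a (j - i) i * t ^ j / fact j = a (j - i) i / fact (j - i) / fact i * t ^ (j - i) * t ^ i"
      if "i \<in> {1..j}" for i
      using that binomial_fact[of i j, where 'a = real] by (simp add: power_add[symmetric] field_simps)
    then show "(\<Sum>i=1..j. real (j choose i) * a (j - i) i) * t ^ j / fact j
      = (\<Sum>i=1..j. a (j - i) i / fact (j - i) / fact i * t ^ (j - i) * t ^ i)"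
      unfolding sum_distrib_right sum_divide_distrib by (intro sum.cong) auto
  qed
  also have "\<dots> = (\<Sum>(j, i)\<in>(SIGMA j:{1..n}. {1..j}). a (j - i) i / fact (j - i) / fact i * t ^ (j - i) * t ^ i)"
    by (rule sum.Sigma) auto
  also have "\<dots> = (\<Sum>(i, l)\<in>(SIGMA i:{1..n}. {..<n + 1 - i}). a l i / fact l / fact i * t ^ l * t ^ i)"
    by (rule sum.reindex_bij_witness[where i = "\<lambda>(i, l). (i + l, i)" and j = "\<lambda>(j, i). (i, j - i)"]) auto
  also have "\<dots> = (\<Sum>i=1..n. \<Sum>l<n + 1 - i. a l i / fact l / fact i * t ^ l * t ^ i)"
    by (rule sum.Sigma[symmetric]) auto
  also have "\<dots> = (\<Sum>i=1..n. (\<Sum>l<n + 1 - i. a l i / fact l * t ^ l) / fact i * t ^ i)"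
    by (simp add: sum_distrib_right sum_divide_distrib)
  finally show ?thesis .
qed

section \<open>The expansion for the process\<close>

text \<open>The value \<open>s 0\<close> is arbitrary, even its sign, whence the normalisation.\<close>

definition punctured :: "(real \<Rightarrow> real) \<Rightarrow> real \<Rightarrow> real" where
  "punctured s x = (if x = 0 then 0 else s x)"

context
  fixes s c :: "real \<Rightarrow> real" and \<nu> :: "real measure" and \<epsilon> :: real
  assumes s_nonneg: "\<forall>x. x \<noteq> 0 \<longrightarrow> 0 \<le> s x" and s_meas: "s \<in> borel_measurable borel"
    and \<nu>: "\<nu> = density lborel (\<lambda>x. ennreal (s x))" and levy: "levy_measure \<nu>"
    and c: "truncation_function \<epsilon> c" and \<epsilon>: "0 < \<epsilon>" "\<epsilon> \<le> 1"
begin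

lemma punctured_nonneg: "0 \<le> punctured s x"
  using s_nonneg by (simp add: punctured_def)

lemma punctured_measurable: "punctured s \<in> borel_measurable borel"
  unfolding punctured_def[abs_def] using s_meas by measurable

lemma truncation_measurable: "c \<in> borel_measurable borel"
  using truncation_Cb[OF c \<epsilon>(1), of 0] Cb_measurable by blast

lemma density_punctured: "\<nu> = density lborel (\<lambda>x. ennreal (punctured s x))"
  unfolding \<nu>
proof (rule density_cong)
  show "AE x in lborel. ennreal (s x) = ennreal (punctured s x)"
    using AE_lborel_singleton[of 0] by eventually_elim (simp add: punctured_def)
qed (use s_meas punctured_measurable in auto)

lemma sigma_finite_levy_density: "sigma_finite_measure \<nu>"
  unfolding \<nu> using s_meas by (subst sigma_finite_measure.sigma_finite_iff_density_finite[OF lborel.sigma_finite_measure_axioms]) auto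

lemma
  fixes g :: "real \<Rightarrow> 'b::{banach, second_countable_topology}"
  assumes g: "g \<in> borel_measurable borel"
  shows integrable_levy_density: "integrable \<nu> g \<longleftrightarrow> integrable lborel (\<lambda>x. punctured s x *\<^sub>R g x)"
    and integral_levy_density: "integral\<^sup>L \<nu> g = (LBINT x. punctured s x *\<^sub>R g x)"
  unfolding density_punctured using g punctured_measurable punctured_nonneg
  by (simp_all add: integrable_density integral_density)

lemma integrable_min_punctured: "integrable lborel (\<lambda>x. punctured s x * min 1 (x\<^sup>2))"
  using levy_measure_integrable[OF levy] by (subst (asm) integrable_levy_density) simp_all

lemma integrable_dominated_punctured:
  fixes g :: "real \<Rightarrow> real"
  assumes [measurable]: "g \<in> borel_measurable borel" and C: "\<And>x. \<bar>g x\<bar> \<le> C * min 1 (x\<^sup>2)"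
  shows "integrable lborel (\<lambda>x. punctured s x * g x)"
proof (rule Bochner_Integration.integrable_bound)
  show "integrable lborel (\<lambda>x. C * (punctured s x * min 1 (x\<^sup>2)))"
    using integrable_min_punctured by simp
  note [measurable] = punctured_measurable
  show "(\<lambda>x. punctured s x * g x) \<in> borel_measurable lborel" by measurable
  show "AE x in lborel. norm (punctured s x * g x) \<le> norm (C * (punctured s x * min 1 (x\<^sup>2)))"
  proof (rule AE_I2)
    fix x
    have "\<bar>g x\<bar> \<le> \<bar>C\<bar> * min 1 (x\<^sup>2)"
      by (rule order_trans[OF C mult_right_mono[OF abs_ge_self]]) simp
    from mult_left_mono[OF this punctured_nonneg[of x]]
    have "punctured s x * \<bar>g x\<bar> \<le> punctured s x * (\<bar>C\<bar> * min 1 (x\<^sup>2))" .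
    then show "norm (punctured s x * g x) \<le> norm (C * (punctured s x * min 1 (x\<^sup>2)))"
      using punctured_nonneg[of x] by (simp add: abs_mult mult_ac)
  qed
qed

lemma truncation_zero: "1 < \<bar>w\<bar> \<Longrightarrow> c w = 0"
  using truncation_eq_0[OF c, of w] \<epsilon> by simp

lemma
  shows small_kernel_nonneg: "0 \<le> c w * punctured s w"
    and small_kernel_measurable: "(\<lambda>w. c w * punctured s w) \<in> borel_measurable borel"
    and small_kernel_integrable: "integrable lborel (\<lambda>w. w\<^sup>2 * (c w * punctured s w))"
    and small_kernel_support: "\<epsilon> < \<bar>w\<bar> \<Longrightarrow> c w * punctured s w = 0"
proof -
  note [measurable] = truncation_measurable punctured_measurable
  show "0 \<le> c w * punctured s w" using truncation_nonneg[OF c] punctured_nonneg by simp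
  show "(\<lambda>w. c w * punctured s w) \<in> borel_measurable borel" by measurable
  show "\<epsilon> < \<bar>w\<bar> \<Longrightarrow> c w * punctured s w = 0" using truncation_eq_0[OF c] by simp
  have "\<bar>w\<^sup>2 * c w\<bar> \<le> 1 * min 1 (w\<^sup>2)" for w
  proof (cases "\<bar>w\<bar> \<le> 1")
    case True
    then have "min 1 (w\<^sup>2) = w\<^sup>2" by (simp add: abs_square_le_1)
    then show ?thesis using truncation_nonneg[OF c, of w] truncation_le_1[OF c, of w] by (simp add: abs_mult mult_left_le)
  qed (simp add: truncation_zero)
  then have "integrable lborel (\<lambda>w. punctured s w * (w\<^sup>2 * c w))"
    by (intro integrable_dominated_punctured) measurable
  then show "integrable lborel (\<lambda>w. w\<^sup>2 * (c w * punctured s w))" by (simp add: mult_ac)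
qed

lemma sbar_eq: "sbar c s = (\<lambda>x. punctured s x * (1 - c x))"
  by (auto simp: sbar_def punctured_def)

lemma sbar_nonneg: "0 \<le> sbar c s x"
  using truncation_le_1[OF c, of x] punctured_nonneg[of x] by (simp add: sbar_eq)

text \<open>The left side is 0 up to \<epsilon> / 2 and at most 1 beyond, where
  \<open>min 1 (x\<^sup>2)\<close> is at least \<open>(\<epsilon> / 2)\<^sup>2\<close>.\<close>

lemma one_minus_truncation_le: "\<bar>1 - c x\<bar> \<le> 1 / (\<epsilon> / 2)\<^sup>2 * min 1 (x\<^sup>2)"
proof (cases "\<bar>x\<bar> \<le> \<epsilon> / 2")
  case True
  then show ?thesis by (simp add: truncation_eq_1[OF c])
next
  case False
  then have "(\<epsilon> / 2)\<^sup>2 \<le> min 1 (x\<^sup>2)"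
    using \<epsilon> power_mono[of "\<epsilon> / 2" "\<bar>x\<bar>" 2] by (auto simp: power_le_one)
  moreover have "1 \<le> 1 / e * m" if "0 < e" "e \<le> m" for e m :: real
    using that by (simp add: field_simps)
  ultimately have "1 \<le> 1 / (\<epsilon> / 2)\<^sup>2 * min 1 (x\<^sup>2)" using \<epsilon> by simp
  then show ?thesis using truncation_nonneg[OF c, of x] truncation_le_1[OF c, of x] by simp
qed

lemma sbar_integrable: "integrable lborel (sbar c s)"
  unfolding sbar_eq using truncation_measurable one_minus_truncation_le
  by (intro integrable_dominated_punctured[where C = "1 / (\<epsilon> / 2)\<^sup>2"]) simp_all

lemma lambda_eps_eq: "lambda_eps c \<nu> = mass (sbar c s)"
  unfolding lambda_eps_def sbar_eq using truncation_measurable by (subst integral_levy_density) auto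

text \<open>The small-jump part is compensated in full, the \<open>sbar\<close> part not at all. The
  compensator left over is that of \<open>1 - c\<close> on [-1, 1], and moving it to the drift is
  what changes \<open>b\<close> into \<open>b_eps\<close>.\<close>

lemma levy_exponent_split:
  "(\<i> * of_real (u * b) - of_real (v * u\<^sup>2 / 2) + (CLINT x|\<nu>. levy_integrand u x))
   = (\<i> * (u * b_eps c b \<nu>) - (v / 2) * u\<^sup>2 + (CLINT w|lborel. (c w * punctured s w) *\<^sub>R (iexp (u * w) - 1 - \<i> * (u * w))))
     + (fourier (sbar c s) u - of_real (mass (sbar c s)))"
proof -
  note [measurable] = truncation_measurable punctured_measurable
  let ?m = "\<lambda>w. punctured s w * (indicator {-1..1} w * (w * (1 - c w)))"
  have mi: "integrable lborel ?m"
  proof (rule integrable_dominated_punctured)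
    show "\<bar>indicator {-1..1} w * (w * (1 - c w))\<bar> \<le> 1 / (\<epsilon> / 2)\<^sup>2 * min 1 (w\<^sup>2)" for w
    proof (rule order_trans[OF _ one_minus_truncation_le])
      show "\<bar>indicator {-1..1} w * (w * (1 - c w))\<bar> \<le> \<bar>1 - c w\<bar>"
        using mult_left_le_one_le[of "\<bar>1 - c w\<bar>" "\<bar>w\<bar>"] by (cases "\<bar>w\<bar> \<le> 1") (auto simp: indicator_def abs_mult)
    qed
  qed measurable
  have be: "b_eps c b \<nu> = b - (LBINT w. ?m w)"
    unfolding b_eps_def set_lebesgue_integral_def by (subst integral_levy_density) (auto simp: mult_ac)
  have "(CLINT x|\<nu>. levy_integrand u x) = (CLINT w|lborel. punctured s w *\<^sub>R levy_integrand u w)"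
    by (rule integral_levy_density) simp
  also have "\<dots> = (CLINT w|lborel. (c w * punctured s w) *\<^sub>R (iexp (u * w) - 1 - \<i> * (u * w))
      + (sbar c s w *\<^sub>R iexp (u * w) - of_real (sbar c s w)) - \<i> * u * of_real (?m w))"
  proof (intro Bochner_Integration.integral_cong refl)
    fix w
    define p I C e where "p = complex_of_real (punctured s w)" and "I = complex_of_real (indicator {-1..1} w)"
      and "C = complex_of_real (c w)" and "e = iexp (u * w)"
    have IC: "I * C = C" using truncation_zero[of w] by (cases "\<bar>w\<bar> \<le> 1") (auto simp: indicator_def I_def C_def abs_le_iff)
    have "p * (e - 1 - I * (\<i> * (u * w))) = C * p * (e - 1 - \<i> * (u * w)) + (p * (1 - C) * e - p * (1 - C))
        - \<i> * u * (p * (I * (w * (1 - C)))) + p * (\<i> * (u * w)) * (C - I * C)"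
      by (simp add: algebra_simps)
    note this[unfolded IC diff_self mult_zero_right add_0_right]
    then show "punctured s w *\<^sub>R levy_integrand u w = (c w * punctured s w) *\<^sub>R (iexp (u * w) - 1 - \<i> * (u * w))
      + (sbar c s w *\<^sub>R iexp (u * w) - of_real (sbar c s w)) - \<i> * u * of_real (?m w)"
      unfolding levy_integrand_def sbar_eq scaleR_conv_of_real of_real_mult of_real_diff of_real_1
        p_def I_def C_def e_def by simp
  qed
  also have "\<dots> = (CLINT w|lborel. (c w * punctured s w) *\<^sub>R (iexp (u * w) - 1 - \<i> * (u * w)))
      + (fourier (sbar c s) u - of_real (mass (sbar c s))) - \<i> * u * of_real (LBINT w. ?m w)"
  proof -
    note i1 = small_exponent_integrable[OF small_kernel_measurable small_kernel_integrable, of u]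
    note i2 = integrable_iexp[OF sbar_integrable, of u]
    have i3: "integrable lborel (\<lambda>w. complex_of_real (sbar c s w))" using sbar_integrable by simp
    have i4: "integrable lborel (\<lambda>w. \<i> * u * of_real (?m w))" using mi by (intro integrable_mult_right integrable_of_real)
    have "(CLINT w|lborel. \<i> * u * of_real (?m w)) = \<i> * u * of_real (LBINT w. ?m w)"
      unfolding integral_mult_right_zero integral_complex_of_real ..
    then show ?thesis
      unfolding fourier_def
        Bochner_Integration.integral_diff[OF Bochner_Integration.integrable_add[OF i1 Bochner_Integration.integrable_diff[OF i2 i3]] i4]
        Bochner_Integration.integral_add[OF i1 Bochner_Integration.integrable_diff[OF i2 i3]]
        Bochner_Integration.integral_diff[OF i2 i3] integral_complex_of_real by simp
  qed
  finally show ?thesis unfolding be by (simp add: algebra_simps)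
qed

end

text \<open>To the right of \<open>a\<close> the function is a shifted \<open>1 - c\<close>, which
  is flat 0 up to \<open>a + \<epsilon> / 2\<close> and 1 beyond \<open>a + \<epsilon>\<close>. The
  flat piece lets the zero branch on the left be glued on smoothly.\<close>

lemma smoothed_step_Cb:
  assumes c: "truncation_function \<epsilon> c" and \<epsilon>: "0 < \<epsilon>"
  shows "\<exists>H. Cb UNIV k H (\<lambda>x. if x \<le> a then 0 else 1 - c (x - a))"
proof -
  let ?h = "\<lambda>x. if x \<le> a then 0 else 1 - c (x - a)"
  obtain E where E: "Cb UNIV k E c" using truncation_Cb[OF assms] by metis
  have "Cb UNIV k (1 + E) (\<lambda>x. 1 - c (- a + 1 * x))"
    by (intro Cb_diff Cb_const Cb_affine E) auto
  from Cb_mono[OF this order_refl, of "{a<..}"] have "Cb {a<..} k (1 + E) (\<lambda>x. 1 - c (x - a))" by simp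
  then have 1: "Cb {a<..} k (1 + E) ?h"
    by (subst Cb_cong[where g = "\<lambda>x. 1 - c (x - a)"]) auto
  have "Cb {..<a + \<epsilon> / 2} k (1 + E) (\<lambda>x. 0)" using Cb_nonneg[OF E] by (intro Cb_const) simp
  then have 2: "Cb {..<a + \<epsilon> / 2} k (1 + E) ?h"
    by (subst Cb_cong[where g = "\<lambda>x. 0"]) (auto simp: truncation_eq_1[OF c])
  have "{a<..} \<union> {..<a + \<epsilon> / 2} = UNIV" using \<epsilon> by auto
  with Cb_Un[OF _ _ 1 2] show ?thesis by auto
qed

text \<open>Differentiability is not assumed: \<open>deriv\<close> selects among the possible
  derivative values, and a shift leaves the set of these unchanged.\<close>

lemma deriv_shift: "deriv (\<lambda>x. g (x - a)) = (\<lambda>x. deriv g (x - a))" for a :: real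
proof
  fix x
  have "((\<lambda>x. g (x - a)) has_field_derivative D) (at x) \<longleftrightarrow> (g has_field_derivative D) (at (x - a))" for D
    using DERIV_shift[of g D x "- a"] by simp
  then show "deriv (\<lambda>x. g (x - a)) x = deriv g (x - a)" by (simp add: deriv_def)
qed

text \<open>Translation invariance turns the dependence on \<open>y\<close> into evaluation at a
  shifted point, so that continuity in \<open>y\<close> of the coefficients follows from continuity
  in \<open>x\<close>.\<close>

lemma levy_op_shift: "levy_op a v q (\<lambda>x. g (x - y)) = (\<lambda>x. levy_op a v q g (x - y))"
  by (auto simp: levy_op_def numeral_2_eq_2 deriv_shift fun_eq_iff add_diff_eq diff_add_eq)

lemma levy_op_iterate_shift: "(levy_op a v q ^^ j) (\<lambda>x. g (x - y)) = (\<lambda>x. (levy_op a v q ^^ j) g (x - y))"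
proof (induction j)
  case (Suc j)
  then show ?case using levy_op_shift[of a v q "(levy_op a v q ^^ j) g" y] by simp
qed simp

lemma f_hat_shift: "f_hat c s y i = (\<lambda>x. f_hat c s 0 i (x - y))"
  by (simp add: f_hat_def fun_eq_iff)

text \<open>Countably many atoms do not matter: a bound at all other points passes to left limits.\<close>

lemma (in real_distribution) tail_bound_from_nonatoms:
  assumes "a < y" and cont: "isCont E y"
    and bd: "\<And>z. a < z \<Longrightarrow> measure M {z} = 0 \<Longrightarrow> \<bar>(1 - cdf M z) - E z\<bar> \<le> B"
  shows "\<bar>measure M {y..} - E y\<bar> \<le> B"
proof (rule ccontr)
  assume nb: "\<not> ?thesis"
  have E: "(E \<longlongrightarrow> E y) (at_left y)"
    using cont by (auto simp: continuous_at intro: tendsto_within_subset)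
  have "((\<lambda>z. \<bar>(1 - cdf M z) - E z\<bar>) \<longlongrightarrow> \<bar>(1 - measure M {..<y}) - E y\<bar>) (at_left y)"
    by (intro tendsto_intros E cdf_at_left)
  moreover have "1 - measure M {..<y} = measure M {y..}"
    using prob_compl[of "{..<y}"] by (simp add: Compl_eq_Diff_UNIV[symmetric])
  ultimately have "eventually (\<lambda>z. B < \<bar>(1 - cdf M z) - E z\<bar>) (at_left y)"
    using nb by (intro order_tendstoD(1)) auto
  then obtain b where b: "b < y" "\<And>z. b < z \<Longrightarrow> z < y \<Longrightarrow> B < \<bar>(1 - cdf M z) - E z\<bar>"
    unfolding eventually_at_left[OF \<open>a < y\<close>] by auto
  \<comment> \<open>Were the bound to fail at \<open>y\<close>, it would fail on a whole interval to
    the left, which is uncountable and so contains a point that is not an atom.\<close>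
  have "\<not> {max a b<..<y} \<subseteq> {z. measure M {z} \<noteq> 0}"
    using uncountable_open_interval[of "max a b" y] countable_subset[OF _ countable_support] b(1) \<open>a < y\<close> by auto
  then obtain z where z: "z \<in> {max a b<..<y}" "measure M {z} = 0" by blast
  then show False using bd[of z] b(2)[of z] by simp
qed

theorem theorem3p2:
  fixes M :: "'w measure" and X :: "real \<Rightarrow> 'w \<Rightarrow> real"
    and \<sigma> b \<epsilon> y\<^sub>0 :: real and \<nu> :: "real measure" and s c :: "real \<Rightarrow> real" and n :: nat
  assumes "y\<^sub>0 > 0" and "n \<ge> 1" and "0 < \<epsilon>" and "\<epsilon> < min (y\<^sub>0 / (real n + 1)) 1"
    and "truncation_function \<epsilon> c"
    and "levy_process M X" and "has_levy_triplet M X (\<sigma>\<^sup>2) b \<nu>"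
    and "\<And>x. x \<noteq> 0 \<Longrightarrow> s x \<ge> 0"
    and "\<nu> = density lborel (\<lambda>x. ennreal (s x))"
    and "\<And>k x. k < 2 * n + 1 \<Longrightarrow> x \<noteq> 0 \<Longrightarrow> (deriv ^^ k) s field_differentiable at x"
    and "\<And>k \<delta>. k \<le> 2 * n + 1 \<Longrightarrow> \<delta> > 0 \<Longrightarrow> bounded ((deriv ^^ k) s ` {x. \<bar>x\<bar> > \<delta>})"
  shows "\<exists>t\<^sub>0>0. \<exists>C. \<forall>y\<ge>y\<^sub>0. \<forall>t. 0 < t \<and> t < t\<^sub>0 \<longrightarrow>
    \<bar>measure M {\<omega>\<in>space M. X t \<omega> \<ge> y}
      - exp (- lambda_eps c \<nu> * t)
          * (\<Sum>j=1..n. expansion_coeff c s (\<sigma>\<^sup>2) b \<nu> y j * t ^ j / fact j)\<bar>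
    \<le> C * t ^ (n + 1)"

proof -
  interpret M: prob_space M using assms(6) by (simp add: levy_process_def)
  \<comment> \<open>Of the (n+1) \<epsilon> below \<open>y\<^sub>0\<close>, n \<epsilon> are the
    reach of n small jumps; the last \<epsilon> is the room in which the majorant rises to
    1.\<close>
  have \<epsilon>1: "\<epsilon> \<le> 1" and y0: "(n + 1) * \<epsilon> < y\<^sub>0"
    using assms(3,4) by (simp_all add: less_divide_eq algebra_simps)
  have levy: "levy_measure \<nu>" using assms(7) by (simp add: has_levy_triplet_def)
  have s_meas: "s \<in> borel_measurable borel"
  proof (rule borel_measurable_continuous_countable_exceptions[of "{0}"])
    have "s field_differentiable at x" if "x \<noteq> 0" for x using assms(10)[of 0 x] that by simp
    then show "continuous_on (- {0}) s"
      by (intro continuous_at_imp_continuous_on ballI field_differentiable_imp_continuous_at) simp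
  qed simp
  have s_nonneg: "\<forall>x. x \<noteq> 0 \<longrightarrow> 0 \<le> s x" using assms(8) by blast
  note ctx = s_nonneg s_meas assms(9) levy assms(5) assms(3) \<epsilon>1
  let ?s = "sbar c s" and ?l = "mass (sbar c s)" and ?a = "b_eps c b \<nu>"
  let ?q = "\<lambda>w. c w * punctured s w"
  let ?L = "levy_op ?a (\<sigma>\<^sup>2 / 2) ?q"
  have s0: "\<And>x. 0 \<le> ?s x" by (rule sbar_nonneg[OF ctx])
  have si: "integrable lborel ?s" by (rule sbar_integrable[OF ctx])
  have l0: "0 \<le> ?l" by (rule Bochner_Integration.integral_nonneg) (rule s0)
  have q2: "?q \<in> borel_measurable borel" "integrable lborel (\<lambda>w. w\<^sup>2 * ?q w)"
    using small_kernel_measurable[OF ctx] small_kernel_integrable[OF ctx] .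
  \<comment> \<open>The derivatives of \<open>s\<close> up to order \<open>2 * n\<close> are
    differentiable, hence continuous, away from 0. The tails gain one order, and
    \<open>2 * n + 1\<close> covers both the remainders and the limits of the coefficients.\<close>
  obtain B where "Cb UNIV (2 * n) B ?s"
    using sbar_Cb[OF assms(5,3), of "2 * n" s] assms(10,11) by auto
  then have "\<forall>i. \<exists>F. \<forall>y. Cb UNIV (Suc (2 * n)) F (f_hat c s y (Suc i))"
    using f_hat_Cb[OF s0 si] by blast
  from choice[OF this] obtain F where F: "\<And>i y. Cb UNIV (Suc (2 * n)) (F i) (f_hat c s y (Suc i))" by blast
  define G where "G = (\<Sum>i<n. F i)"
  have F0: "0 \<le> F i" for i using Cb_nonneg[OF F] .
  then have G0: "0 \<le> G" unfolding G_def by (intro sum_nonneg) auto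
  have fC: "Cb UNIV (2 * n + 1) G (f_hat c s y i)" if "i \<in> {1..n}" for i y
  proof -
    obtain j where i: "i = Suc j" "j < n"
      using \<open>i \<in> {1..n}\<close> by (metis Suc_le_lessD Suc_pred' atLeastAtMost_iff less_eq_Suc_le One_nat_def)
    have "F j \<le> G" unfolding G_def using i(2) F0 by (intro member_le_sum) auto
    from Cb_mono[OF F this subset_UNIV] show ?thesis unfolding i(1) by (simp del: Cb.simps)
  qed
  \<comment> \<open>A smooth majorant of the indicator of \<open>(y, \<infinity>)\<close> that vanishes where at most \<open>n\<close> small jumps can lead.\<close>
  define h where "h = (\<lambda>x. if x \<le> n * \<epsilon> then 0 else 1 - c (x - n * \<epsilon>))"
  obtain H where H: "Cb UNIV (2 * (n + 1)) H h"
    unfolding h_def using smoothed_step_Cb[OF assms(5,3)] by blast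
  have "0 \<le> \<sigma>\<^sup>2 / 2" by simp
  from small_jump_sequence[where a = ?a, OF small_kernel_nonneg[OF ctx] q2 small_kernel_support[OF ctx] assms(3) \<epsilon>1 this]
  obtain r K where K: "1 \<le> K" and r0: "\<And>m w. 0 \<le> r m w" and ri: "\<And>m. integrable lborel (r m)"
    and rs: "\<And>m w. \<epsilon> < \<bar>w\<bar> \<Longrightarrow> r m w = 0"
    and rK: "\<And>m j B g x. Cb UNIV (2 * j) B g \<Longrightarrow> \<bar>(cp_gen (r m) ^^ j) g x\<bar> \<le> K ^ j * B"
    and rlim: "\<And>j B g x. Cb UNIV (2 * j + 1) B g \<Longrightarrow> (\<lambda>m. (cp_gen (r m) ^^ j) g x) \<longlonglongrightarrow> (?L ^^ j) g x"
    by blast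
  define C where "C = K ^ (n + 1) * H + n * (K ^ (n + 1) * G) + exp ?l"
  define E where "E t z = exp (- t * ?l) * (\<Sum>i=1..n. (\<Sum>k<n + 1 - i. (?L ^^ k) (f_hat c s z i) 0 / fact k * t ^ k) / fact i * t ^ i)" for t z

  have fourier_lim: "(\<lambda>m. fourier (r m) u - of_real (mass (r m))) \<longlonglongrightarrow>
      \<i> * (u * ?a) - (\<sigma>\<^sup>2 / 2) * u\<^sup>2 + (CLINT w|lborel. ?q w *\<^sub>R (iexp (u * w) - 1 - \<i> * (u * w)))" (is "?f \<longlonglongrightarrow> ?\<psi>") for u
  proof -
    \<comment> \<open>The convergence of the generators is applied to waves at 0; the amplitudes 1
      and -\<i> deliver the real and the imaginary parts.\<close>
    have "(\<lambda>m. Re (z * ?f m)) \<longlonglongrightarrow> Re (z * ?\<psi>)" for z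
    proof -
      have "(\<lambda>m. (cp_gen (r m) ^^ 1) (wave u z) 0) \<longlonglongrightarrow> (?L ^^ 1) (wave u z) 0"
        by (rule rlim, rule Cb_wave)
      then show ?thesis
        unfolding One_nat_def funpow.simps comp_id cp_gen_wave[OF r0 ri] levy_op_wave[OF q2] .
    qed
    from this[of 1] this[of "- \<i>"] show ?thesis by (simp add: tendsto_complex_iff add.commute)
  qed

  \<comment> \<open>The range of \<open>z\<close> extends strictly below \<open>y\<^sub>0\<close>,
    which leaves room for left limits at \<open>y\<close>. The constant \<open>C\<close> depends
    neither on \<open>z\<close> nor on \<open>t\<close>.\<close>
  have key: "\<bar>(1 - cdf (distr M borel (X t)) z) - E t z\<bar> \<le> C * t ^ (n + 1)"
    if t: "0 < t" "t \<le> 1" and z: "(n + 1) * \<epsilon> < z" and na: "measure (distr M borel (X t)) {z} = 0" for t z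
  proof -
    have Xm: "X t \<in> borel_measurable M" using assms(6) t by (simp add: levy_process_def)
    interpret D: real_distribution "distr M borel (X t)" by (rule M.real_distribution_distr[OF Xm])
    have t0: "0 \<le> t" using t by simp
    have "\<forall>m. \<exists>P. real_distribution P \<and> (\<forall>g B. g \<in> borel_measurable borel \<longrightarrow> (\<forall>x. \<bar>g x\<bar> \<le> B) \<longrightarrow>
      (LINT w|P. g w) = cp_expect (r m) t (cp_expect ?s t g) 0)"
      using compound_poisson_pair_exists[OF r0 ri s0 si t0] by blast
    from choice[OF this] obtain P where P: "\<And>m. real_distribution (P m)"
      and PI: "\<And>m g B. g \<in> borel_measurable borel \<Longrightarrow> (\<And>x. \<bar>g x\<bar> \<le> B) \<Longrightarrow> (LINT w|P m. g w) = cp_expect (r m) t (cp_expect ?s t g) 0"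
      by blast
    have "weak_conv_m P (distr M borel (X t))"
    proof (rule levy_continuity[OF P D.real_distribution_axioms])
      fix u
      let ?\<psi> = "\<i> * (u * ?a) - (\<sigma>\<^sup>2 / 2) * u\<^sup>2 + (CLINT w|lborel. ?q w *\<^sub>R (iexp (u * w) - 1 - \<i> * (u * w)))"
      have "(\<lambda>m. exp (of_real t * (fourier ?s u - of_real ?l)) * exp (of_real t * (fourier (r m) u - of_real (mass (r m)))))
        \<longlonglongrightarrow> exp (of_real t * (fourier ?s u - of_real ?l)) * exp (of_real t * ?\<psi>)"
        by (intro tendsto_intros fourier_lim)
      also have "exp (of_real t * (fourier ?s u - of_real ?l)) * exp (of_real t * ?\<psi>) = char (distr M borel (X t)) u"
      proof -
        have "char (distr M borel (X t)) u = (CLINT \<omega>|M. iexp (u * X t \<omega>))"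
          unfolding char_def using Xm by (subst integral_distr) auto
        also have "\<dots> = exp (of_real t * (?\<psi> + (fourier ?s u - of_real ?l)))"
          unfolding levy_triplet_char[OF M.prob_space_axioms assms(7) Xm sigma_finite_levy_density[OF ctx] t(1)]
            levy_exponent_split[OF ctx] ..
        finally show ?thesis by (simp only: exp_add[symmetric] distrib_left add.commute)
      qed
      finally have "(\<lambda>m. exp (of_real t * (fourier ?s u - of_real ?l)) * exp (of_real t * (fourier (r m) u - of_real (mass (r m)))))
        \<longlonglongrightarrow> char (distr M borel (X t)) u" .
      moreover have "char (P m) u = exp (of_real t * (fourier ?s u - of_real ?l)) * exp (of_real t * (fourier (r m) u - of_real (mass (r m))))" for m
        by (rule char_compound_poisson_pair[OF r0 ri s0 si P]) (rule PI)
      ultimately show "(\<lambda>m. char (P m) u) \<longlonglongrightarrow> char (distr M borel (X t)) u"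
        by (simp only:)
    qed
    then have "(\<lambda>m. cdf (P m) z) \<longlonglongrightarrow> cdf (distr M borel (X t)) z"
      using na D.isCont_cdf unfolding weak_conv_m_def weak_conv_def by blast
    then have lim1: "(\<lambda>m. 1 - cdf (P m) z) \<longlonglongrightarrow> 1 - cdf (distr M borel (X t)) z"
      by (intro tendsto_intros)
    have lim2: "(\<lambda>m. exp (- t * ?l) * (\<Sum>i=1..n. (\<Sum>k<n + 1 - i. (cp_gen (r m) ^^ k) (f_hat c s z i) 0 / fact k * t ^ k) / fact i * t ^ i))
      \<longlonglongrightarrow> E t z"
      unfolding E_def
    proof (intro tendsto_intros)
      fix i k assume i: "i \<in> {1..n}" and k: "k \<in> {..<n + 1 - i}"
      have "Cb UNIV (2 * k + 1) G (f_hat c s z i)" using i k by (intro Cb_antimono[OF fC[OF i]]) auto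
      then show "(\<lambda>m. (cp_gen (r m) ^^ k) (f_hat c s z i) 0) \<longlonglongrightarrow> (?L ^^ k) (f_hat c s z i) 0" by (rule rlim)
    qed auto
    have "\<bar>(1 - cdf (P m) z) - exp (- t * ?l) * (\<Sum>i=1..n. (\<Sum>k<n + 1 - i. (cp_gen (r m) ^^ k) (f_hat c s z i) 0 / fact k * t ^ k) / fact i * t ^ i)\<bar>
      \<le> C * t ^ (n + 1)" for m
    proof -
      interpret P: real_distribution "P m" by (rule P)
      have "1 - cdf (P m) z = measure (P m) {z<..}"
        using P.prob_compl[of "{..z}"] by (simp add: cdf_def Compl_eq_Diff_UNIV[symmetric] Compl_atMost)
      also have "\<dots> = (LINT w|P m. indicator {z<..} w)" by simp
      also have "\<dots> = cp_expect (r m) t (cp_expect ?s t (indicator {z<..})) 0"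
        by (rule PI[of _ 1]) (auto simp: indicator_def)
      finally have eq: "1 - cdf (P m) z = cp_expect (r m) t (cp_expect ?s t (indicator {z<..})) 0" .
      \<comment> \<open>The distribution function yields the open half-line, whereas
        \<open>f_hat\<close> is defined with the closed one. After one convolution with a density
        the difference is gone; the term without large jumps keeps the open one.\<close>
      have "conv_op ?s (indicator {z<..}) x = conv_op ?s (indicator {z..}) x" for x
        unfolding conv_op_def
      proof (rule integral_cong_AE)
        show "AE w in lborel. ?s w * indicator {z<..} (x + w) = ?s w * indicator {z..} (x + w)"
          using AE_lborel_singleton[of "z - x"] by eventually_elim (auto simp: indicator_def)
      qed (use borel_measurable_integrable[OF si] in simp_all)
      then have "conv_op ?s (indicator {z<..}) = conv_op ?s (indicator {z..})" ..
      then have f: "f_hat c s z i = (conv_op ?s ^^ i) (indicator {z<..})" if "1 \<le> i" for i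
        using that f_hat_eq_conv_op_iterate[OF s0 si, of z "i - 1"] by (cases i) (simp_all add: funpow_Suc_right del: funpow.simps)
      \<comment> \<open>For \<open>x > z > (n + 1) * \<epsilon>\<close> the argument of
        \<open>c\<close> in \<open>h\<close> exceeds \<epsilon>, so that \<open>h\<close> equals
        1.\<close>
      have gh: "indicator {z<..} x \<le> h x" for x
      proof (cases "z < x")
        case True
        then have "c (x - n * \<epsilon>) = 0" "\<not> x \<le> n * \<epsilon>"
          using z assms(3) by (auto simp: algebra_simps intro!: truncation_eq_0[OF assms(5)])
        then show ?thesis by (simp add: h_def indicator_def)
      qed (use truncation_le_1[OF assms(5)] in \<open>simp add: h_def\<close>)
      show ?thesis unfolding eq C_def
      proof (rule cp_pair_expansion[where h = h and \<epsilon> = \<epsilon>, OF r0 ri rs _ s0 si K rK _ _ _ gh H _ f])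
        show "Cb UNIV (2 * n) G (f_hat c s z i)" if "1 \<le> i" "i \<le> n" for i
          using that by (intro Cb_antimono[OF fC]) auto
        show "h x = 0" if "\<bar>x\<bar> \<le> n * \<epsilon>" for x using that by (simp add: h_def)
      qed (use t G0 assms(3) in \<open>auto simp: indicator_def\<close>)
    qed
    then show ?thesis
      by (intro LIMSEQ_le_const2[OF tendsto_rabs[OF tendsto_diff[OF lim1 lim2]]]) auto
  qed

  have L_shift: "(?L ^^ k) (f_hat c s z i) 0 = (?L ^^ k) (f_hat c s 0 i) (- z)" for k z i
    unfolding f_hat_shift[of c s z] levy_op_iterate_shift by simp
  have cont: "isCont (E t) y" for t y
  proof -
    have "isCont (\<lambda>z. (?L ^^ k) (f_hat c s z i) 0) y" if i: "i \<in> {1..n}" and k: "k \<in> {..<n + 1 - i}" for i k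
    proof -
      have "Cb UNIV (2 * k + 0) G (f_hat c s 0 i)" using i k by (intro Cb_antimono[OF fC[OF i]]) auto
      from Cb_continuous[OF Cb_levy_op_iterate[OF q2 order_refl this]]
      have "isCont ((?L ^^ k) (f_hat c s 0 i)) (- y)" by (simp add: continuous_on_eq_continuous_at)
      moreover have "isCont (\<lambda>z::real. - z) y" by (intro continuous_intros)
      ultimately show ?thesis unfolding L_shift by (rule isCont_o2[rotated])
    qed
    then show ?thesis unfolding E_def by (intro continuous_intros) auto
  qed
  have "\<bar>measure M {\<omega>\<in>space M. X t \<omega> \<ge> y} - exp (- lambda_eps c \<nu> * t)
          * (\<Sum>j=1..n. expansion_coeff c s (\<sigma>\<^sup>2) b \<nu> y j * t ^ j / fact j)\<bar> \<le> C * t ^ (n + 1)"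
    if "y\<^sub>0 \<le> y" and t: "0 < t" "t < 1" for t y
  proof -
    have Xm: "X t \<in> borel_measurable M" using assms(6) t by (simp add: levy_process_def)
    interpret D: real_distribution "distr M borel (X t)" by (rule M.real_distribution_distr[OF Xm])
    have "{\<omega>\<in>space M. X t \<omega> \<ge> y} = X t -` {y..} \<inter> space M" by auto
    then have 1: "measure M {\<omega>\<in>space M. X t \<omega> \<ge> y} = measure (distr M borel (X t)) {y..}"
      using Xm by (simp add: measure_distr)
    have "(L_eps c s (\<sigma>\<^sup>2) b \<nu> ^^ k) (f_hat c s y i) = (?L ^^ k) (f_hat c s y i)"
      if i: "i \<in> {1..n}" and k: "k < n + 1 - i" for i k
    proof (rule L_eps_iterate_eq_levy_op[OF q2])
      show "Cb UNIV (2 * k) G (f_hat c s y i)" using i k by (intro Cb_antimono[OF fC[OF i]]) auto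
    qed (simp add: punctured_def)
    then have 2: "exp (- lambda_eps c \<nu> * t) * (\<Sum>j=1..n. expansion_coeff c s (\<sigma>\<^sup>2) b \<nu> y j * t ^ j / fact j) = E t y"
      unfolding expansion_coeff_def E_def lambda_eps_eq[OF ctx]
        expansion_reindex[where a = "\<lambda>k i. (L_eps c s (\<sigma>\<^sup>2) b \<nu> ^^ k) (f_hat c s y i) 0"]
      by (simp add: mult.commute[of t])
    have "(n + 1) * \<epsilon> < y" using y0 that(1) by simp
    then show ?thesis unfolding 1 2
      using t by (intro D.tail_bound_from_nonatoms[OF _ cont key]) auto
  qed
  \<comment> \<open>The only restriction on time is \<open>t\<close> at most 1, from the tail of the
    series in the number of large jumps.\<close>
  then show ?thesis by (intro exI[of _ 1] exI[of _ C]) auto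
qed

end
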